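(* Let $\Gamma=(X,\mathcal{R})$ be a non-bipartite distance-regular graph with classical parameters $(D,q,\alpha,\beta)$, where $D\ge 4$ and $q\ge 2$, and fix $x\in X$. Let $T=T(x)$ be the Terwilliger algebra of $\Gamma$ with respect to $x$. Assume that every irreducible $T$-module with endpoint $1$ is thin, that $\Gamma$ supports a uniform structure with respect to $x$, and that $\alpha\ne0$. Then $\alpha\in\{q,q+1\}$.
   Context: All graphs are finite, simple, connected, undirected; $\partial$ denotes path-length distance. $\Gamma$ is distance-regular with diameter $D$ if for all $0\le h,i,j\le D$ and all $y,z$ with $\partial(y,z)=h$ the number $p^h_{ij}=|\{w:\partial(y,w)=i,\ \partial(z,w)=j\}|$ depends only on $h,i,j$; write $c_i=p^i_{1,i-1}$, $b_i=p^i_{1,i+1}$. $\Gamma$ has classical parameters $(D,q,\alpha,\beta)$ if $c_i=[i](1+\alpha[i-1])$ for $1\le i\le D$ and $b_i=([D]-[i])(\beta-\alpha[i])$ for $0\le i\le D-1$, where $[j]=1+q+\cdots+q^{j-1}$. Let $V=\mathbb{C}^X$ and $A$ the adjacency matrix. For fixed $x$ and $0\le i\le D$, $E_i^*$ is the diagonal matrix with $(y,y)$-entry $1$ if $\partial(x,y)=i$ and $0$ otherwise. $T=T(x)$ is the algebra generated by $A$ and $E_0^*,\dots,E_D^*$. A $T$-module is a subspace $W\subseteq V$ with $TW\subseteq W$; irreducible if $W\ne0$ with only submodules $0,W$; its endpoint is $\min\{i:E_i^*W\ne0\}$; thin if $\dim E_i^*W\le1$ for all $i$. $L=\sum_{i=1}^{D}E^*_{i-1}AE^*_i$,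 $R=\sum_{i=0}^{D-1}E^*_{i+1}AE^*_i$. $\Gamma$ supports a uniform structure with respect to $x$ if there exist a tridiagonal complex matrix $U=(e_{ij})_{1\le i,j\le D}$ with $e_{ii}=1$, such that either $e_{i,i-1}\ne0$ for all $2\le i\le D$ or $e_{i-1,i}\ne0$ for all $2\le i\le D$, and every principal submatrix $(e_{ij})_{s\le i,j\le t}$ is nonsingular, and scalars $f_1,\dots,f_D$ such that, with $e_i^-=e_{i,i-1}$ ($e_1^-=0$) and $e_i^+=e_{i,i+1}$ ($e_D^+=0$), $e_i^-RL^2+LRL+e_i^+L^2R=f_iL$ holds on $E_i^*V$ for $1\le i\le D$. *)

theory Defs
  imports "HOL-Analysis.Analysis" "Jordan_Normal_Form.Determinant"
begin

(* Vertex-indexed vectors and matrices are those of HOL-Analysis.  Jordan_Normal_Form supplies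
   the determinant of a matrix of varying size; its "det" and "mat" are written qualified. *)
no_notation Matrix.vec_index (infixl "$" 100)

section \<open>Distance-regular graphs\<close>

text \<open>A finite graph is given by its adjacency relation on a finite type of vertices.\<close>

type_synonym 'v graph = "'v \<Rightarrow> 'v \<Rightarrow> bool"

definition connected_simple_graph :: "'v::finite graph \<Rightarrow> bool" where
  "connected_simple_graph G \<longleftrightarrow> symp G \<and> irreflp G \<and> (\<forall>y z. G\<^sup>*\<^sup>* y z)"

definition bipartite :: "'v::finite graph \<Rightarrow> bool" where
  "bipartite G \<longleftrightarrow> (\<exists>Y. \<forall>y z. G y z \<longrightarrow> (y \<in> Y \<longleftrightarrow> z \<notin> Y))"

definition gdist :: "'v::finite graph \<Rightarrow> 'v \<Rightarrow> 'v \<Rightarrow> nat" where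
  "gdist G y z = (LEAST n. (G ^^ n) y z)"

definition gdiam :: "'v::finite graph \<Rightarrow> nat" where
  "gdiam G = Max {gdist G y z | y z. True}"

definition meet_sphere :: "'v::finite graph \<Rightarrow> nat \<Rightarrow> nat \<Rightarrow> 'v \<Rightarrow> 'v \<Rightarrow> 'v set" where
  "meet_sphere G i j y z = {w. gdist G y w = i \<and> gdist G z w = j}"

definition distance_regular :: "'v::finite graph \<Rightarrow> bool" where
  "distance_regular G \<longleftrightarrow>
     (\<forall>h\<le>gdiam G. \<forall>i\<le>gdiam G. \<forall>j\<le>gdiam G. \<exists>p. \<forall>y z.
        gdist G y z = h \<longrightarrow> card (meet_sphere G i j y z) = p)"

text \<open>The number \<open>p\<^sup>h\<^sub>i\<^sub>j\<close>; unique in a connected distance-regular graph, as every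
  \<open>h \<le> gdiam G\<close> is then the distance of some pair of vertices.\<close>

definition intersection_number :: "'v::finite graph \<Rightarrow> nat \<Rightarrow> nat \<Rightarrow> nat \<Rightarrow> nat" where
  "intersection_number G h i j =
     (THE p. \<forall>y z. gdist G y z = h \<longrightarrow> card (meet_sphere G i j y z) = p)"

definition c_num :: "'v::finite graph \<Rightarrow> nat \<Rightarrow> nat" where
  "c_num G i = intersection_number G i 1 (i - 1)"

definition b_num :: "'v::finite graph \<Rightarrow> nat \<Rightarrow> nat" where
  "b_num G i = intersection_number G i 1 (i + 1)"

definition qbracket :: "real \<Rightarrow> nat \<Rightarrow> real" where
  "qbracket q j = (\<Sum>k<j. q ^ k)"

definition classical_parameters ::
    "'v::finite graph \<Rightarrow> nat \<Rightarrow> real \<Rightarrow> real \<Rightarrow> real \<Rightarrow> bool" where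
  "classical_parameters G D q \<alpha> \<beta> \<longleftrightarrow>
     gdiam G = D \<and>
     (\<forall>i\<in>{1..D}. real (c_num G i) = qbracket q i * (1 + \<alpha> * qbracket q (i - 1))) \<and>
     (\<forall>i<D. real (b_num G i) = (qbracket q D - qbracket q i) * (\<beta> - \<alpha> * qbracket q i))"

section \<open>The Terwilliger algebra and its modules\<close>

definition adj_mat :: "'v::finite graph \<Rightarrow> complex^'v^'v" where
  "adj_mat G = (\<chi> y z. if G y z then 1 else 0)"

definition dual_idem :: "'v::finite graph \<Rightarrow> 'v \<Rightarrow> nat \<Rightarrow> complex^'v^'v" where
  "dual_idem G x i = (\<chi> y z. if y = z \<and> gdist G x y = i then 1 else 0)"

text \<open>No unit rule is needed: the identity matrix is the sum of the \<open>dual_idem G x i\<close>.\<close>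

inductive_set terwilliger_algebra :: "'v::finite graph \<Rightarrow> 'v \<Rightarrow> (complex^'v^'v) set"
  for G x where
  adj: "adj_mat G \<in> terwilliger_algebra G x"
| idem: "i \<le> gdiam G \<Longrightarrow> dual_idem G x i \<in> terwilliger_algebra G x"
| add: "M \<in> terwilliger_algebra G x \<Longrightarrow> N \<in> terwilliger_algebra G x \<Longrightarrow>
    M + N \<in> terwilliger_algebra G x"
| scale: "M \<in> terwilliger_algebra G x \<Longrightarrow> (\<chi> y z. c * M $ y $ z) \<in> terwilliger_algebra G x"
| mult: "M \<in> terwilliger_algebra G x \<Longrightarrow> N \<in> terwilliger_algebra G x \<Longrightarrow>
    M ** N \<in> terwilliger_algebra G x"

text \<open>\<open>vec.subspace\<close> and \<open>vec.dim\<close> refer to the complex vector space structure, unlike the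
  unqualified \<open>subspace\<close> and \<open>dim\<close>, which are real.\<close>

definition T_module :: "'v::finite graph \<Rightarrow> 'v \<Rightarrow> (complex^'v) set \<Rightarrow> bool" where
  "T_module G x W \<longleftrightarrow>
     vec.subspace W \<and> (\<forall>M\<in>terwilliger_algebra G x. \<forall>w\<in>W. M *v w \<in> W)"

definition irreducible_T_module :: "'v::finite graph \<Rightarrow> 'v \<Rightarrow> (complex^'v) set \<Rightarrow> bool" where
  "irreducible_T_module G x W \<longleftrightarrow>
     T_module G x W \<and> W \<noteq> {0} \<and>
     (\<forall>W'. T_module G x W' \<and> W' \<subseteq> W \<longrightarrow> W' = {0} \<or> W' = W)"

definition component :: "'v::finite graph \<Rightarrow> 'v \<Rightarrow> nat \<Rightarrow> (complex^'v) set \<Rightarrow> (complex^'v) set" where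
  "component G x i W = (\<lambda>w. dual_idem G x i *v w) ` W"

definition endpoint :: "'v::finite graph \<Rightarrow> 'v \<Rightarrow> (complex^'v) set \<Rightarrow> nat" where
  "endpoint G x W = (LEAST i. component G x i W \<noteq> {0})"

definition thin :: "'v::finite graph \<Rightarrow> 'v \<Rightarrow> (complex^'v) set \<Rightarrow> bool" where
  "thin G x W \<longleftrightarrow> (\<forall>i\<le>gdiam G. vec.dim (component G x i W) \<le> 1)"

section \<open>Uniform structures\<close>

definition lowering :: "'v::finite graph \<Rightarrow> 'v \<Rightarrow> complex^'v^'v" where
  "lowering G x = (\<Sum>i\<in>{1..gdiam G}. dual_idem G x (i - 1) ** adj_mat G ** dual_idem G x i)"

definition raising :: "'v::finite graph \<Rightarrow> 'v \<Rightarrow> complex^'v^'v" where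
  "raising G x = (\<Sum>i<gdiam G. dual_idem G x (i + 1) ** adj_mat G ** dual_idem G x i)"

text \<open>A \<open>D \<times> D\<close> matrix with rows and columns numbered from \<open>1\<close> is a function whose values
  outside \<open>{1..D} \<times> {1..D}\<close> are irrelevant.\<close>

definition principal_submatrix :: "(nat \<Rightarrow> nat \<Rightarrow> complex) \<Rightarrow> nat \<Rightarrow> nat \<Rightarrow> complex mat" where
  "principal_submatrix e s t =
     Matrix.mat (t + 1 - s) (t + 1 - s) (\<lambda>(i, j). e (s + i) (s + j))"

definition parameter_matrix :: "nat \<Rightarrow> (nat \<Rightarrow> nat \<Rightarrow> complex) \<Rightarrow> bool" where
  "parameter_matrix D e \<longleftrightarrow>
     (\<forall>i\<in>{1..D}. \<forall>j\<in>{1..D}. j + 1 < i \<or> i + 1 < j \<longrightarrow> e i j = 0) \<and>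
     (\<forall>i\<in>{1..D}. e i i = 1) \<and>
     ((\<forall>i\<in>{2..D}. e i (i - 1) \<noteq> 0) \<or> (\<forall>i\<in>{2..D}. e (i - 1) i \<noteq> 0)) \<and>
     (\<forall>s t. 1 \<le> s \<and> s \<le> t \<and> t \<le> D \<longrightarrow> Determinant.det (principal_submatrix e s t) \<noteq> 0)"

definition e_minus :: "(nat \<Rightarrow> nat \<Rightarrow> complex) \<Rightarrow> nat \<Rightarrow> complex" where
  "e_minus e i = (if i = 1 then 0 else e i (i - 1))"

definition e_plus :: "nat \<Rightarrow> (nat \<Rightarrow> nat \<Rightarrow> complex) \<Rightarrow> nat \<Rightarrow> complex" where
  "e_plus D e i = (if i = D then 0 else e i (i + 1))"

definition supports_uniform_structure :: "'v::finite graph \<Rightarrow> 'v \<Rightarrow> bool" where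
  "supports_uniform_structure G x \<longleftrightarrow>
     (let D = gdiam G; L = lowering G x; R = raising G x in
      \<exists>e f. parameter_matrix D e \<and>
        (\<forall>i\<in>{1..D}. \<forall>v\<in>component G x i UNIV.
           e_minus e i *s ((R ** L ** L) *v v) + (L ** R ** L) *v v
             + e_plus D e i *s ((L ** L ** R) *v v)
           = f i *s (L *v v)))"

end

theory Submission
  imports Defs
begin

text \<open>
  A thin irreducible module of endpoint \<open>1\<close> is generated by an eigenvector \<open>v\<close> of the local graph, and its
  structure is determined by the eigenvalue of \<open>v\<close>.  Since \<open>\<Gamma>\<close> is Q-polynomial, the dual adjacency matrix maps
  the \<open>\<theta>\<^sub>1\<close>-eigenvector of the module into the sum of the eigenspaces of \<open>\<theta>\<^sub>1\<close> and \<open>\<theta>\<^sub>2\<close>; comparing two components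
  leaves only the local eigenvalues \<open>-1\<close>, \<open>\<alpha>q[D-1] - 1\<close>, \<open>\<beta> - \<alpha> - 1\<close> and \<open>-q - 1\<close>.  In a uniform structure the
  eigenvalues of \<open>RL\<close> on a module of endpoint \<open>1\<close> solve a nonsingular tridiagonal system that depends only on the
  dimension of the module, so modules of equal dimension have equal eigenvalues.  Hence at most one of the
  first two and at most one of the last two local eigenvalues occurs (a coincidence of the second and the
  third being treated as the third).

  So the local graph is annihilated by a quadratic polynomial on the complement of the all-ones vector, that is,
  it is strongly regular.  Counting excludes all pairs but \<open>\<alpha>q[D-1] - 1\<close>, \<open>-q - 1\<close>, and for this pair
  \<open>\<beta> = \<alpha>[D+1] - q\<close>.  The claw-clique method of Bose and Neumaier shows that the local graph is then the point graph of
  a partial geometry with \<open>q + 1\<close> lines on each point and nexus \<open>\<alpha>\<close>.  Therefore \<open>\<alpha>\<close> is an integer with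
  \<open>1 \<le> \<alpha> \<le> q + 1\<close>, and the integrality of the number of lines and of an eigenvalue multiplicity excludes \<open>\<alpha> < q\<close>.
\<close>

section \<open>Distances in a connected graph\<close>

text \<open>The length of a module can be read off from \<open>lamR g (D - 1)\<close>. For the local
  eigenvalues -1 and \<alpha>q[D-1] - 1 it is nonzero and the module reaches distance D; for \<beta>
  - \<alpha> - 1 and -q - 1 it is zero and the module stops at D - 1. This is why the eigenvalues
  are compared in these two pairs. The exception is \<beta> = \<alpha>[D], where the second and
  third eigenvalue and their sequences \<open>gA\<close> and \<open>gB\<close> agree. A priori q and
  \<alpha> are only real, and \<alpha> may be negative. Signs come from the positivity of the
  intersection numbers. Integrality of q comes from c_2 = (1 + q)(1 + \<alpha>) together with the
  number \<alpha>(1 + q) of common neighbours of two nonadjacent vertices of the local graph. The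
  diameter enters once more at the end. For D \<ge> 5 the divisibility that expresses integrality of
  the multiplicity fails by size alone. For D = 4 it has to be combined with the number of lines,
  which leaves a divisibility problem in q and \<alpha>.\<close>

lemma relpowp_symp: "symp R \<Longrightarrow> (R ^^ n) y z \<Longrightarrow> (R ^^ n) z y"
proof (induction n arbitrary: y z)
  case (Suc n)
  from Suc.prems(2) obtain w where "R y w" "(R ^^ n) w z" by (rule relpowp_Suc_E2)
  with Suc show ?case by (auto intro!: relpowp_Suc_I dest: sympD)
qed auto

locale connected_graph =
  fixes G :: "'v::finite graph"
  assumes connected_simple: "connected_simple_graph G"
begin

lemma adj_sym: "G y z \<longleftrightarrow> G z y"
  using connected_simple by (auto simp: connected_simple_graph_def symp_def)

lemma adj_irrefl [simp]: "\<not> G y y"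
  using connected_simple by (auto simp: connected_simple_graph_def irreflp_def)

lemma relpowp_gdist: "(G ^^ gdist G y z) y z"
proof -
  have "G\<^sup>*\<^sup>* y z" using connected_simple by (auto simp: connected_simple_graph_def)
  then obtain n where "(G ^^ n) y z" by (auto simp: rtranclp_power)
  then show ?thesis unfolding gdist_def by (rule LeastI)
qed

lemma gdist_le: "(G ^^ n) y z \<Longrightarrow> gdist G y z \<le> n"
  unfolding gdist_def by (rule Least_le)

lemma gdist_commute: "gdist G y z = gdist G z y"
proof -
  have "symp G" using connected_simple by (simp add: connected_simple_graph_def)
  then show ?thesis
    by (intro antisym gdist_le relpowp_symp[OF _ relpowp_gdist])
qed

lemma gdist_triangle: "gdist G y z \<le> gdist G y w + gdist G w z"
  by (rule gdist_le) (auto simp: relpowp_add relcompp.simps intro: relpowp_gdist)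

lemma gdist_self [simp]: "gdist G y y = 0"
  using gdist_le[of 0 y y] by simp

lemma gdist_eq_0 [simp]: "gdist G y z = 0 \<longleftrightarrow> y = z"
  using relpowp_gdist[of y z] by (auto simp del: relpowp.simps(2))

lemma gdist_eq_1 [simp]: "gdist G y z = Suc 0 \<longleftrightarrow> G y z"
proof
  assume "gdist G y z = Suc 0"
  then have "(G ^^ 1) y z" using relpowp_gdist[of y z] by simp
  then show "G y z" unfolding relpowp_1 .
next
  assume a: "G y z"
  then have "gdist G y z \<le> 1" by (intro gdist_le) (simp add: relpowp_1 del: relpowp.simps)
  moreover have "gdist G y z \<noteq> 0" using a by auto
  ultimately show "gdist G y z = Suc 0" by linarith
qed

lemma gdist_adj_le: "G y z \<Longrightarrow> gdist G y t \<le> gdist G z t + 1"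
  using gdist_triangle[of y t z] by (simp flip: gdist_eq_1)

lemma gdist_split:
  assumes "m \<le> gdist G y z"
  obtains w where "gdist G y w = m" "gdist G w z = gdist G y z - m"
proof -
  obtain n where n: "gdist G y z = m + n" using assms le_Suc_ex by blast
  then obtain w where w: "(G ^^ m) y w" "(G ^^ n) w z"
    using relpowp_gdist[of y z] by (auto simp: relpowp_add)
  then have "gdist G y w \<le> m" "gdist G w z \<le> n" by (auto intro: gdist_le)
  then have "gdist G y w = m" "gdist G w z = n" using gdist_triangle[of y z w] n by auto
  with that n show thesis by auto
qed

lemma gdist_le_gdiam: "gdist G y z \<le> gdiam G"
proof -
  have "{gdist G y z |y z. True} = (\<lambda>(y, z). gdist G y z) ` UNIV" by auto
  then have "finite {gdist G y z |y z. True}" by simp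
  then show ?thesis unfolding gdiam_def by (intro Max_ge) auto
qed

lemma ex_gdist:
  assumes "h \<le> gdiam G"
  obtains y z where "gdist G y z = h"
proof -
  have "{gdist G y z |y z. True} = (\<lambda>(y, z). gdist G y z) ` UNIV" by auto
  then have "gdiam G \<in> {gdist G y z |y z. True}" unfolding gdiam_def by (intro Max_in) auto
  then obtain y z where "gdist G y z = gdiam G" by auto
  with assms obtain w where "gdist G y w = h" using gdist_split[of h y z] by auto
  then show thesis by (rule that)
qed

end

section \<open>The parameters of the graph\<close>

lemma qbracket_0 [simp]: "qbracket q 0 = 0"
  by (simp add: qbracket_def)

lemma qbracket_Suc: "qbracket q (Suc n) = 1 + q * qbracket q n"
  by (simp add: qbracket_def sum.lessThan_Suc_shift sum_distrib_left del: sum.lessThan_Suc)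

lemma qbracket_Suc_power: "qbracket q (Suc n) = qbracket q n + q ^ n"
  by (simp add: qbracket_def)

lemma qbracket_1 [simp]: "qbracket q (Suc 0) = 1"
  by (simp add: qbracket_Suc)

lemma qbracket_add: "qbracket q (m + n) = qbracket q m + q ^ m * qbracket q n"
  by (induction n) (auto simp: qbracket_Suc_power power_add algebra_simps)

lemma qbracket_mono: "q \<ge> 0 \<Longrightarrow> m \<le> n \<Longrightarrow> qbracket q m \<le> qbracket q n"
  unfolding qbracket_def by (intro sum_mono2) auto

lemma qbracket_pos: "q \<ge> 0 \<Longrightarrow> n > 0 \<Longrightarrow> qbracket q n > 0"
  using qbracket_mono[of q 1 n] by simp

locale classical_graph = connected_graph G for G :: "'v::finite graph" +
  fixes D :: nat and q \<alpha> \<beta> :: real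
  assumes distance_regular: "distance_regular G"
    and classical: "classical_parameters G D q \<alpha> \<beta>"
    and D_ge: "D \<ge> 4" and q_ge: "q \<ge> 2"
begin

abbreviation br :: "nat \<Rightarrow> real" where "br \<equiv> qbracket q"

definition cc :: "nat \<Rightarrow> real" where "cc i = br i * (1 + \<alpha> * br (i - 1))"
definition bb :: "nat \<Rightarrow> real" where "bb i = (br D - br i) * (\<beta> - \<alpha> * br i)"
definition aa :: "nat \<Rightarrow> real" where "aa i = bb 0 - bb i - cc i"

lemma gdiam_eq: "gdiam G = D"
  using classical by (simp add: classical_parameters_def)

lemma gdist_le_D: "gdist G y z \<le> D"
  using gdist_le_gdiam[of y z] by (simp add: gdiam_eq)

lemma card_meet_sphere:
  assumes "i \<le> D" "j \<le> D"
  shows "card (meet_sphere G i j y z) = intersection_number G (gdist G y z) i j"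
proof -
  obtain p where p: "\<And>y' z'. gdist G y' z' = gdist G y z \<Longrightarrow> card (meet_sphere G i j y' z') = p"
    using distance_regular assms gdist_le_D[of y z]
    unfolding distance_regular_def gdiam_eq by meson
  have "intersection_number G (gdist G y z) i j = p"
    unfolding intersection_number_def using p by (intro the_equality) auto
  with p show ?thesis by simp
qed

lemma card_closer:
  assumes "gdist G y t = h" "h > 0"
  shows "real (card {z. G y z \<and> gdist G z t = h - 1}) = cc h"
proof -
  have "h \<le> D" using gdist_le_D assms by blast
  have "{z. G y z \<and> gdist G z t = h - 1} = meet_sphere G 1 (h - 1) y t"
    by (simp add: meet_sphere_def gdist_commute[of t])
  then have "real (card {z. G y z \<and> gdist G z t = h - 1}) = real (c_num G h)"
    using card_meet_sphere[of 1 "h - 1" y t] assms \<open>h \<le> D\<close> D_ge by (simp add: c_num_def)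
  also have "\<dots> = cc h"
    using classical assms \<open>h \<le> D\<close> by (auto simp: classical_parameters_def cc_def)
  finally show ?thesis .
qed

lemma card_farther:
  assumes "gdist G y t = h"
  shows "real (card {z. G y z \<and> gdist G z t = h + 1}) = bb h"
proof (cases "h < D")
  case True
  have "{z. G y z \<and> gdist G z t = h + 1} = meet_sphere G 1 (h + 1) y t"
    by (simp add: meet_sphere_def gdist_commute[of t])
  then have "real (card {z. G y z \<and> gdist G z t = h + 1}) = real (b_num G h)"
    using card_meet_sphere[of 1 "h + 1" y t] assms True D_ge by (simp add: b_num_def)
  also have "\<dots> = bb h"
    using classical True by (auto simp: classical_parameters_def bb_def)
  finally show ?thesis .
next
  case False
  then have "h = D" using gdist_le_D[of y t] assms by simp
  moreover have "{z. G y z \<and> gdist G z t = D + 1} = {}"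
    using gdist_le_D by (auto dest: le_trans)
      (metis Suc_n_not_le_n)
  ultimately show ?thesis by (simp add: bb_def)
qed

lemma card_neighbours: "real (card {z. G y z}) = bb 0"
proof -
  have "{z. G y z} = {z. G y z \<and> gdist G z y = 0 + 1}"
    using gdist_eq_1 adj_sym by auto
  then show ?thesis using card_farther[of y y 0] by simp
qed

text \<open>The intersection matrix: the action of A on functions of the distance to a fixed vertex.
  The values f (i - 1) at i = 0 and f (D + 1) at i = D are harmless because \<open>cc 0\<close> and
  \<open>bb D\<close> vanish.\<close>

definition Bop :: "(nat \<Rightarrow> 'b::real_vector) \<Rightarrow> nat \<Rightarrow> 'b" where
  "Bop f i = cc i *\<^sub>R f (i - 1) + aa i *\<^sub>R f i + bb i *\<^sub>R f (i + 1)"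

lemma sum_neighbours:
  fixes f :: "nat \<Rightarrow> 'b::real_vector"
  shows "(\<Sum>z | G y z. f (gdist G z t)) = Bop f (gdist G y t)"
proof -
  define h where "h = gdist G y t"
  define C where "C = {z. G y z \<and> gdist G z t + 1 = h}"
  define A where "A = {z. G y z \<and> gdist G z t = h}"
  define B where "B = {z. G y z \<and> gdist G z t = h + 1}"
  have U: "{z. G y z} = C \<union> A \<union> B"
    using gdist_adj_le[of y _ t] gdist_adj_le[of _ y t] adj_sym
    unfolding A_def B_def C_def h_def by force
  have disj: "C \<inter> A = {}" "(C \<union> A) \<inter> B = {}"
    unfolding A_def B_def C_def by auto
  have cC: "real (card C) = cc h"
  proof (cases "h = 0")
    case False
    then have "C = {z. G y z \<and> gdist G z t = h - 1}" unfolding C_def by auto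
    then show ?thesis using card_closer[OF h_def[symmetric]] False by simp
  qed (simp add: C_def cc_def)
  have cB: "real (card B) = bb h" unfolding B_def by (rule card_farther) (simp add: h_def)
  have "card {z. G y z} = card C + card A + card B"
    unfolding U using disj by (subst card_Un_disjoint; simp)+
  then have cA: "real (card A) = aa h" using cC cB card_neighbours[of y] by (simp add: aa_def)
  have "(\<Sum>z | G y z. f (gdist G z t))
      = (\<Sum>z\<in>C. f (gdist G z t)) + (\<Sum>z\<in>A. f (gdist G z t)) + (\<Sum>z\<in>B. f (gdist G z t))"
    unfolding U using disj by (simp add: sum.union_disjoint)
  also have "(\<Sum>z\<in>C. f (gdist G z t)) = (\<Sum>z\<in>C. f (h - 1))"
    by (rule sum.cong) (auto simp: C_def)
  also have "(\<Sum>z\<in>A. f (gdist G z t)) = (\<Sum>z\<in>A. f h)"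
    by (rule sum.cong) (auto simp: A_def)
  also have "(\<Sum>z\<in>B. f (gdist G z t)) = (\<Sum>z\<in>B. f (h + 1))"
    by (rule sum.cong) (auto simp: B_def)
  finally show ?thesis
    by (simp add: sum_constant_scaleR cA cB cC Bop_def h_def)
qed

lemma cc_pos: "1 \<le> i \<Longrightarrow> i \<le> D \<Longrightarrow> cc i > 0"
proof -
  assume i: "1 \<le> i" "i \<le> D"
  obtain y t where yt: "gdist G y t = i" using ex_gdist i gdiam_eq by metis
  obtain w where "gdist G y w = 1" "gdist G w t = i - 1" using gdist_split[of 1 y t] i yt by auto
  then have "w \<in> {z. G y z \<and> gdist G z t = i - 1}" using gdist_eq_1 by auto
  then have "card {z. G y z \<and> gdist G z t = i - 1} > 0" by (auto simp: card_gt_0_iff)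
  then show "cc i > 0" using card_closer[OF yt] i by linarith
qed

lemma bb_pos: "i < D \<Longrightarrow> bb i > 0"
proof -
  assume i: "i < D"
  obtain y t where yt: "gdist G y t = i + 1" using ex_gdist[of "i + 1"] i gdiam_eq by auto
  obtain w where w: "gdist G y w = 1" "gdist G w t = i" using gdist_split[of 1 y t] yt by auto
  then have "y \<in> {z. G w z \<and> gdist G z t = i + 1}" using gdist_eq_1 adj_sym yt by auto
  then have "card {z. G w z \<and> gdist G z t = i + 1} > 0" by (auto simp: card_gt_0_iff)
  then show "bb i > 0" using card_farther[OF w(2)] by linarith
qed

lemma bb_D [simp]: "bb D = 0" by (simp add: bb_def)
lemma cc_0 [simp]: "cc 0 = 0" by (simp add: cc_def)
lemma cc_1 [simp]: "cc (Suc 0) = 1" by (simp add: cc_def)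

lemma aa_0: "aa 0 = 0" by (simp add: aa_def)

lemma br_less: "i < j \<Longrightarrow> br i < br j"
proof (induction j)
  case (Suc j)
  have "br j < br (Suc j)" using q_ge by (simp add: qbracket_Suc_power)
  with Suc show ?case by (cases "i = j") auto
qed simp

text \<open>The sign of \<alpha> is unknown at this stage. The factor is positive because
  \<open>cc (i + 1)\<close> counts first steps of geodesics that exist;
  \<open>beta_alpha_pos\<close> follows from \<open>bb\<close> in the same way.\<close>

lemma alpha_br_pos: "i < D \<Longrightarrow> 1 + \<alpha> * br i > 0"
  using cc_pos[of "i + 1"] qbracket_pos[of q "i + 1"] q_ge
  by (auto simp: cc_def zero_less_mult_iff)

lemma beta_alpha_pos: "i < D \<Longrightarrow> \<beta> - \<alpha> * br i > 0"
  using bb_pos[of i] br_less[of i D] by (auto simp: bb_def zero_less_mult_iff)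

lemma br_diff: "i \<le> D \<Longrightarrow> br D - br i = q ^ i * br (D - i)"
  using qbracket_add[of q i "D - i"] by simp

end

section \<open>The Q-polynomial structure\<close>

context connected_graph
begin

definition Ad :: "('v \<Rightarrow> 'b::real_vector) \<Rightarrow> 'v \<Rightarrow> 'b" where
  "Ad f y = (\<Sum>z | G y z. f z)"

definition sh :: "real \<Rightarrow> ('v \<Rightarrow> 'b::real_vector) \<Rightarrow> 'v \<Rightarrow> 'b" where
  "sh \<theta> f y = Ad f y - \<theta> *\<^sub>R f y"

text \<open>\<open>sph f\<close> is the element \<open>\<Sum>\<^sub>i f(i)A\<^sub>i\<close> of the Bose-Mesner algebra.\<close>

definition sph :: "(nat \<Rightarrow> real) \<Rightarrow> ('v \<Rightarrow> 'b::real_vector) \<Rightarrow> 'v \<Rightarrow> 'b" where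
  "sph f g y = (\<Sum>z\<in>UNIV. f (gdist G y z) *\<^sub>R g z)"

lemma Ad_self_adjoint:
  fixes f g :: "'v \<Rightarrow> 'b::{real_vector, comm_ring}"
  shows "(\<Sum>y\<in>UNIV. Ad f y * g y) = (\<Sum>y\<in>UNIV. f y * Ad g y)"
proof -
  have "(\<Sum>y\<in>UNIV. Ad f y * g y) = (\<Sum>y\<in>UNIV. \<Sum>z\<in>{z\<in>UNIV. G y z}. f z * g y)"
    by (simp add: Ad_def sum_distrib_right)
  also have "\<dots> = (\<Sum>z\<in>UNIV. \<Sum>y\<in>{y\<in>UNIV. G y z}. f z * g y)"
    by (rule sum.swap_restrict) auto
  also have "\<dots> = (\<Sum>z\<in>UNIV. f z * Ad g z)"
    by (simp add: Ad_def sum_distrib_left adj_sym)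
  finally show ?thesis .
qed

lemma sh_self_adjoint:
  fixes f g :: "'v \<Rightarrow> real"
  shows "(\<Sum>y\<in>UNIV. sh \<theta> f y * g y) = (\<Sum>y\<in>UNIV. f y * sh \<theta> g y)"
  using Ad_self_adjoint[of f g] by (simp add: sh_def algebra_simps sum_subtractf)

lemma Ad_sum: "Ad (\<lambda>y. \<Sum>b\<in>S. r b y *\<^sub>R v b) = (\<lambda>y. \<Sum>b\<in>S. Ad (r b) y *\<^sub>R v b)"
  unfolding Ad_def by (subst sum.swap) (simp add: scaleR_sum_left)

lemma sh_sum: "sh \<theta> (\<lambda>y. \<Sum>b\<in>S. r b y *\<^sub>R v b) = (\<lambda>y. \<Sum>b\<in>S. sh \<theta> (r b) y *\<^sub>R v b)"
  unfolding sh_def Ad_sum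
  by (simp add: scaleR_diff_left sum_subtractf scaleR_sum_right)

end

context classical_graph
begin

definition Bsh :: "real \<Rightarrow> (nat \<Rightarrow> real) \<Rightarrow> nat \<Rightarrow> real" where
  "Bsh \<theta> f i = Bop f i - \<theta> * f i"

lemma Ad_radial: "Ad (\<lambda>y. f (gdist G y t)) = (\<lambda>y. Bop f (gdist G y t))"
  by (rule ext) (simp add: Ad_def sum_neighbours)

lemma sh_radial: "sh \<theta> (\<lambda>y. f (gdist G y t)) = (\<lambda>y. Bsh \<theta> f (gdist G y t))"
  by (rule ext) (simp add: sh_def Ad_radial Bsh_def)

lemma Ad_sph: "Ad (sph f g) = sph (Bop f) g"
proof -
  have "Ad (sph f g) = (\<lambda>y. \<Sum>z\<in>UNIV. Ad (\<lambda>y. f (gdist G y z)) y *\<^sub>R g z)"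
    unfolding sph_def by (rule Ad_sum)
  then show ?thesis by (auto simp: Ad_radial sph_def)
qed

lemma sh_sph: "sh \<theta> (sph f g) = sph (Bsh \<theta> f) g"
  by (rule ext) (simp add: sh_def Ad_sph sph_def Bsh_def scaleR_diff_left sum_subtractf scaleR_sum_right)

definition dl :: "nat \<Rightarrow> nat \<Rightarrow> real" where "dl j i = (if i = j then 1 else 0)"

lemma sph_dl_0 [simp]: "sph (dl 0) g = g"
  unfolding sph_def dl_def by (simp add: if_distrib[of "\<lambda>c. c *\<^sub>R _"] cong: if_cong)

lemma Bop_dl:
  "Bop (dl j) i = cc (Suc j) * dl (Suc j) i + aa j * dl j i
     + (if j = 0 then 0 else bb (j - 1) * dl (j - 1) i)"
  unfolding Bop_def dl_def by (cases i; cases j) auto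

lemma Ad_sph_dl:
  "Ad (sph (dl j) g) y = cc (Suc j) *\<^sub>R sph (dl (Suc j)) g y + aa j *\<^sub>R sph (dl j) g y
     + (if j = 0 then 0 else bb (j - 1) *\<^sub>R sph (dl (j - 1)) g y)"
  unfolding Ad_sph
  by (simp add: sph_def Bop_dl scaleR_sum_right scaleR_add_left sum.distrib)

lemma sph_expand: "sph f g y = (\<Sum>j\<le>D. f j *\<^sub>R sph (dl j) g y)"
proof -
  have "(\<Sum>j\<le>D. f j *\<^sub>R sph (dl j) g y)
      = (\<Sum>z\<in>UNIV. (\<Sum>j\<le>D. (if j = gdist G y z then f j else 0)) *\<^sub>R g z)"
    unfolding sph_def scaleR_sum_right scaleR_sum_left
    by (subst sum.swap) (auto intro!: sum.cong simp: dl_def)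
  also have "\<dots> = sph f g y"
    unfolding sph_def using gdist_le_D by (intro sum.cong refl) (simp add: sum.delta')
  finally show ?thesis by simp
qed

text \<open>The three-term recurrence can be solved for \<open>A\<^sub>j\<close> since
  \<open>cc j\<close> is nonzero, so every distance matrix is a real polynomial in A and preserves
  whatever A preserves.\<close>

lemma sph_closed:
  assumes add: "\<And>g h. g \<in> S \<Longrightarrow> h \<in> S \<Longrightarrow> (\<lambda>y. g y + h y) \<in> S"
    and scale: "\<And>g r. g \<in> S \<Longrightarrow> (\<lambda>y. r *\<^sub>R g y) \<in> S"
    and Ad: "\<And>g. g \<in> S \<Longrightarrow> Ad g \<in> S"
    and g: "g \<in> S"
  shows "sph f g \<in> S"
proof -
  have dl: "sph (dl j) g \<in> S" if "j \<le> D" for j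
    using that
  proof (induction j rule: less_induct)
    case (less j)
    show ?case
    proof (cases j)
      case 0
      then show ?thesis using g by simp
    next
      case (Suc i)
      have prev: "(\<lambda>y. (if i = 0 then 0 else (- bb (i - 1)) *\<^sub>R sph (dl (i - 1)) g y)) \<in> S"
      proof (cases "i = 0")
        case True
        then show ?thesis using scale[OF g, of 0] by simp
      next
        case False
        then show ?thesis using scale[OF less.IH[of "i - 1"], of "- bb (i - 1)"] less.prems Suc by simp
      qed
      have "(\<lambda>y. (1 / cc j) *\<^sub>R ((Ad (sph (dl i) g) y + (- aa i) *\<^sub>R sph (dl i) g y)
             + (if i = 0 then 0 else (- bb (i - 1)) *\<^sub>R sph (dl (i - 1)) g y))) \<in> S"
        using less Suc by (intro scale add Ad prev) auto
      also have "(\<lambda>y. (1 / cc j) *\<^sub>R ((Ad (sph (dl i) g) y + (- aa i) *\<^sub>R sph (dl i) g y)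
             + (if i = 0 then 0 else (- bb (i - 1)) *\<^sub>R sph (dl (i - 1)) g y))) = sph (dl j) g"
        using cc_pos[of j] less.prems Suc by (auto simp: Ad_sph_dl fun_eq_iff)
      finally show ?thesis .
    qed
  qed
  have "(\<lambda>y. \<Sum>j\<in>J. f j *\<^sub>R sph (dl j) g y) \<in> S" if "finite J" "J \<subseteq> {..D}" for J
    using that
  proof (induction J rule: finite_induct)
    case empty
    then show ?case using scale[OF g, of 0] by simp
  next
    case (insert j J)
    then show ?case by (simp add: add[OF scale[OF dl]])
  qed
  then have "(\<lambda>y. \<Sum>j\<le>D. f j *\<^sub>R sph (dl j) g y) \<in> S" by simp
  moreover have "sph f g = (\<lambda>y. \<Sum>j\<le>D. f j *\<^sub>R sph (dl j) g y)" by (rule ext) (rule sph_expand)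
  ultimately show ?thesis by simp
qed

text \<open>The eigenvalue \<open>b\<^sub>j / q\<^sup>j - [j]\<close> of a graph with classical
  parameters.\<close>

definition th :: "nat \<Rightarrow> real" where "th j = br (D - j) * (\<beta> - \<alpha> * br j) - br j"

text \<open>The dual eigenvalues of a graph with classical parameters are affine functions of \<open>q\<^sup>-\<^sup>i\<close>.\<close>

definition X :: "nat \<Rightarrow> real" where "X i = 1 / q ^ i"

lemma br_D_1: "br D = 1 + q * br (D - 1)"
  using D_ge qbracket_Suc[of q "D - 1"] by simp

lemma br_D_2: "br (D - 1) = 1 + q * br (D - 2)"
proof -
  have "D - 1 = Suc (D - 2)" using D_ge by simp
  then show ?thesis by (simp only: qbracket_Suc)
qed

lemma power_br: "q ^ i = 1 + (q - 1) * br i"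
  using qbracket_Suc[of q i] qbracket_Suc_power[of q i] by (simp add: algebra_simps)

lemma Bop_const: "Bop (\<lambda>_. r) i = th 0 * r"
  by (simp add: Bop_def aa_def bb_def th_def algebra_simps)

lemma Bop_add: "Bop (\<lambda>i. f i + g i) i = Bop f i + Bop g i"
  and Bop_scale: "Bop (\<lambda>i. r * h i) i = r * Bop h i"
  for h :: "nat \<Rightarrow> real"
  by (simp_all add: Bop_def algebra_simps)

lemma Bop_diffs:
  fixes f :: "nat \<Rightarrow> real"
  shows "Bop f i = bb 0 * f i + cc i * (f (i - 1) - f i) + bb i * (f (i + 1) - f i)"
  by (simp add: Bop_def aa_def algebra_simps)

lemma cc_br: "q * cc i = br i * (q + \<alpha> * (br i - 1))"
  by (cases i) (auto simp: cc_def qbracket_Suc algebra_simps)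

text \<open>The inhomogeneous term of \<open>Bop X\<close>: the coefficient of \<open>q ^ i\<close>
  once the factor \<open>X i\<close> has been taken out.\<close>

definition \<kappa> :: real where "\<kappa> = 1 + \<beta> / q + \<alpha> * br (D - 1)"

text \<open>After \<open>X i\<close> is factored out, what remains is a priori quadratic in
  \<open>q ^ i\<close>. The quadratic contributions of \<open>cc\<close> and \<open>bb\<close>, both
  stemming from \<alpha>, cancel, so an affine expression is left.\<close>

lemma Bop_X: "Bop X i = th 1 * X i + \<kappa>"
proof -
  have q: "q \<noteq> 0" "q > 0" using q_ge by auto
  have c: "cc i * (X (i - 1) - X i) = cc i * ((q - 1) * X i)"
    using q by (cases i) (auto simp: X_def field_simps)
  have b: "X (i + 1) - X i = (1 / q - 1) * X i"
    using q by (simp add: X_def field_simps)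
  have "Bop X i = X i * (bb 0 + cc i * (q - 1) + bb i * (1 / q - 1))"
    unfolding Bop_diffs c b by (simp add: algebra_simps)
  also have "bb 0 + cc i * (q - 1) + bb i * (1 / q - 1) = th 1 + \<kappa> * q ^ i"
  proof -
    have "q * (bb 0 + cc i * (q - 1) + bb i * (1 / q - 1))
        = q * bb 0 + (q * cc i) * (q - 1) - bb i * (q - 1)"
      using q by (simp add: field_simps)
    also have "\<dots> = q * (th 1 + \<kappa> * q ^ i)"
      unfolding cc_br power_br bb_def br_D_1 th_def \<kappa>_def using q
      by (simp add: field_simps)
    finally show ?thesis using q by simp
  qed
  also have "X i * (th 1 + \<kappa> * q ^ i) = th 1 * X i + \<kappa>"
    using q by (simp add: X_def field_simps)
  finally show ?thesis .
qed

text \<open>Together with \<open>Bop_const\<close> and \<open>Bop_X\<close> this makes the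
  intersection matrix triangular on 1, X, X^2 with diagonal entries \<open>th 0\<close>,
  \<open>th 1\<close>, \<open>th 2\<close>: the Q-polynomial property in the degrees used
  later.\<close>

lemma Bop_X_square:
  obtains e1 e0 where "\<And>i. Bop (\<lambda>i. (X i)\<^sup>2) i = th 2 * (X i)\<^sup>2 + e1 * X i + e0"
proof
  fix i
  define h where "h = br (D - 2)"
  have q: "q \<noteq> 0" "q > 0" using q_ge by auto
  have brD: "br D = 1 + q * (1 + q * h)" by (simp only: br_D_1 br_D_2 h_def)
  have br2: "br 2 = 1 + q" by (simp add: numeral_2_eq_2 qbracket_Suc)
  have c: "cc i * ((X (i - 1))\<^sup>2 - (X i)\<^sup>2) = cc i * ((q\<^sup>2 - 1) * (X i)\<^sup>2)"
    using q by (cases i) (auto simp: X_def field_simps power2_eq_square)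
  have b: "(X (i + 1))\<^sup>2 - (X i)\<^sup>2 = (1 / q\<^sup>2 - 1) * (X i)\<^sup>2"
    using q by (simp add: X_def field_simps power2_eq_square)
  let ?e1 = "(q + 1) * (1 + \<beta> / q\<^sup>2 - \<alpha> / q\<^sup>2 + \<alpha> * h)"
  let ?e0 = "\<alpha> * (q + 1) / q\<^sup>2"
  have "Bop (\<lambda>i. (X i)\<^sup>2) i = (X i)\<^sup>2 * (bb 0 + cc i * (q\<^sup>2 - 1) + bb i * (1 / q\<^sup>2 - 1))"
    unfolding Bop_diffs c b by (simp add: algebra_simps)
  also have "bb 0 + cc i * (q\<^sup>2 - 1) + bb i * (1 / q\<^sup>2 - 1) = th 2 + ?e1 * q ^ i + ?e0 * (q ^ i)\<^sup>2"
  proof -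
    have "q\<^sup>2 * (bb 0 + cc i * (q\<^sup>2 - 1) + bb i * (1 / q\<^sup>2 - 1))
        = q\<^sup>2 * bb 0 + q * (q * cc i) * (q\<^sup>2 - 1) - bb i * (q\<^sup>2 - 1)"
      using q by (simp add: field_simps power2_eq_square)
    also have "\<dots> = q\<^sup>2 * (th 2 + ?e1 * q ^ i + ?e0 * (q ^ i)\<^sup>2)"
      unfolding cc_br power_br bb_def brD th_def br2 h_def[symmetric] using q
      by (simp add: field_simps power2_eq_square)
    finally show ?thesis using q by simp
  qed
  also have "(X i)\<^sup>2 * (th 2 + ?e1 * q ^ i + ?e0 * (q ^ i)\<^sup>2) = th 2 * (X i)\<^sup>2 + ?e1 * X i + ?e0"
    using q by (simp add: X_def field_simps power2_eq_square)
  finally show "Bop (\<lambda>i. (X i)\<^sup>2) i = th 2 * (X i)\<^sup>2 + ?e1 * X i + ?e0" .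
qed

lemma th_0: "th 0 = bb 0" by (simp add: th_def bb_def)

lemma th_1: "th 1 = br (D - 1) * (\<beta> - \<alpha>) - 1"
  by (simp add: th_def)

lemma th_0_neq_th_1: "th 0 \<noteq> th 1"
proof -
  have p: "\<beta> > 0" "\<beta> - \<alpha> > 0" "1 + \<alpha> * br (D - 1) > 0" "br (D - 1) > 0"
    using beta_alpha_pos[of 0] beta_alpha_pos[of 1] alpha_br_pos[of "D - 1"] D_ge
      qbracket_pos[of q "D - 1"] q_ge by auto
  have "th 0 - th 1 = \<beta> * (1 + (q - 1) * br (D - 1)) + (1 + \<alpha> * br (D - 1))"
    unfolding th_0 bb_def th_1 br_D_1 by (simp add: algebra_simps)
  moreover have "\<beta> * (1 + (q - 1) * br (D - 1)) > 0"
    using p q_ge by (intro mult_pos_pos) (auto intro: add_pos_nonneg)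
  ultimately show ?thesis using p by linarith
qed

text \<open>The shift absorbs \<kappa> and turns X into an eigenfunction for \<open>th 1\<close>. Up
  to a factor this is the dual eigenvalue sequence, and \<open>sph uu\<close> is a multiple of the
  primitive idempotent of \<open>th 1\<close>.\<close>

definition uu :: "nat \<Rightarrow> real" where "uu i = X i - \<kappa> / (th 0 - th 1)"

lemma Bop_uu: "Bop uu i = th 1 * uu i"
proof -
  have "Bop uu i = Bop X i + Bop (\<lambda>_. - \<kappa> / (th 0 - th 1)) i"
    unfolding uu_def by (subst Bop_add[symmetric]) simp
  then show ?thesis unfolding Bop_X Bop_const uu_def using th_0_neq_th_1
    by (simp add: field_simps)
qed

lemma uu_0: "uu 0 \<noteq> 0"
proof
  assume "uu 0 = 0"
  then have "bb 0 * uu 1 = 0" using Bop_uu[of 0] by (simp add: Bop_def aa_def)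
  then have "uu 1 = 0" using bb_pos[of 0] D_ge by simp
  with \<open>uu 0 = 0\<close> have "X 0 = X 1" by (simp add: uu_def)
  then show False using q_ge by (simp add: X_def)
qed

text \<open>The square of \<open>uu\<close> is a quadratic polynomial in X. On the triangular basis
  each of the three factors lowers the degree by one.\<close>

lemma Bsh_uu_square: "Bsh (th 0) (Bsh (th 1) (Bsh (th 2) (\<lambda>i. (uu i)\<^sup>2))) i = 0"
proof -
  obtain e1 e0 where e: "\<And>i. Bop (\<lambda>i. (X i)\<^sup>2) i = th 2 * (X i)\<^sup>2 + e1 * X i + e0"
    by (rule Bop_X_square) blast
  define r where "r = \<kappa> / (th 0 - th 1)"
  have sq: "(\<lambda>i. (uu i)\<^sup>2) = (\<lambda>i. (X i)\<^sup>2 + (- 2 * r * X i + r\<^sup>2))"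
    by (rule ext) (simp add: uu_def r_def power2_eq_square algebra_simps)
  have "\<exists>g1 g0. Bsh (th 2) (\<lambda>i. (uu i)\<^sup>2) = (\<lambda>i. g1 * X i + g0)"
    unfolding sq Bsh_def Bop_add e Bop_scale Bop_X Bop_const
    by (rule exI[of _ "e1 - 2 * r * th 1 + 2 * r * th 2"],
        rule exI[of _ "e0 - 2 * r * \<kappa> + r\<^sup>2 * th 0 - r\<^sup>2 * th 2"])
       (simp add: algebra_simps)
  then obtain g1 g0 where g: "Bsh (th 2) (\<lambda>i. (uu i)\<^sup>2) = (\<lambda>i. g1 * X i + g0)" by blast
  have g': "Bsh (th 1) (\<lambda>i. g1 * X i + g0) = (\<lambda>_. g1 * \<kappa> + (th 0 - th 1) * g0)"
    unfolding Bsh_def Bop_add Bop_scale Bop_X Bop_const by (simp add: algebra_simps)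
  show ?thesis unfolding g g' Bsh_def Bop_const by simp
qed

definition Nop :: "('v \<Rightarrow> 'b::real_vector) \<Rightarrow> 'v \<Rightarrow> 'b" where
  "Nop f = sh (th 0) (sh (th 1) (sh (th 2) f))"

text \<open>The three-term relation \<open>A\<^sup>* E\<^sub>1V \<subseteq> E\<^sub>0V + E\<^sub>1V + E\<^sub>2V\<close>.  The sum of squares of all entries of
  \<open>N A\<^sup>* E\<close>, where \<open>N = (A - \<theta>\<^sub>0)(A - \<theta>\<^sub>1)(A - \<theta>\<^sub>2)\<close>, is a multiple of an entry of
  \<open>N\<^sup>2\<close> applied to the entrywise square of \<open>E\<close>, which is zero by the previous lemma.\<close>

lemma Nop_uu_uu: "Nop (\<lambda>y. uu (gdist G x y) * uu (gdist G y b)) a = 0"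
proof -
  \<comment> \<open>Shifts are self-adjoint, so the squared norm of \<open>Nop f\<close> is the
    pairing of f with \<open>T f\<close>. As an element of the Bose-Mesner algebra, T is given by
    the coefficients n.\<close>
  define T where "T f = sh (th 2) (sh (th 1) (sh (th 0) (Nop f)))" for f :: "'v \<Rightarrow> real"
  define n where "n = Bsh (th 2) (Bsh (th 1) (Bsh (th 0) (Bsh (th 0) (Bsh (th 1) (Bsh (th 2) (dl 0))))))"
  have T: "T f = sph n f" for f
  proof -
    have "T (sph (dl 0) f) = sph n f" unfolding T_def Nop_def sh_sph n_def ..
    then show ?thesis by simp
  qed
  have NT: "(\<Sum>a\<in>UNIV. (Nop f a)\<^sup>2) = (\<Sum>y\<in>UNIV. f y * T f y)" for f
    unfolding T_def power2_eq_square Nop_def sh_self_adjoint ..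
  have uu_Ad: "Ad (\<lambda>y. uu (gdist G y t)) = (\<lambda>y. th 1 * uu (gdist G y t))" for t
    unfolding Ad_radial Bop_uu ..
  have ev: "\<exists>\<tau>. \<forall>y. sph f (\<lambda>y. uu (gdist G y t)) y = \<tau> * uu (gdist G y t)" for f t
  proof -
    let ?S = "{g. \<exists>\<tau>. g = (\<lambda>y. \<tau> * uu (gdist G y t))}"
    have "sph f (\<lambda>y. uu (gdist G y t)) \<in> ?S"
    proof (rule sph_closed)
      fix g h assume "g \<in> ?S" "h \<in> ?S"
      then show "(\<lambda>y. g y + h y) \<in> ?S" by (auto simp flip: distrib_right)
    next
      fix g and r :: real assume "g \<in> ?S"
      then show "(\<lambda>y. r *\<^sub>R g y) \<in> ?S" by (auto simp flip: mult.assoc)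
    next
      fix g assume "g \<in> ?S"
      then obtain \<tau> where g: "g = (\<lambda>y. \<tau> * uu (gdist G y t))" by blast
      have "Ad g = (\<lambda>y. \<tau> * Ad (\<lambda>y. uu (gdist G y t)) y)"
        unfolding g Ad_def by (simp add: sum_distrib_left)
      also have "\<dots> = (\<lambda>y. (\<tau> * th 1) * uu (gdist G y t))" unfolding uu_Ad by (simp only: mult.assoc)
      finally show "Ad g \<in> ?S" by blast
    next
      have "(\<lambda>y. uu (gdist G y t)) = (\<lambda>y. 1 * uu (gdist G y t))" by simp
      then show "(\<lambda>y. uu (gdist G y t)) \<in> ?S" by blast
    qed
    then show ?thesis by auto
  qed
  obtain k where k: "\<And>t y. sph uu (\<lambda>y. uu (gdist G y t)) y = k t * uu (gdist G y t)"
    using ev[of uu] by metis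
  \<comment> \<open>\<tau> is the eigenvalue of the entrywise product of T and
    \<open>sph uu\<close>. Read at x, \<open>\<tau> * uu 0\<close> is T applied to the square of
    \<open>uu\<close>, and this vanishes because \<open>Nop\<close> already kills that
    square.\<close>
  obtain \<tau> where \<tau>: "\<And>y. sph (\<lambda>i. n i * uu i) (\<lambda>y. uu (gdist G y x)) y = \<tau> * uu (gdist G y x)"
    using ev[of "\<lambda>i. n i * uu i" x] by blast
  have "\<tau> * uu 0 = sph n (\<lambda>y. (uu (gdist G y x))\<^sup>2) x"
    using \<tau>[of x] by (simp add: sph_def power2_eq_square gdist_commute[of x] mult_ac)
  also have "\<dots> = T (\<lambda>y. (uu (gdist G y x))\<^sup>2) x" by (simp add: T)
  also have "Nop (\<lambda>y. (uu (gdist G y x))\<^sup>2) = (\<lambda>y. 0)"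
    unfolding Nop_def sh_radial[of _ "\<lambda>i. (uu i)\<^sup>2"] sh_radial Bsh_uu_square ..
  then have "T (\<lambda>y. (uu (gdist G y x))\<^sup>2) x = 0" unfolding T_def by (simp add: sh_def Ad_def)
  finally have "\<tau> = 0" using uu_0 by simp
  let ?F = "\<lambda>b y. uu (gdist G x y) * uu (gdist G y b)"
  have "(\<Sum>b\<in>UNIV. \<Sum>a\<in>UNIV. (Nop (?F b) a)\<^sup>2)
      = (\<Sum>b\<in>UNIV. \<Sum>y\<in>UNIV. \<Sum>z\<in>UNIV. ?F b y * (n (gdist G y z) * ?F b z))"
    unfolding NT T sph_def by (simp add: sum_distrib_left)
  also have "\<dots> = (\<Sum>y\<in>UNIV. \<Sum>z\<in>UNIV. \<Sum>b\<in>UNIV. ?F b y * (n (gdist G y z) * ?F b z))"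
    by (subst sum.swap, rule sum.cong[OF refl], subst sum.swap, rule refl)
  \<comment> \<open>Summing over b first produces \<open>sph uu\<close> applied to
    \<open>uu\<close>, a multiple of \<open>uu\<close>. What then remains is the entrywise product
    with eigenvalue \<tau>.\<close>
  also have "\<dots> = (\<Sum>y\<in>UNIV. \<Sum>z\<in>UNIV. uu (gdist G x y) * n (gdist G y z) * uu (gdist G x z)
                     * sph uu (\<lambda>y. uu (gdist G y z)) y)"
    by (simp add: sph_def sum_distrib_left gdist_commute[of _ "_ :: 'v"] mult_ac)
  also have "\<dots> = (\<Sum>y\<in>UNIV. \<Sum>z\<in>UNIV. uu (gdist G x y) * n (gdist G y z) * uu (gdist G x z)
                     * (k z * uu (gdist G y z)))"
    unfolding k ..
  also have "\<dots> = (\<Sum>z\<in>UNIV. k z * uu (gdist G x z)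
                     * sph (\<lambda>i. n i * uu i) (\<lambda>y. uu (gdist G y x)) z)"
    by (subst sum.swap) (simp add: sph_def sum_distrib_left gdist_commute mult_ac)
  also have "\<dots> = 0" unfolding \<tau> \<open>\<tau> = 0\<close> by simp
  finally have "(\<Sum>a\<in>UNIV. (Nop (?F b) a)\<^sup>2) = 0"
    by (subst (asm) sum_nonneg_eq_0_iff) (auto intro: sum_nonneg)
  then show ?thesis by (subst (asm) sum_nonneg_eq_0_iff) auto
qed

text \<open>\<open>uu (gdist G x y)\<close> is the diagonal of the dual adjacency matrix. Expanding
  v in point masses b reduces the claim to \<open>Nop_uu_uu\<close>.\<close>

lemma Nop_dual_uu:
  "Nop (\<lambda>y. uu (gdist G x y) *\<^sub>R sph uu v y) = (\<lambda>_. 0)"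
proof -
  have "(\<lambda>y. uu (gdist G x y) *\<^sub>R sph uu v y)
      = (\<lambda>y. \<Sum>b\<in>UNIV. (uu (gdist G x y) * uu (gdist G y b)) *\<^sub>R v b)"
    by (simp add: sph_def scaleR_sum_right)
  then have "Nop (\<lambda>y. uu (gdist G x y) *\<^sub>R sph uu v y)
      = (\<lambda>a. \<Sum>b\<in>UNIV. Nop (\<lambda>y. uu (gdist G x y) * uu (gdist G y b)) a *\<^sub>R v b)"
    by (simp only: Nop_def sh_sum)
  then show ?thesis by (simp add: Nop_uu_uu)
qed

end

section \<open>Modules of the Terwilliger algebra\<close>

lemmas cvec_eq_iff = Finite_Cartesian_Product.vec_eq_iff

lemma collinear_of_dim_le_1:
  fixes S :: "(complex^'n::finite) set"
  assumes "vec.dim S \<le> 1" "u \<in> S" "w \<in> S" "u \<noteq> 0"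
  shows "\<exists>t. w = t *s u"
proof (rule ccontr)
  assume a: "\<nexists>t. w = t *s u"
  then have "w \<notin> vec.span {u}" by (auto simp: vec.span_singleton)
  then have "vec.independent {w, u}" using assms(4)
    by (intro vec.independent_insertI) (auto simp: vec.independent_empty)
  moreover have "w \<noteq> u" using a by (metis vec.scale_one)
  ultimately have "2 \<le> vec.dim S"
    using vec.independent_card_le_dim[of "{w, u}" S] assms by simp
  with assms(1) show False by simp
qed

locale rooted_classical_graph = classical_graph G D q \<alpha> \<beta>
  for G :: "'v::finite graph" and D q \<alpha> \<beta> +
  fixes x :: 'v
begin

abbreviation A :: "complex^'v \<Rightarrow> complex^'v" where "A w \<equiv> adj_mat G *v w"
abbreviation P :: "nat \<Rightarrow> complex^'v \<Rightarrow> complex^'v" where "P i w \<equiv> dual_idem G x i *v w"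

definition S :: "(nat \<Rightarrow> real) \<Rightarrow> complex^'v \<Rightarrow> complex^'v" where
  "S f w = (\<chi> y. sph f (($) w) y)"

definition cip :: "complex^'v \<Rightarrow> complex^'v \<Rightarrow> complex" where
  "cip u w = (\<Sum>y\<in>UNIV. u $ y * cnj (w $ y))"

lemma A_nth: "A w $ y = Ad (($) w) y"
  by (simp add: adj_mat_def matrix_vector_mult_def Ad_def if_distrib[of "\<lambda>c. c * _"]
      sum.If_cases cong: if_cong)

lemma P_nth [simp]: "P i w $ y = (if gdist G x y = i then w $ y else 0)"
proof -
  have "P i w $ y = (\<Sum>z\<in>UNIV. if y = z then (if gdist G x y = i then w $ z else 0) else 0)"
    unfolding dual_idem_def matrix_vector_mult_def by (simp add: if_distrib[of "\<lambda>c. c * _"] cong: if_cong)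
  then show ?thesis by simp
qed

lemma A_add: "A (u + w) = A u + A w"
  and P_add: "P i (u + w) = P i u + P i w"
  by (rule matrix_vector_right_distrib)+

lemma A_scale: "A (c *s w) = c *s A w"
  by (simp add: cvec_eq_iff A_nth Ad_def sum_distrib_left)

lemma P_scale: "P i (c *s w) = c *s P i w"
  by (simp add: cvec_eq_iff)

lemma A_diff: "A (u - w) = A u - A w"
  and P_diff: "P i (u - w) = P i u - P i w"
  by (simp_all add: cvec_eq_iff A_nth Ad_def sum_subtractf)

lemma A_minus: "A (- w) = - A w"
  and P_minus: "P i (- w) = - P i w"
  by (simp_all add: cvec_eq_iff A_nth Ad_def sum_negf)

lemma A_0 [simp]: "A 0 = 0" and P_0 [simp]: "P i 0 = 0"
  by simp_all

lemma P_P [simp]: "P i (P j w) = (if i = j then P i w else 0)"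
  by (auto simp: cvec_eq_iff)

lemma P_gt: "i > D \<Longrightarrow> P i w = 0"
  using gdist_le_D by (auto simp: cvec_eq_iff dest: leD)

lemma sum_P: "(\<Sum>i\<le>D. c i *s P i w) = (\<chi> y. c (gdist G x y) * w $ y)"
  using gdist_le_D by (auto simp: cvec_eq_iff if_distrib[of "\<lambda>a. _ * a"] cong: if_cong)

lemma P_A:
  assumes "i \<ge> 1"
  shows "P i (A w) = P i (A (P (i - 1) w)) + P i (A (P i w)) + P i (A (P (i + 1) w))"
proof -
  have "Ad (($) w) y = Ad (($) (P (i - 1) w)) y + Ad (($) (P i w)) y + Ad (($) (P (i + 1) w)) y"
    if y: "gdist G x y = i" for y
    unfolding Ad_def sum.distrib[symmetric]
  proof (rule sum.cong[OF refl])
    fix z assume "z \<in> {z. G y z}"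
    then have "gdist G x z \<le> i + 1" "i \<le> gdist G x z + 1"
      using gdist_adj_le[of y z x] gdist_adj_le[of z y x] y by (auto simp: gdist_commute[of _ x] adj_sym)
    then consider "gdist G x z = i - 1" | "gdist G x z = i" | "gdist G x z = i + 1" by linarith
    then show "w $ z = P (i - 1) w $ z + P i w $ z + P (i + 1) w $ z"
      using assms by cases auto
  qed
  then show ?thesis by (auto simp: cvec_eq_iff A_nth)
qed

lemma A_S: "A (S f w) = S (Bop f) w"
proof -
  have "($) (S f w) = sph f (($) w)" by (rule ext) (simp add: S_def)
  then show ?thesis by (simp add: cvec_eq_iff A_nth Ad_sph S_def)
qed

lemma S_dl_0 [simp]: "S (dl 0) w = w"
  by (simp add: S_def cvec_eq_iff)

lemma cip_A: "cip (A u) w = cip u (A w)"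
proof -
  have "cnj (A w $ y) = Ad (\<lambda>z. cnj (w $ z)) y" for y
    by (simp add: A_nth Ad_def)
  then show ?thesis unfolding cip_def
    using Ad_self_adjoint[of "($) u" "\<lambda>z. cnj (w $ z)"] by (simp add: A_nth)
qed

lemma cip_P: "cip (P i u) w = cip u (P i w)"
  unfolding cip_def by (rule sum.cong) auto

lemma cip_add_left: "cip (u + u') w = cip u w + cip u' w"
  and cip_scale_left: "cip (c *s u) w = c * cip u w"
  and cip_scale_right: "cip u (c *s w) = cnj c * cip u w"
  by (simp_all add: cip_def distrib_left distrib_right sum.distrib sum_distrib_left mult_ac)

lemma cip_0 [simp]: "cip 0 w = 0" "cip u 0 = 0"
  by (simp_all add: cip_def)

lemma cip_self: "cip u u = 0 \<Longrightarrow> u = 0"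
proof -
  assume "cip u u = 0"
  then have "(\<Sum>y\<in>UNIV. complex_of_real ((cmod (u $ y))\<^sup>2)) = 0"
    unfolding cip_def by (simp only: complex_norm_square)
  then have "(\<Sum>y\<in>UNIV. (cmod (u $ y))\<^sup>2) = 0" unfolding of_real_sum[symmetric] of_real_eq_0_iff .
  then show "u = 0" by (simp add: sum_nonneg_eq_0_iff cvec_eq_iff)
qed

lemma T_moduleI:
  assumes "vec.subspace W" "\<And>w. w \<in> W \<Longrightarrow> A w \<in> W" "\<And>i w. w \<in> W \<Longrightarrow> P i w \<in> W"
  shows "T_module G x W"
proof -
  have "M *v w \<in> W" if "M \<in> terwilliger_algebra G x" "w \<in> W" for M w
    using that
  proof (induction arbitrary: w rule: terwilliger_algebra.induct)
    case (add M N)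
    then show ?case using assms(1)
      by (simp add: matrix_vector_mult_add_rdistrib vec.subspace_add)
  next
    case (scale M c)
    have "(\<chi> y z. c * M $ y $ z) *v w = c *s (M *v w)"
      by (simp add: cvec_eq_iff matrix_vector_mult_def sum_distrib_left mult.assoc)
    with scale show ?case using assms(1) by (simp add: vec.subspace_scale)
  next
    case (mult M N)
    then show ?case by (simp add: matrix_vector_mul_assoc[symmetric])
  qed (use assms in auto)
  with assms(1) show ?thesis by (simp add: T_module_def)
qed

lemma
  assumes "T_module G x W"
  shows T_module_subspace: "vec.subspace W"
    and T_module_A: "w \<in> W \<Longrightarrow> A w \<in> W"
    and T_module_P: "w \<in> W \<Longrightarrow> P i w \<in> W"
proof -
  show s: "vec.subspace W" using assms by (simp add: T_module_def)
  show "w \<in> W \<Longrightarrow> A w \<in> W"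
    using assms by (simp add: T_module_def terwilliger_algebra.adj)
  show "P i w \<in> W" if "w \<in> W"
  proof (cases "i \<le> D")
    case True
    then show ?thesis using assms that by (simp add: T_module_def terwilliger_algebra.idem gdiam_eq)
  next
    case False
    then show ?thesis using P_gt[of i w] vec.subspace_0[OF s] by simp
  qed
qed

lemma T_module_S:
  assumes "T_module G x W" "w \<in> W"
  shows "S f w \<in> W"
proof -
  note s = T_module_subspace[OF assms(1)]
  have "sph f (($) w) \<in> {g. vec_lambda g \<in> W}"
  proof (rule sph_closed)
    fix g h assume "g \<in> {g. vec_lambda g \<in> W}" "h \<in> {g. vec_lambda g \<in> W}"
    then have "vec_lambda g + vec_lambda h \<in> W" using vec.subspace_add[OF s] by blast
    also have "vec_lambda g + vec_lambda h = (\<chi> y. g y + h y)" by (simp add: cvec_eq_iff)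
    finally show "(\<lambda>y. g y + h y) \<in> {g. vec_lambda g \<in> W}" by simp
  next
    fix g and r :: real assume "g \<in> {g. vec_lambda g \<in> W}"
    then have "of_real r *s vec_lambda g \<in> W" using vec.subspace_scale[OF s] by blast
    also have "of_real r *s vec_lambda g = (\<chi> y. r *\<^sub>R g y)"
      by (simp add: cvec_eq_iff scaleR_conv_of_real)
    finally show "(\<lambda>y. r *\<^sub>R g y) \<in> {g. vec_lambda g \<in> W}" by simp
  next
    fix g assume "g \<in> {g. vec_lambda g \<in> W}"
    then have "A (vec_lambda g) \<in> W" using T_module_A[OF assms(1)] by blast
    also have "A (vec_lambda g) = (\<chi> y. Ad g y)"
      by (simp add: cvec_eq_iff A_nth vec_lambda_inverse)
    finally show "Ad g \<in> {g. vec_lambda g \<in> W}" by simp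
  next
    show "($) w \<in> {g. vec_lambda g \<in> W}" using assms(2) by simp
  qed
  then show ?thesis by (simp add: S_def)
qed

end

text \<open>What is used of a thin irreducible module of endpoint 1: no component at distance 0,
  every component spanned by any nonzero vector in it, and a vector v of component 1, which thinness
  makes an eigenvector of the local graph.\<close>

locale endpoint_one_module = rooted_classical_graph G D q \<alpha> \<beta> x
  for G :: "'v::finite graph" and D q \<alpha> \<beta> x +
  fixes W :: "(complex^'v) set" and v :: "complex^'v" and \<eta> :: complex
  assumes T_module: "T_module G x W"
    and P_0_W: "\<And>w. w \<in> W \<Longrightarrow> P 0 w = 0"
    and thin_W: "\<And>i u w. u \<in> W \<Longrightarrow> w \<in> W \<Longrightarrow> P i u \<noteq> 0 \<Longrightarrow> \<exists>t. P i w = t *s P i u"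
    and v_in: "v \<in> W" and P_1_v: "P 1 v = v" and v_nz: "v \<noteq> 0"
    and local_eigen: "P 1 (A v) = \<eta> *s v"
begin

text \<open>\<open>S (dl j)\<close> is the distance-\<open>j\<close> matrix \<open>A\<^sub>j\<close>, so \<open>p i\<close> and \<open>n i\<close> are \<open>E\<^sub>i\<^sup>*A\<^sub>i\<^sub>-\<^sub>1v\<close> and
  \<open>E\<^sub>i\<^sup>*A\<^sub>i\<^sub>+\<^sub>1v\<close>.  As \<open>v\<close> is orthogonal to the all-ones vector, \<open>E\<^sub>i\<^sup>*A\<^sub>iv = - p i - n i\<close>.\<close>

definition p :: "nat \<Rightarrow> complex^'v" where "p i = P i (S (dl (i - 1)) v)"
definition n :: "nat \<Rightarrow> complex^'v" where "n i = P i (S (dl (i + 1)) v)"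

lemma p_1 [simp]: "p (Suc 0) = v"
  using P_1_v by (simp add: p_def)

lemma p_in: "p i \<in> W" and n_in: "n i \<in> W"
  unfolding p_def n_def by (intro T_module_P[OF T_module] T_module_S[OF T_module] v_in)+

lemma P_p [simp]: "P i (p j) = (if i = j then p j else 0)"
  and P_n [simp]: "P i (n j) = (if i = j then n j else 0)"
  unfolding p_def n_def by auto

lemma v_nth_0: "gdist G x z \<noteq> 1 \<Longrightarrow> v $ z = 0"
  using arg_cong[OF P_1_v, of "\<lambda>w. w $ z"] by simp

text \<open>The entry of \<open>A v\<close> at x is the sum of v over the neighbours of x, and it
  belongs to component 0 of the module.\<close>

lemma sum_v: "(\<Sum>z\<in>UNIV. v $ z) = 0"
proof -
  have "P 0 (A v) $ x = 0"
    using P_0_W[OF T_module_A[OF T_module v_in]] by simp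
  then have "(\<Sum>z | G x z. v $ z) = 0" by (simp add: A_nth Ad_def)
  also have "(\<Sum>z | G x z. v $ z) = (\<Sum>z\<in>UNIV. v $ z)"
    by (rule sum.mono_neutral_left) (auto simp: v_nth_0)
  finally show ?thesis .
qed

text \<open>From a vertex at distance i, the support of v is seen only at distances i - 1, i and i +
  1. As v sums to zero, the constant \<open>f i\<close> may be subtracted from f, which removes the
  middle distance.\<close>

lemma P_S:
  assumes "i \<ge> 1"
  shows "P i (S f v) = of_real (f (i - 1) - f i) *s p i + of_real (f (i + 1) - f i) *s n i"
proof -
  have "sph f (($) v) y = of_real (f (i - 1) - f i) * sph (dl (i - 1)) (($) v) y
     + of_real (f (i + 1) - f i) * sph (dl (i + 1)) (($) v) y"
    if y: "gdist G x y = i" for y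
  proof -
    have "sph f (($) v) y = sph f (($) v) y - f i *\<^sub>R (\<Sum>z\<in>UNIV. v $ z)"
      by (simp add: sum_v)
    also have "\<dots> = (\<Sum>z\<in>UNIV. (f (gdist G y z) - f i) *\<^sub>R v $ z)"
      by (simp add: sph_def scaleR_diff_left sum_subtractf scaleR_sum_right)
    also have "\<dots> = (\<Sum>z\<in>UNIV. ((f (i - 1) - f i) * dl (i - 1) (gdist G y z)
                       + (f (i + 1) - f i) * dl (i + 1) (gdist G y z)) *\<^sub>R v $ z)"
    proof (rule sum.cong[OF refl])
      fix z
      show "(f (gdist G y z) - f i) *\<^sub>R v $ z = ((f (i - 1) - f i) * dl (i - 1) (gdist G y z)
                       + (f (i + 1) - f i) * dl (i + 1) (gdist G y z)) *\<^sub>R v $ z"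
      proof (cases "gdist G x z = 1")
        case True
        then have "gdist G y z \<le> i + 1" "i \<le> gdist G y z + 1"
          using gdist_triangle[of y z x] gdist_triangle[of x y z] y True
            gdist_commute[of y x] gdist_commute[of z y] by linarith+
        then consider "gdist G y z = i - 1" | "gdist G y z = i" | "gdist G y z = i + 1" by linarith
        then show ?thesis using assms by cases (auto simp: dl_def)
      qed (simp add: v_nth_0)
    qed
    also have "\<dots> = of_real (f (i - 1) - f i) * sph (dl (i - 1)) (($) v) y
     + of_real (f (i + 1) - f i) * sph (dl (i + 1)) (($) v) y"
      unfolding sph_def sum_distrib_left sum.distrib[symmetric]
      by (rule sum.cong) (simp_all add: scaleR_conv_of_real algebra_simps)
    finally show ?thesis .
  qed
  then show ?thesis by (auto simp: cvec_eq_iff p_def n_def S_def algebra_simps)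
qed

text \<open>The common source of the relations below: both sides are expressed through p and n by
  \<open>P_S\<close>, and different choices of a delta function f isolate different blocks of
  A.\<close>

lemma P_A_S:
  assumes "i \<ge> 1"
  shows "P i (S (Bop f) v) = P i (A (P (i - 1) (S f v))) + P i (A (P i (S f v)))
     + P i (A (P (i + 1) (S f v)))"
  using P_A[OF assms, of "S f v"] by (simp add: A_S)

lemma P_0_S [simp]: "P 0 (S f v) = 0"
  by (intro P_0_W T_module_S[OF T_module] v_in)

lemma P_v: "P j v = (if j = 1 then v else 0)"
  using arg_cong[OF P_1_v, of "P j"] P_1_v by (auto split: if_splits)

lemma dl_self: "dl j j = 1" and dl_neq: "i \<noteq> j \<Longrightarrow> dl j i = 0"
  by (simp_all add: dl_def)

text \<open>For f = \<open>dl (i - 1)\<close> the components of \<open>S f v\<close> at distances i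
  + 1 and i + 2 vanish, so at distance i + 1 only the raised part of p i is left.
  \<open>lower_n\<close> is the mirror image with \<open>dl (i + 2)\<close>.\<close>

lemma raise_p:
  assumes "i \<ge> 1"
  shows "P (i + 1) (A (p i)) = of_real (cc i) *s p (i + 1)"
  using P_A_S[of "i + 1" "dl (i - 1)"] assms
  by (cases "i = 1") (simp_all add: P_S Bop_dl A_add A_scale P_add P_scale P_v dl_self dl_neq)

lemma lower_n:
  assumes "i \<ge> 1"
  shows "P i (A (n (i + 1))) = of_real (bb (i + 1)) *s n i"
  using P_A_S[of i "dl (i + 2)"] assms
  by (cases "i = 1") (simp_all add: P_S Bop_dl A_add A_scale P_add P_scale P_v dl_self dl_neq)

lemma flat_p:
  assumes "i \<ge> 2"
  shows "P i (A (p i)) = P i (A (p (i - 1))) + P i (A (n (i - 1)))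
     - of_real (cc i) *s (p i + n i) + of_real (aa (i - 1)) *s p i"
  using P_A_S[of i "dl (i - 1)"] assms
  by (simp add: P_S Bop_dl A_add A_scale P_add P_scale A_minus P_minus A_diff P_diff P_v aa_0 dl_self dl_neq)
    (simp add: cvec_eq_iff algebra_simps del: P_nth)

lemma lower_p:
  assumes "i \<ge> 1"
  shows "P i (A (p (i + 1))) = P i (A (n i)) - P i (A (n (i + 1)))
     + of_real (bb i) *s (p i + n i) - of_real (aa (i + 1)) *s n i"
  using P_A_S[of i "dl (i + 1)"] assms
  by (cases "i = 1") (simp_all add: P_S Bop_dl A_add A_scale P_add P_scale A_minus P_minus A_diff P_diff aa_0 dl_self dl_neq
      cvec_eq_iff algebra_simps del: P_nth)

text \<open>The local part of \<open>A v\<close> is - p 1 - n 1, and it also equals \<eta> v. Hence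
  the first ratio of n to p is -1 - \<eta>, the variable in which local eigenvalues are treated from
  here on.\<close>

lemma n_1: "n 1 = (- 1 - \<eta>) *s v"
  using P_A_S[of 1 "dl 0"] local_eigen
  by (simp add: P_S Bop_dl A_add A_scale P_add P_scale A_minus P_minus A_diff P_diff P_v aa_0 dl_self dl_neq)
    (simp add: cvec_eq_iff algebra_simps del: P_nth)

end

section \<open>Thin modules of endpoint one\<close>

context classical_graph
begin

text \<open>The sum of the squared differences of f along edges is computed from A f =
  \<open>bb 0\<close> f and the regularity of the graph, and it vanishes. Connectedness does the
  rest.\<close>

lemma Ad_eigen_const_real:
  fixes f :: "'v \<Rightarrow> real"
  assumes "Ad f = (\<lambda>y. bb 0 * f y)"
  shows "f y = f z"
proof -
  have "(\<Sum>y\<in>UNIV. \<Sum>z | G y z. (f y - f z)\<^sup>2)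
      = (\<Sum>y\<in>UNIV. bb 0 * (f y)\<^sup>2 - 2 * f y * Ad f y + Ad (\<lambda>z. (f z)\<^sup>2) y * 1)"
    by (rule sum.cong)
      (simp_all add: power2_diff Ad_def sum.distrib sum_subtractf sum_distrib_left card_neighbours)
  also have "\<dots> = (\<Sum>y\<in>UNIV. bb 0 * (f y)\<^sup>2 - 2 * f y * Ad f y)
      + (\<Sum>y\<in>UNIV. (f y)\<^sup>2 * Ad (\<lambda>_. 1) y)"
    unfolding Ad_self_adjoint[symmetric] by (simp add: sum.distrib)
  also have "\<dots> = 0"
    unfolding assms sum.distrib[symmetric]
    by (rule sum.neutral) (simp add: Ad_def card_neighbours power2_eq_square)
  finally have "(\<Sum>z | G y z. (f y - f z)\<^sup>2) = 0" for y
    by (subst (asm) sum_nonneg_eq_0_iff) (auto intro: sum_nonneg)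
  then have step: "f y = f z" if "G y z" for y z
    using that by (subst (asm) sum_nonneg_eq_0_iff) auto
  have "G\<^sup>*\<^sup>* y z" using connected_simple by (auto simp: connected_simple_graph_def)
  then show ?thesis by induction (auto dest: step)
qed

lemma Ad_eigen_const:
  fixes f :: "'v \<Rightarrow> complex"
  assumes "Ad f = (\<lambda>y. bb 0 *\<^sub>R f y)"
  shows "f y = f z"
proof -
  have "Ad (\<lambda>y. Re (f y)) y = bb 0 * Re (f y)" "Ad (\<lambda>y. Im (f y)) y = bb 0 * Im (f y)" for y
    using arg_cong[OF fun_cong[OF assms, of y], of Re] arg_cong[OF fun_cong[OF assms, of y], of Im]
    by (simp_all add: Ad_def)
  then show ?thesis
    using Ad_eigen_const_real[of "\<lambda>y. Re (f y)" y z] Ad_eigen_const_real[of "\<lambda>y. Im (f y)" y z]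
    by (simp add: complex_eq_iff fun_eq_iff)
qed

end

text \<open>The algebra behind \<open>local_eigenvalue\<close>, with T for [D-1](\<beta> - \<alpha>)
  and e for [D-2](\<beta> - \<alpha>(1 + q)). Multiplying \<open>main\<close> by lam eliminates g2.
  A factor g q e then cancels and leaves lam = q (T + g)(1 + \<alpha>), a quadratic equation for
  g.\<close>

lemma local_eigenvalue_roots:
  fixes g g2 lam \<phi> :: complex and q \<alpha> \<beta> b1 b2 c2 k \<theta> \<theta>2 T R e :: real
  assumes "q > 0" "e \<noteq> 0" "\<theta> = T - 1" "b1 = q * T" "b2 = q\<^sup>2 * e" "c2 = (1 + q) * (1 + \<alpha>)"
    "\<theta> - k + b1 + c2 - q - q * \<theta>2 = q * (q + 1)"
    "b1 - k + c2 - 1 - q + T = q * e" "T = R * (\<beta> - \<alpha>)"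
    "b1 - k + c2 - 1 - q - q * \<alpha> = \<alpha> - \<beta> - \<alpha> * q * R"
    and lam: "lam = of_real b1 + g * (of_real (b1 - k + c2 - 1) - g)"
    and g2: "g2 * lam = of_real b2 * g"
    and \<phi>: "\<phi> = of_real (k - b1 - 1) - of_real c2 * (1 + g2) + (1 + g)"
    and main: "(of_real q + 1) * lam = (of_real \<theta> + 1 + g) * (of_real \<theta> - \<phi> + of_real q * (- 1 - g - of_real \<theta>2))"
  shows "g = 0 \<or> g = of_real (- \<alpha> * q * R) \<or> g = of_real (\<alpha> - \<beta>)"
proof (cases "g = 0")
  case False
  define Q B where "Q = complex_of_real q" and "B = complex_of_real b2"
  define \<Delta> where "\<Delta> = complex_of_real (b1 - k + c2 - 1)"
  define t E where "t = complex_of_real T" and "E = complex_of_real e"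
  define a where "a = complex_of_real \<alpha>"
  have "Q + 1 = of_real (q + 1)" by (simp add: Q_def)
  also have "\<dots> \<noteq> 0" using assms(1) by (simp only: of_real_eq_0_iff)
  finally have nz: "Q \<noteq> 0" "E \<noteq> 0" "Q + 1 \<noteq> 0"
    using assms(1,2) by (simp_all add: Q_def E_def)
  have c2: "complex_of_real c2 = (1 + Q) * (1 + a)" by (simp add: assms(6) Q_def a_def)
  have B: "B = Q\<^sup>2 * E" by (simp add: B_def assms(5) Q_def E_def)
  have "of_real \<theta> - of_real (k - b1 - 1) + of_real c2 - 1 - Q - Q * of_real \<theta>2
     = complex_of_real (\<theta> - k + b1 + c2 - q - q * \<theta>2)"
    by (simp add: Q_def)
  then have y0: "of_real \<theta> - of_real (k - b1 - 1) + of_real c2 - 1 - Q - Q * of_real \<theta>2 = Q * (Q + 1)"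
    unfolding assms(7) by (simp add: Q_def)
  have "of_real \<theta> - \<phi> + Q * (- 1 - g - of_real \<theta>2) =
     (of_real \<theta> - of_real (k - b1 - 1) + of_real c2 - 1 - Q - Q * of_real \<theta>2) + of_real c2 * g2 - (Q + 1) * g"
    unfolding \<phi> by (simp add: algebra_simps)
  also have "\<dots> = (Q + 1) * (Q - g) + of_real c2 * g2" unfolding y0 by (simp add: algebra_simps)
  finally have "(Q + 1) * lam = (t + g) * ((Q + 1) * (Q - g) + of_real c2 * g2)"
    using main unfolding Q_def[symmetric] by (simp add: assms(3) t_def)
  then have "((Q + 1) * lam) * lam = ((t + g) * ((Q + 1) * (Q - g) + of_real c2 * g2)) * lam" by simp
  then have "(Q + 1) * lam * lam = (t + g) * ((Q + 1) * (Q - g) * lam + of_real c2 * (g2 * lam))"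
    by (simp add: algebra_simps)
  then have "(Q + 1) * (lam * lam) = (Q + 1) * ((t + g) * ((Q - g) * lam + (1 + a) * (B * g)))"
    unfolding g2 B_def[symmetric] c2 by (simp add: algebra_simps)
  then have "lam * lam = (t + g) * ((Q - g) * lam + (1 + a) * (B * g))" using nz by simp
  then have "lam * (lam - (t + g) * (Q - g)) = (t + g) * (1 + a) * B * g" by (simp add: algebra_simps)
  moreover have "lam - (t + g) * (Q - g) = g * (\<Delta> - Q + t)"
    unfolding lam \<Delta>_def[symmetric] by (simp add: assms(4) Q_def t_def algebra_simps)
  moreover have "\<Delta> - Q + t = Q * E"
    using arg_cong[OF assms(8), of complex_of_real] by (simp add: \<Delta>_def Q_def t_def E_def)
  ultimately have "g * (Q * E) * lam = g * (Q * E) * (Q * (t + g) * (1 + a))"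
    by (simp add: B power2_eq_square mult_ac)
  then have "lam = Q * (t + g) * (1 + a)" using False nz by simp
  then have "Q * t + g * \<Delta> - g * g = Q * (t + g) * (1 + a)"
    unfolding lam \<Delta>_def[symmetric] by (simp add: assms(4) Q_def t_def algebra_simps)
  moreover have "\<Delta> = Q + Q * a + of_real (\<alpha> - \<beta>) - of_real (\<alpha> * q * R)"
    using arg_cong[OF assms(10), of complex_of_real] by (simp add: \<Delta>_def Q_def a_def algebra_simps)
  moreover have "Q * a * t = - of_real (\<alpha> - \<beta>) * of_real (\<alpha> * q * R)"
    by (simp add: Q_def a_def t_def assms(9) algebra_simps)
  ultimately have "(g - of_real (\<alpha> - \<beta>)) * (g + of_real (\<alpha> * q * R)) = 0"
    by (simp add: algebra_simps)
  then show ?thesis by (auto simp: eq_neg_iff_add_eq_0)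
qed simp

context endpoint_one_module
begin

lemma W_closed:
  "u \<in> W \<Longrightarrow> w \<in> W \<Longrightarrow> u + w \<in> W" "w \<in> W \<Longrightarrow> c *s w \<in> W" "u \<in> W \<Longrightarrow> w \<in> W \<Longrightarrow> u - w \<in> W"
  "w \<in> W \<Longrightarrow> A w \<in> W" "w \<in> W \<Longrightarrow> P i w \<in> W"
  using T_module_subspace[OF T_module] T_module_A[OF T_module] T_module_P[OF T_module]
  by (simp_all add: vec.subspace_add vec.subspace_scale vec.subspace_diff)

text \<open>Raising and lowering are adjoint, so \<open>cc i\<close> times the squared norm of p (i
  + 1) is the pairing of the lowered p (i + 1) with p i.\<close>

lemma p_eq_0:
  assumes "P i (A (p (i + 1))) = 0" "1 \<le> i" "i \<le> D"
  shows "p (i + 1) = 0"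
proof -
  have "cip (p (i + 1)) (of_real (cc i) *s p (i + 1)) = cip (P (i + 1) (p (i + 1))) (A (p i))"
    unfolding cip_P raise_p[OF assms(2)] ..
  also have "\<dots> = cip (P i (A (p (i + 1)))) (p i)" by (simp add: cip_P cip_A)
  finally have "of_real (cc i) * cip (p (i + 1)) (p (i + 1)) = 0"
    unfolding assms(1) by (simp add: cip_scale_right)
  moreover have "cc i \<noteq> 0" using cc_pos[of i] assms(2,3) by simp
  ultimately have "cip (p (i + 1)) (p (i + 1)) = 0" by simp
  then show ?thesis by (rule cip_self)
qed

text \<open>If \<open>n i = g i \<cdot> p i\<close>, then \<open>L\<close> maps \<open>p (i + 1)\<close> to \<open>lam g i \<cdot> p i\<close>, and \<open>p i\<close> is an eigenvector of
  \<open>E\<^sub>i\<^sup>*AE\<^sub>i\<^sup>*\<close> with eigenvalue \<open>phi g i\<close>.\<close>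

definition lam :: "(nat \<Rightarrow> complex) \<Rightarrow> nat \<Rightarrow> complex" where
  "lam g i = of_real (bb i) + g i * (of_real (bb i - bb (i - 1) + cc (i + 1) - cc i)
     + of_real (cc (i - 1)) * g (i - 1) - of_real (cc i) * g i)"

definition phi :: "(nat \<Rightarrow> complex) \<Rightarrow> nat \<Rightarrow> complex" where
  "phi g i = of_real (aa (i - 1)) - of_real (cc i) * (1 + g i) + of_real (cc (i - 1)) * (1 + g (i - 1))"

lemma thin_n: "p i \<noteq> 0 \<Longrightarrow> \<exists>t. n i = t *s p i"
  using thin_W[OF p_in n_in, of i i i] by simp

lemma lower_p_lam:
  assumes "1 \<le> i" "n i = g i *s p i" "P i (A (p i)) = phi g i *s p i"
  shows "P i (A (p (i + 1))) = lam g i *s p i"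
proof -
  have "P i (A (p (i + 1))) = (g i * phi g i - of_real (bb (i + 1)) * g i
      + of_real (bb i) * (1 + g i) - of_real (aa (i + 1)) * g i) *s p i"
    unfolding lower_p[OF assms(1)] lower_n[OF assms(1)] assms(2) A_scale P_scale assms(3)
    by (simp add: cvec_eq_iff algebra_simps)
  also have "g i * phi g i - of_real (bb (i + 1)) * g i
      + of_real (bb i) * (1 + g i) - of_real (aa (i + 1)) * g i = lam g i"
    by (simp add: lam_def phi_def aa_def algebra_simps)
  finally show ?thesis .
qed

lemma flat_p_phi:
  assumes "1 \<le> i" "n i = g i *s p i" "n (i + 1) = g (i + 1) *s p (i + 1)"
  shows "P (i + 1) (A (p (i + 1))) = phi g (i + 1) *s p (i + 1)"
proof -
  have "P (i + 1) (A (p (i + 1))) = P (i + 1) (A (p i)) + P (i + 1) (A (n i))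
     - of_real (cc (i + 1)) *s (p (i + 1) + n (i + 1)) + of_real (aa i) *s p (i + 1)"
    using flat_p[of "i + 1"] assms(1) by simp
  then show ?thesis
    unfolding assms(2,3) A_scale P_scale raise_p[OF assms(1)]
    by (simp add: cvec_eq_iff phi_def algebra_simps del: P_nth)
qed

lemma flat_v:
  assumes "n 1 = g 1 *s p 1"
  shows "P 1 (A (p 1)) = phi g 1 *s p 1"
proof -
  have "(- 1 - \<eta>) *s v = g 1 *s v" using assms n_1 by simp
  then have "\<eta> = - 1 - g 1" using v_nz by (simp only: vec.scale_cancel_right) (simp add: algebra_simps)
  then show ?thesis using local_eigen by (simp add: phi_def aa_0)
qed

text \<open>If n (i + 1) = t p (i + 1), lowering this vector in two ways gives
  \<open>t * lam g i = bb (i + 1) * g i\<close>, so the recursion forces t = g (i + 1). Nonvanishing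
  of \<open>lam g i\<close> keeps p (i + 1) nonzero.\<close>

lemma module_parameters:
  assumes g1: "n 1 = g 1 *s p 1"
    and rec: "\<And>i. 1 \<le> i \<Longrightarrow> i + 1 < D \<Longrightarrow> lam g i \<noteq> 0 \<and> g (i + 1) * lam g i = of_real (bb (i + 1)) * g i"
  shows "1 \<le> i \<Longrightarrow> i < D \<Longrightarrow>
    p i \<noteq> 0 \<and> n i = g i *s p i \<and> P i (A (p i)) = phi g i *s p i \<and> P i (A (p (i + 1))) = lam g i *s p i"
proof (induction i rule: dec_induct[of 1])
  case base
  then show ?case using g1 flat_v[of g, OF g1] lower_p_lam[of 1 g] v_nz by simp
next
  case (step i)
  then have IH: "p i \<noteq> 0" "n i = g i *s p i" "P i (A (p i)) = phi g i *s p i"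
    "P i (A (p (i + 1))) = lam g i *s p i"
    by simp_all
  have r: "lam g i \<noteq> 0" "g (i + 1) * lam g i = of_real (bb (i + 1)) * g i"
    using rec[of i] step by simp_all
  have "lam g i *s p i \<noteq> 0" using IH(1) r(1) by (simp add: vec.scale_eq_0_iff)
  then have pn: "p (i + 1) \<noteq> 0" using IH(4) by (metis A_0 P_0)
  obtain t where t: "n (i + 1) = t *s p (i + 1)"
    using thin_n[OF pn] by blast
  have "(t * lam g i) *s p i = P i (A (n (i + 1)))"
    unfolding t A_scale P_scale IH(4) vector_smult_assoc ..
  also have "\<dots> = (of_real (bb (i + 1)) * g i) *s p i"
    unfolding lower_n[OF step(1)] IH(2) vector_smult_assoc ..
  finally have "(t * lam g i) *s p i = (of_real (bb (i + 1)) * g i) *s p i" .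
  then have "t * lam g i = g (i + 1) * lam g i" using IH(1) r(2) by (simp only: vec.scale_cancel_right) simp
  then have t': "t = g (i + 1)" using r(1) by simp
  have n': "n (i + 1) = g (i + 1) *s p (i + 1)" using t t' by simp
  have f': "P (i + 1) (A (p (i + 1))) = phi g (i + 1) *s p (i + 1)"
    by (rule flat_p_phi[OF _ IH(2) n']) (use step in simp)
  show ?case using pn n' f' lower_p_lam[OF _ n' f'] by simp
qed

end

section \<open>The equation for the local eigenvalue\<close>

context endpoint_one_module
begin

lemma local_eigenvalue:
  "- 1 - \<eta> = 0 \<or> - 1 - \<eta> = of_real (- \<alpha> * q * br (D - 1)) \<or> - 1 - \<eta> = of_real (\<alpha> - \<beta>)
    \<or> - 1 - \<eta> = of_real q"
proof -
  define g where "g = - 1 - \<eta>"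
  define lam1 where "lam1 = of_real (bb 1) + g * (of_real (bb 1 - bb 0 + cc 2 - 1) - g)"
  have q0: "q > 0" using q_ge by simp
  have n1: "n 1 = g *s v" unfolding g_def by (rule n_1)
  have n1_eq: "n 1 = (\<lambda>_. g) 1 *s p 1" using n1 by simp
  have \<eta>: "\<eta> = - 1 - g" by (simp add: g_def)
  have lam1_eq: "lam (\<lambda>_. g) 1 = lam1" by (simp add: lam_def lam1_def numeral_2_eq_2)
  have low: "P 1 (A (p 2)) = lam1 *s v"
    using lower_p_lam[of 1 "\<lambda>_. g", OF _ n1_eq flat_v[of "\<lambda>_. g", OF n1_eq]]
    unfolding lam1_eq by (simp add: numeral_2_eq_2)
  have raise: "P 2 (A v) = p 2" using raise_p[of 1] by (simp add: numeral_2_eq_2)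
  \<comment> \<open>If p 2 vanished, \<open>flat_p\<close> would give n 2 = 0, then
    \<open>lower_n\<close> would give g = 0, and lam1 would be both 0 and
    \<open>bb 1\<close>.\<close>
  have p2: "p 2 \<noteq> 0"
  proof
    assume z: "p 2 = 0"
    then have "lam1 = 0" using low v_nz by (simp add: vec.scale_eq_0_iff)
    have "P 2 (A (n 1)) = 0" unfolding n1 A_scale P_scale raise z by simp
    then have "of_real (cc 2) *s n 2 = 0"
      using flat_p[of 2] raise z by simp
    then have "n 2 = 0" using cc_pos[of 2] D_ge by (simp add: vec.scale_eq_0_iff)
    then have "of_real (bb 2) *s n 1 = 0" using lower_n[of 1] by (simp add: numeral_2_eq_2)
    then have "g = 0" using bb_pos[of 2] D_ge v_nz n1 by (simp add: vec.scale_eq_0_iff)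
    then have "lam1 = of_real (bb 1)" by (simp add: lam1_def)
    then show False using \<open>lam1 = 0\<close> bb_pos[of 1] D_ge by simp
  qed
  obtain g2 where g2: "n 2 = g2 *s p 2" using thin_n[OF p2] by blast
  have g2_lam1: "g2 * lam1 = of_real (bb 2) * g"
  proof -
    have "(g2 * lam1) *s v = P 1 (A (n 2))"
      unfolding g2 A_scale P_scale low vector_smult_assoc ..
    also have "\<dots> = (of_real (bb 2) * g) *s v"
      using lower_n[of 1] n1 by (simp add: numeral_2_eq_2 vector_smult_assoc)
    finally show ?thesis using v_nz by (simp only: vec.scale_cancel_right) simp
  qed
  define \<phi> where "\<phi> = of_real (bb 0 - bb 1 - 1) - of_real (cc 2) * (1 + g2) + (1 + g)"
  have flat2: "P 2 (A (p 2)) = \<phi> *s p 2"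
  proof -
    have "P 2 (A (p 2)) = p 2 + g *s p 2 - of_real (cc 2) *s (p 2 + g2 *s p 2) + of_real (aa 1) *s p 2"
      using flat_p[of 2] raise unfolding g2 by (simp add: n1[simplified] A_scale P_scale)
    then show ?thesis by (simp add: cvec_eq_iff \<phi>_def aa_def algebra_simps del: P_nth)
  qed
  show ?thesis
  proof (cases "g = of_real q")
    case True
    then show ?thesis by (simp add: g_def)
  next
    case False
    \<comment> \<open>w is an eigenvector of A for \<open>th 1\<close>. Its component 1 is a
      multiple of q - g, which is why g = q had to be set aside.\<close>
    define w where "w = S uu v"
    define e where "e i = complex_of_real ((q - 1) / q ^ (i + 1))" for i
    have w_in: "w \<in> W" unfolding w_def by (intro T_module_S[OF T_module] v_in)
    have Pw: "P i w = e i *s (of_real q *s p i - n i)" if "i \<ge> 1" for i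
    proof -
      have "uu (i - 1) - uu i = (q - 1) / q ^ (i + 1) * q" "uu (i + 1) - uu i = - ((q - 1) / q ^ (i + 1))"
        using q0 that by (cases i; simp add: uu_def X_def field_simps)+
      then have r: "complex_of_real (uu (i - 1) - uu i) = e i * of_real q"
        "complex_of_real (uu (i + 1) - uu i) = - e i"
        by (simp_all only: e_def of_real_mult of_real_minus)
      show ?thesis unfolding w_def P_S[OF that] r
        by (simp add: cvec_eq_iff algebra_simps)
    qed
    define w1 w2 where "w1 = e 1 * (of_real q - g)" and "w2 = e 2 * (of_real q - g2)"
    have Pw1: "P 1 w = w1 *s v" unfolding Pw[OF order_refl] n1 w1_def
      by (simp add: cvec_eq_iff algebra_simps)
    have Pw2: "P 2 w = w2 *s p 2" using Pw[of 2] unfolding g2 w2_def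
      by (simp add: cvec_eq_iff algebra_simps)
    have w1_nz: "w1 \<noteq> 0" unfolding w1_def e_def using q_ge False by simp
    have P0: "P 0 u = 0" if "u \<in> W" for u using P_0_W[OF that] .
    have Aw: "A w = of_real (th 1) *s w"
    proof -
      have "A w = S (\<lambda>i. th 1 * uu i) v" unfolding w_def A_S Bop_uu[abs_def] ..
      also have "\<dots> = of_real (th 1) *s w"
        by (simp add: w_def S_def sph_def cvec_eq_iff sum_distrib_left scaleR_conv_of_real mult_ac)
      finally show ?thesis .
    qed
    obtain \<tau> where \<tau>: "P 2 (A (P 3 w)) = \<tau> *s p 2"
      using thin_W[of "p 2" "A (P 3 w)" 2] p2 p_in w_in W_closed by auto
    define f where "f = (\<Sum>i\<le>D. complex_of_real (uu i) *s P i w)"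
    have f_nth: "f $ y = of_real (uu (gdist G x y)) * w $ y" for y
      unfolding f_def sum_P by simp
    have f_in: "f \<in> W" unfolding f_def
      by (rule vec.subspace_sum[OF T_module_subspace[OF T_module]]) (intro W_closed w_in)
    have Pf: "P i f = of_real (uu i) *s P i w" for i by (auto simp: cvec_eq_iff f_nth)
    define z where "z = A f - of_real (th 2) *s f"
    have z_in: "z \<in> W" unfolding z_def by (intro W_closed f_in)
    define z0 where "z0 = A z - of_real (th 1) *s z"
    have z0_in: "z0 \<in> W" unfolding z0_def by (intro W_closed z_in)
    \<comment> \<open>By the three-term relation A - \<open>th 0\<close> kills z0, so z0 is
      constant, and its entry at x is zero. Thus z is an eigenvector for
      \<open>th 1\<close>.\<close>
    have "z0 = 0"
    proof -
      have fn: "($) f = (\<lambda>y. uu (gdist G x y) *\<^sub>R sph uu (($) v) y)"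
        by (rule ext) (simp add: f_nth w_def S_def scaleR_conv_of_real)
      have sh_vec: "($) (A u - of_real r *s u) = sh r (($) u)" for u r
        by (rule ext) (simp add: sh_def A_nth scaleR_conv_of_real)
      have "sh (th 0) (($) z0) = (\<lambda>_. 0)"
        unfolding z0_def z_def sh_vec fn using Nop_dual_uu by (simp add: Nop_def)
      then have "Ad (($) z0) = (\<lambda>y. bb 0 *\<^sub>R z0 $ y)"
        by (simp add: sh_def fun_eq_iff th_0)
      then have "z0 $ y = z0 $ x" for y by (rule Ad_eigen_const)
      moreover have "z0 $ x = 0" using arg_cong[OF P0[OF z0_in], of "\<lambda>u. u $ x"] by simp
      ultimately show ?thesis by (simp add: cvec_eq_iff)
    qed
    then have Az: "A z = of_real (th 1) *s z" by (simp add: z0_def)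
    have "P 1 w \<noteq> 0" using Pw1 w1_nz v_nz by (simp add: vec.scale_eq_0_iff)
    then obtain a where a: "P 1 z = a *s P 1 w" using thin_W[OF w_in z_in] by blast
    \<comment> \<open>An eigenvector for \<open>th 1\<close> in W with zero component 1 has zero
      component 2, because lowering is injective on the span of p 2. Hence z and w are proportional
      in both components with the same factor.\<close>
    have a2: "P 2 z = a *s P 2 w"
    proof -
      define z' where "z' = z - a *s w"
      have z'_in: "z' \<in> W" unfolding z'_def by (intro W_closed z_in w_in)
      have Az': "A z' = of_real (th 1) *s z'"
        by (simp add: z'_def A_diff A_scale Az Aw vector_ssub_ldistrib vector_smult_assoc mult.commute)
      have P1: "P 1 z' = 0" unfolding z'_def P_diff P_scale a by simp
      obtain t where t: "P 2 z' = t *s p 2"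
        using thin_W[of "p 2" z' 2] p2 p_in z'_in by auto
      have "P 1 (A z') = (t * lam1) *s v"
        using P_A[of 1 z'] P0[OF z'_in] P1 t low
        by (simp add: numeral_2_eq_2[symmetric] A_scale P_scale vector_smult_assoc)
      then have "t * lam1 = 0" unfolding Az' P_scale P1 using v_nz by (simp add: vec.scale_eq_0_iff)
      moreover have "lam1 \<noteq> 0" using p_eq_0[of 1] low p2 D_ge by (auto simp: numeral_2_eq_2)
      ultimately have "P 2 z' = 0" using t by simp
      then show ?thesis by (simp add: z'_def P_diff P_scale)
    qed
    have P1A: "P 1 (A u) = P 1 (A (P 1 u)) + P 1 (A (P 2 u))" if "u \<in> W" for u
      using P_A[of 1 u] P0[OF that] by (simp add: numeral_2_eq_2)
    have P2A: "P 2 (A u) = P 2 (A (P 1 u)) + P 2 (A (P 2 u)) + P 2 (A (P 3 u))" for u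
      using P_A[of 2 u] by (simp add: numeral_3_eq_3 numeral_2_eq_2)
    note sc = A_scale P_scale vector_smult_assoc
    have "(w1 * \<eta> + w2 * lam1) *s v = (of_real (th 1) * w1) *s v"
      using P1A[OF w_in] unfolding Aw Pw1 Pw2 sc local_eigen low vector_sadd_rdistrib by simp
    then have E1: "w1 * \<eta> + w2 * lam1 = of_real (th 1) * w1"
      using v_nz by (simp only: vec.scale_cancel_right) simp
    have "(w1 + w2 * \<phi> + \<tau>) *s p 2 = (of_real (th 1) * w2) *s p 2"
      using P2A[of w] unfolding Aw Pw1 Pw2 sc raise flat2 \<tau> vector_sadd_rdistrib by simp
    then have E2: "w1 + w2 * \<phi> + \<tau> = of_real (th 1) * w2"
      using p2 by (simp only: vec.scale_cancel_right) simp
    define u1 u2 u3 where "u1 = complex_of_real (uu 1)" and "u2 = complex_of_real (uu 2)"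
      and "u3 = complex_of_real (uu 3)"
    have "P 1 z = (u1 * w1 * \<eta> + u2 * w2 * lam1 - of_real (th 2) * u1 * w1) *s v"
      unfolding z_def P_diff P1A[OF f_in] Pf u1_def u2_def
      unfolding Pw1 Pw2 sc local_eigen low Pf
      by (simp add: cvec_eq_iff algebra_simps)
    then have "(u1 * w1 * \<eta> + u2 * w2 * lam1 - of_real (th 2) * u1 * w1) *s v = (a * w1) *s v"
      unfolding a Pw1 sc by simp
    then have E3: "u1 * w1 * \<eta> + u2 * w2 * lam1 - of_real (th 2) * u1 * w1 = a * w1"
      using v_nz by (simp only: vec.scale_cancel_right) simp
    have "P 2 z = (u1 * w1 + u2 * w2 * \<phi> + u3 * \<tau> - of_real (th 2) * u2 * w2) *s p 2"
      unfolding z_def P_diff P2A[of f] Pf u1_def u2_def u3_def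
      unfolding Pw1 Pw2 sc raise flat2 Pf \<tau>
      by (simp add: cvec_eq_iff algebra_simps)
    then have "(u1 * w1 + u2 * w2 * \<phi> + u3 * \<tau> - of_real (th 2) * u2 * w2) *s p 2 = (a * w2) *s p 2"
      unfolding a2 Pw2 sc by simp
    then have E4: "u1 * w1 + u2 * w2 * \<phi> + u3 * \<tau> - of_real (th 2) * u2 * w2 = a * w2"
      using p2 by (simp only: vec.scale_cancel_right) simp
    \<comment> \<open>Consecutive differences of \<open>uu\<close> shrink by the factor q. This lets
      \<tau>, the unknown contribution of component 3, be eliminated between E2 and E4.\<close>
    define d where "d = u1 - u2"
    have d: "d \<noteq> 0" "of_real q * (u2 - u3) = d"
    proof -
      have "d = of_real ((q - 1) / q\<^sup>2)" "u2 - u3 = of_real ((q - 1) / q ^ 3)"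
        using q0 unfolding d_def u1_def u2_def u3_def of_real_diff[symmetric]
        by (simp_all add: uu_def X_def field_simps power2_eq_square power3_eq_cube)
      then show "d \<noteq> 0" "of_real q * (u2 - u3) = d" using q_ge
        by (simp_all add: power2_eq_square power3_eq_cube)
    qed
    define k where "k = complex_of_real (th 1 - th 2)"
    have s1: "(a - u1 * k) * w1 = - d * (lam1 * w2)"
    proof -
      have "(a - u1 * k) * w1 = (u1 * w1 * \<eta> + u2 * w2 * lam1 - of_real (th 2) * u1 * w1) - u1 * k * w1"
        unfolding E3 by (simp add: algebra_simps)
      also have "\<dots> = u1 * (w1 * \<eta> + w2 * lam1 - of_real (th 1) * w1) - d * (lam1 * w2)"
        by (simp add: k_def d_def algebra_simps)
      finally show ?thesis unfolding E1 by simp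
    qed
    have s2: "(a - u1 * k) * w2 + d * k * w2 = d * w1 - (u2 - u3) * \<tau>"
    proof -
      have "(a - u1 * k) * w2 + d * k * w2 = a * w2 - u2 * k * w2" by (simp add: d_def algebra_simps)
      also have "\<dots> = u2 * (w1 + w2 * \<phi> + \<tau> - of_real (th 1) * w2) + d * w1 - (u2 - u3) * \<tau>"
        unfolding E4[symmetric] by (simp add: k_def d_def algebra_simps)
      finally show ?thesis unfolding E2 by simp
    qed
    have lw: "lam1 * w2 = (of_real (th 1) - \<eta>) * w1"
      using E1 by (simp add: algebra_simps)
    have "w1 * (of_real q * (d * w1 - (u2 - u3) * \<tau>)) = of_real q * (w2 * ((a - u1 * k) * w1) + w1 * d * k * w2)"
      unfolding s2[symmetric] by (simp add: algebra_simps)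
    also have "\<dots> = w1 * d * (of_real q * w2 * (k - (of_real (th 1) - \<eta>)))"
      unfolding s1 lw by (simp add: algebra_simps)
    also have "w1 * (of_real q * (d * w1 - (u2 - u3) * \<tau>)) = w1 * d * (of_real q * w1 - \<tau>)"
      using d(2) by (simp add: algebra_simps)
    finally have "of_real q * w1 - \<tau> = of_real q * w2 * (k - (of_real (th 1) - \<eta>))"
      using w1_nz d(1) by simp
    moreover have "\<tau> = of_real (th 1) * w2 - w1 - w2 * \<phi>" using E2 by (simp add: algebra_simps)
    ultimately have "(of_real q + 1) * w1 = w2 * (of_real (th 1) - \<phi> + of_real q * (\<eta> - of_real (th 2)))"
      by (simp add: k_def algebra_simps)
    then have "lam1 * ((of_real q + 1) * w1) = (lam1 * w2) * (of_real (th 1) - \<phi> + of_real q * (\<eta> - of_real (th 2)))"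
      by simp
    then have "w1 * ((of_real q + 1) * lam1)
        = w1 * ((of_real (th 1) - \<eta>) * (of_real (th 1) - \<phi> + of_real q * (\<eta> - of_real (th 2))))"
      unfolding lw by (simp only: mult_ac)
    then have main: "(of_real q + 1) * lam1
        = (of_real (th 1) + 1 + g) * (of_real (th 1) - \<phi> + of_real q * (- 1 - g - of_real (th 2)))"
      using w1_nz unfolding \<eta> by simp
    define h where "h = br (D - 2)"
    have br1: "br (D - 1) = 1 + q * h" and brD: "br D = 1 + q * (1 + q * h)"
      unfolding h_def by (simp_all only: br_D_1 br_D_2)
    have br2: "br 2 = 1 + q" by (simp add: numeral_2_eq_2 qbracket_Suc)
    have "h > 0" unfolding h_def using D_ge q_ge by (intro qbracket_pos) auto
    moreover have "\<beta> - \<alpha> * (1 + q) > 0" using beta_alpha_pos[of 2] D_ge br2 by simp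
    ultimately have e_nz: "h * (\<beta> - \<alpha> * (1 + q)) \<noteq> 0" by simp
    have vals: "bb 0 = (1 + q * (1 + q * h)) * \<beta>" "bb 1 = q * (1 + q * h) * (\<beta> - \<alpha>)"
      "bb 2 = q\<^sup>2 * h * (\<beta> - \<alpha> * (1 + q))" "cc 2 = (1 + q) * (1 + \<alpha>)"
      "th 1 = (1 + q * h) * (\<beta> - \<alpha>) - 1" "th 2 = h * (\<beta> - \<alpha> * (1 + q)) - (1 + q)"
      by (simp_all add: bb_def cc_def th_def br2 brD br1[simplified] h_def[symmetric] algebra_simps power2_eq_square)
    have "g = 0 \<or> g = of_real (- \<alpha> * q * br (D - 1)) \<or> g = of_real (\<alpha> - \<beta>)"
      by (rule local_eigenvalue_roots[OF q0 e_nz _ _ _ vals(4) _ _ _ _ lam1_def g2_lam1 \<phi>_def main, of "(1 + q * h) * (\<beta> - \<alpha>)"])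
        (simp_all add: vals vals(2,5)[unfolded One_nat_def] br1[simplified] algebra_simps power2_eq_square)
    then show ?thesis unfolding g_def by blast
  qed
qed

end

section \<open>The parameters of the thin modules\<close>

context classical_graph
begin

definition lamR :: "(nat \<Rightarrow> real) \<Rightarrow> nat \<Rightarrow> real" where
  "lamR g i = bb i + g i * (bb i - bb (i - 1) + cc (i + 1) - cc i + cc (i - 1) * g (i - 1) - cc i * g i)"

text \<open>The ratios \<open>g i\<close> of the modules with local eigenvalue \<open>\<alpha>q[D-1] - 1\<close> and \<open>\<beta> - \<alpha> - 1\<close>.  For the local
  eigenvalues \<open>-1\<close> and \<open>-q - 1\<close> they are constantly \<open>0\<close> and \<open>q\<close>.\<close>

definition gA :: "nat \<Rightarrow> real" where
  "gA i = - \<alpha> * q ^ i * br (D - i) / (1 + \<alpha> * br (i - 1))"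

definition gB :: "nat \<Rightarrow> real" where
  "gB i = - (\<beta> - \<alpha> * br i) / (1 + \<alpha> * br (i - 1))"

lemma bb_alt: "i \<le> D \<Longrightarrow> bb i = q ^ i * br (D - i) * (\<beta> - \<alpha> * br i)"
  by (simp add: bb_def br_diff)

lemma cc_gA: "1 \<le> i \<Longrightarrow> i \<le> D \<Longrightarrow> cc i * gA i = - \<alpha> * q ^ i * br (D - i) * br i"
  and cc_gB: "1 \<le> i \<Longrightarrow> i \<le> D \<Longrightarrow> cc i * gB i = - (\<beta> - \<alpha> * br i) * br i"
  using alpha_br_pos[of "i - 1"] by (cases i; auto simp: cc_def gA_def gB_def)+

text \<open>Everything is rewritten in terms of [i-1] and [D-i-1], so that the closed forms below
  become identities of rational functions.\<close>

lemma parameter_expressions: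
  assumes "1 \<le> i" "i < D"
  obtains B E where "br (i - 1) = B" "br i = 1 + q * B" "br (i + 1) = 1 + q + q\<^sup>2 * B"
    "br (D - i - 1) = E" "br (D - i) = 1 + q * E" "br (D - (i - 1)) = 1 + q + q\<^sup>2 * E"
    "q ^ i = q * (1 + (q - 1) * B)" "q ^ (i - 1) = 1 + (q - 1) * B"
    "q ^ (i + 1) = q\<^sup>2 * (1 + (q - 1) * B)"
proof
  let ?B = "br (i - 1)" and ?E = "br (D - i - 1)"
  have s: "i = Suc (i - 1)" "D - i = Suc (D - i - 1)" "D - (i - 1) = Suc (D - i)" using assms by auto
  show "br (i - 1) = ?B" "br (D - i - 1) = ?E" by simp_all
  show b: "br i = 1 + q * ?B" by (subst s(1)) (rule qbracket_Suc)
  show "br (i + 1) = 1 + q + q\<^sup>2 * ?B" by (simp add: qbracket_Suc b algebra_simps power2_eq_square)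
  show e: "br (D - i) = 1 + q * ?E" by (subst s(2)) (rule qbracket_Suc)
  show "br (D - (i - 1)) = 1 + q + q\<^sup>2 * ?E"
    unfolding s(3) qbracket_Suc e by (simp add: algebra_simps power2_eq_square)
  show p: "q ^ (i - 1) = 1 + (q - 1) * ?B" by (rule power_br)
  show p': "q ^ i = q * (1 + (q - 1) * ?B)" by (subst s(1)) (simp only: power_Suc p)
  show "q ^ (i + 1) = q\<^sup>2 * (1 + (q - 1) * ?B)" by (simp add: p' power2_eq_square)
qed

text \<open>The factors show where the modules end: at i = D - 1 the first and third expressions
  vanish, the second only if \<beta> = \<alpha>[D].\<close>

lemma
  assumes i: "1 \<le> i" "i < D"
  shows lamR_q: "lamR (\<lambda>_. q) i = bb (i + 1)"
    and lamR_gA: "lamR gA i = q ^ i * br (D - i) * (\<beta> - \<alpha> * br (i + 1)) * (1 + \<alpha> * br i) / (1 + \<alpha> * br (i - 1))"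
    and lamR_gB: "lamR gB i = q ^ (i + 1) * br (D - i - 1) * (\<beta> - \<alpha> * br i) * (1 + \<alpha> * br i) / (1 + \<alpha> * br (i - 1))"
proof -
  obtain B E where s: "br (i - 1) = B" "br i = 1 + q * B" "br (i + 1) = 1 + q + q\<^sup>2 * B"
    "br (D - i - 1) = E" "br (D - i) = 1 + q * E" "br (D - (i - 1)) = 1 + q + q\<^sup>2 * E"
    "q ^ i = q * (1 + (q - 1) * B)" "q ^ (i - 1) = 1 + (q - 1) * B"
    "q ^ (i + 1) = q\<^sup>2 * (1 + (q - 1) * B)"
    by (rule parameter_expressions[OF i])
  have nz: "1 + \<alpha> * B \<noteq> 0" using alpha_br_pos[of "i - 1", unfolded s] i by linarith
  have b: "bb i = q * (1 + (q - 1) * B) * (1 + q * E) * (\<beta> - \<alpha> * (1 + q * B))"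
    "bb (i - 1) = (1 + (q - 1) * B) * (1 + q + q\<^sup>2 * E) * (\<beta> - \<alpha> * B)"
    "bb (i + 1) = q\<^sup>2 * (1 + (q - 1) * B) * E * (\<beta> - \<alpha> * (1 + q + q\<^sup>2 * B))"
    using i s(4) by (simp_all only: bb_alt s less_imp_le diff_le_self less_or_eq_imp_le)
      (simp_all add: bb_alt s[simplified])
  \<comment> \<open>The definition of \<open>cc (i - 1)\<close> contains [i-2], a truncated index
    for i = 1. Multiplication by q expresses it through [i-1] alone.\<close>
  have "q * cc (i - 1) = B * (q + \<alpha> * (B - 1))" using cc_br[of "i - 1"] s by simp
  have c: "cc i = (1 + q * B) * (1 + \<alpha> * B)" "cc (i + 1) = (1 + q + q\<^sup>2 * B) * (1 + \<alpha> * (1 + q * B))"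
    unfolding cc_def s using s(2) by simp_all
  have "q * lamR (\<lambda>_. q) i = q * bb (i + 1)"
  proof -
    have "q * lamR (\<lambda>_. q) i = q * bb i + q * q * (bb i - bb (i - 1) + cc (i + 1) - cc i - cc i * q)
        + q * q * (q * cc (i - 1))"
      by (simp add: lamR_def algebra_simps)
    then show ?thesis unfolding \<open>q * cc (i - 1) = _\<close> b c by (simp add: algebra_simps power2_eq_square)
  qed
  then show "lamR (\<lambda>_. q) i = bb (i + 1)" using q_ge by simp
  have ga: "cc i * gA i = - \<alpha> * (q * (1 + (q - 1) * B)) * (1 + q * E) * (1 + q * B)"
    using cc_gA[of i] i s by simp
  have ga1: "cc (i - 1) * gA (i - 1) = - \<alpha> * (1 + (q - 1) * B) * (1 + q + q\<^sup>2 * E) * B"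
    using cc_gA[of "i - 1"] i s by (cases "i = 1") simp_all
  have gA: "gA i = - \<alpha> * (q * (1 + (q - 1) * B)) * (1 + q * E) / (1 + \<alpha> * B)"
    unfolding gA_def s ..
  show "lamR gA i = q ^ i * br (D - i) * (\<beta> - \<alpha> * br (i + 1)) * (1 + \<alpha> * br i) / (1 + \<alpha> * br (i - 1))"
    unfolding lamR_def ga ga1 unfolding gA b c s using nz by (simp add: field_simps power2_eq_square)
  have gb: "cc i * gB i = - (\<beta> - \<alpha> * (1 + q * B)) * (1 + q * B)"
    using cc_gB[of i] i s by simp
  have gb1: "cc (i - 1) * gB (i - 1) = - (\<beta> - \<alpha> * B) * B"
    using cc_gB[of "i - 1"] i s by (cases "i = 1") simp_all
  have gB: "gB i = - (\<beta> - \<alpha> * (1 + q * B)) / (1 + \<alpha> * B)"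
    unfolding gB_def s ..
  show "lamR gB i = q ^ (i + 1) * br (D - i - 1) * (\<beta> - \<alpha> * br i) * (1 + \<alpha> * br i) / (1 + \<alpha> * br (i - 1))"
    unfolding lamR_def gb gb1 unfolding gB b c s using nz by (simp add: field_simps power2_eq_square)
qed

lemma lamR_0: "lamR (\<lambda>_. 0) i = bb i"
  by (simp add: lamR_def)

text \<open>The recursion of \<open>module_parameters\<close>. It stops short of
  \<open>lamR g (D - 1)\<close>, whose vanishing or not tells modules that end at D - 1 from those
  that reach D.\<close>

definition admissible :: "(nat \<Rightarrow> real) \<Rightarrow> bool" where
  "admissible g \<longleftrightarrow> (\<forall>i. 1 \<le> i \<longrightarrow> i + 1 < D \<longrightarrow> lamR g i \<noteq> 0 \<and> g (i + 1) * lamR g i = bb (i + 1) * g i)"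

lemma admissible_0: "admissible (\<lambda>_. 0)"
  unfolding admissible_def lamR_0 using bb_pos by (metis Suc_lessD add.commute add_0 less_irrefl mult_zero_left mult_zero_right plus_1_eq_Suc)

lemma admissible_q: "admissible (\<lambda>_. q)"
  unfolding admissible_def using bb_pos lamR_q by (simp add: less_imp_neq[symmetric])

lemma admissible_gA: "admissible gA"
  unfolding admissible_def
proof (intro allI impI conjI)
  fix i assume i: "1 \<le> i" "i + 1 < D"
  have pos: "1 + \<alpha> * br (i - 1) > 0" "1 + \<alpha> * br i > 0" "\<beta> - \<alpha> * br (i + 1) > 0" "br (D - i) > 0"
    using alpha_br_pos beta_alpha_pos qbracket_pos[of q "D - i"] q_ge i by auto
  then show "lamR gA i \<noteq> 0" using lamR_gA[of i] i q_ge by auto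
  show "gA (i + 1) * lamR gA i = bb (i + 1) * gA i"
    using pos i lamR_gA[of i] by (simp add: gA_def bb_alt)
qed

lemma admissible_gB: "admissible gB"
  unfolding admissible_def
proof (intro allI impI conjI)
  fix i assume i: "1 \<le> i" "i + 1 < D"
  have pos: "1 + \<alpha> * br (i - 1) > 0" "1 + \<alpha> * br i > 0" "\<beta> - \<alpha> * br i > 0" "br (D - i - 1) > 0"
    using alpha_br_pos beta_alpha_pos qbracket_pos[of q "D - i - 1"] q_ge i by auto
  then show "lamR gB i \<noteq> 0" using lamR_gB[of i] i q_ge by auto
  show "gB (i + 1) * lamR gB i = bb (i + 1) * gB i"
    using pos i lamR_gB[of i] by (simp add: gB_def bb_alt) (simp add: algebra_simps)
qed

text \<open>The eigenvalue of \<open>RL\<close> on the \<open>i\<close>-th component of a thin module of endpoint \<open>1\<close>.\<close>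

definition yy :: "(nat \<Rightarrow> real) \<Rightarrow> nat \<Rightarrow> real" where
  "yy g i = (if i \<le> 1 then 0 else cc (i - 1) * lamR g (i - 1))"

end

section \<open>The tridiagonal system of a uniform structure\<close>

context rooted_classical_graph
begin

lemma sum_mult_vec: "(\<Sum>i\<in>I. M i) *v w = (\<Sum>i\<in>I. M i *v w)"
  for M :: "nat \<Rightarrow> complex^'v^'v"
  by (induction I rule: infinite_finite_induct) (simp_all add: matrix_vector_mult_add_rdistrib)

lemma lowering_P:
  assumes "P i w = w" "i \<ge> 1"
  shows "lowering G x *v w = P (i - 1) (A w)"
proof (cases "i \<le> D")
  case True
  have "lowering G x *v w = (\<Sum>j\<in>{1..D}. P (j - 1) (A (P j (P i w))))"
    unfolding lowering_def sum_mult_vec assms(1) gdiam_eq by (simp add: matrix_vector_mul_assoc matrix_mul_assoc)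
  also have "\<dots> = (\<Sum>j\<in>{1..D}. if j = i then P (i - 1) (A (P i w)) else 0)"
    by (intro sum.cong) (auto simp del: P_nth)
  finally show ?thesis using True assms by (simp add: sum.delta)
next
  case False
  then have "w = 0" using P_gt[of i w] assms by simp
  then show ?thesis by simp
qed

lemma raising_P:
  assumes "P i w = w"
  shows "raising G x *v w = P (i + 1) (A w)"
proof (cases "i < D")
  case True
  have "raising G x *v w = (\<Sum>j<D. P (j + 1) (A (P j (P i w))))"
    unfolding raising_def sum_mult_vec assms(1) gdiam_eq by (simp add: matrix_vector_mul_assoc matrix_mul_assoc)
  also have "\<dots> = (\<Sum>j<D. if j = i then P (i + 1) (A (P i w)) else 0)"
    by (intro sum.cong) auto
  finally show ?thesis using True assms by (simp add: sum.delta)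
next
  case False
  have "raising G x *v w = (\<Sum>j<D. P (j + 1) (A (P j (P i w))))"
    unfolding raising_def sum_mult_vec assms(1) gdiam_eq by (simp add: matrix_vector_mul_assoc matrix_mul_assoc)
  also have "\<dots> = 0" using False by (intro sum.neutral) auto
  finally show ?thesis using False P_gt[of "i + 1"] by simp
qed

definition uniform :: "(nat \<Rightarrow> nat \<Rightarrow> complex) \<Rightarrow> (nat \<Rightarrow> complex) \<Rightarrow> bool" where
  "uniform e f \<longleftrightarrow> parameter_matrix D e \<and>
        (\<forall>i\<in>{1..D}. \<forall>v. P i v = v \<longrightarrow>
           e_minus e i *s (raising G x *v (lowering G x *v (lowering G x *v v)))
             + lowering G x *v (raising G x *v (lowering G x *v v))
             + e_plus D e i *s (lowering G x *v (lowering G x *v (raising G x *v v)))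
           = f i *s (lowering G x *v v))"

lemma supports_uniform:
  assumes "supports_uniform_structure G x"
  obtains e f where "uniform e f"
proof -
  have comp: "v \<in> component G x i UNIV" if "P i v = v" for i v
    unfolding component_def using that[symmetric] by (rule image_eqI) simp
  obtain e f where ef: "parameter_matrix D e"
    "\<And>i v. i \<in> {1..D} \<Longrightarrow> v \<in> component G x i UNIV \<Longrightarrow>
       e_minus e i *s ((raising G x ** lowering G x ** lowering G x) *v v)
             + (lowering G x ** raising G x ** lowering G x) *v v
             + e_plus D e i *s ((lowering G x ** lowering G x ** raising G x) *v v)
           = f i *s (lowering G x *v v)"
    using assms unfolding supports_uniform_structure_def Let_def gdiam_eq by blast
  have "uniform e f" unfolding uniform_def
    using ef(1) ef(2)[OF _ comp] by (simp add: matrix_vector_mul_assoc[symmetric])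
  then show thesis by (rule that)
qed

text \<open>The boundary values d 1 and d (t + 1) vanish, or e_plus does when t = D. So the vector
  of d 2, ..., d t lies in the kernel of the principal submatrix on rows and columns 2 to t, which
  is nonsingular.\<close>

lemma tridiagonal_unique:
  assumes e: "parameter_matrix D e" and t: "2 \<le> t" "t \<le> D"
    and eq: "\<And>i. 2 \<le> i \<Longrightarrow> i \<le> t \<Longrightarrow> e_minus e i * d (i - 1) + d i + e_plus D e i * d (i + 1) = 0"
    and d: "d 1 = 0" "t < D \<Longrightarrow> d (t + 1) = 0"
    and i: "2 \<le> i" "i \<le> t"
  shows "d i = (0::complex)"
proof (rule ccontr)
  assume nz: "d i \<noteq> 0"
  let ?n = "t - 1"
  let ?M = "principal_submatrix e 2 t"
  have n: "t + 1 - 2 = ?n" using t by simp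
  have M: "?M \<in> carrier_mat ?n ?n" unfolding principal_submatrix_def n by simp
  define u where "u = Matrix.vec ?n (\<lambda>j. d (2 + j))"
  have u: "u \<in> carrier_vec ?n" "u \<noteq> 0\<^sub>v ?n"
  proof -
    show "u \<in> carrier_vec ?n" by (simp add: u_def)
    have "i = 2 + (i - 2)" using i by simp
    then have "Matrix.vec_index u (i - 2) = d i" using i by (auto simp: u_def)
    moreover have "Matrix.vec_index (0\<^sub>v ?n :: complex Matrix.vec) (i - 2) = 0" using i by simp
    ultimately show "u \<noteq> 0\<^sub>v ?n" using nz by auto
  qed
  have "?M *\<^sub>v u = 0\<^sub>v ?n"
  proof (rule Matrix.eq_vecI)
    fix r assume "r < dim_vec (0\<^sub>v ?n :: complex Matrix.vec)"
    then have r: "r < ?n" by simp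
    define j where "j = r + 2"
    have j: "2 \<le> j" "j \<le> t" using r t by (auto simp: j_def)
    have "Matrix.vec_index (?M *\<^sub>v u) r = (\<Sum>k = 0..<?n. e (2 + r) (2 + k) * d (2 + k))"
      using r M unfolding principal_submatrix_def n
      by (simp add: scalar_prod_def u_def)
    also have "\<dots> = (\<Sum>k\<in>(\<lambda>k. 2 + k) ` {0..<?n}. e j k * d k)"
      by (subst sum.reindex) (auto simp: j_def add.commute)
    also have "(\<lambda>k. 2 + k) ` {0..<?n} = {2..t}" using image_add_atLeastLessThan[of 2 0 ?n] t by auto
    also have "(\<Sum>k\<in>{2..t}. e j k * d k) = (\<Sum>k\<in>{2..t} \<inter> {j - 1, j, j + 1}. e j k * d k)"
    proof (rule sum.mono_neutral_right)
      have "e j k = 0" if "k \<in> {2..t} - {2..t} \<inter> {j - 1, j, j + 1}" for k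
      proof -
        have "k + 1 < j \<or> j + 1 < k" using that by auto
        moreover have "j \<in> {1..D}" "k \<in> {1..D}" using that j t by auto
        ultimately show ?thesis using e unfolding parameter_matrix_def by blast
      qed
      then show "\<forall>k\<in>{2..t} - {2..t} \<inter> {j - 1, j, j + 1}. e j k * d k = 0" by simp
    qed auto
    also have "\<dots> = (\<Sum>k\<in>{j - 1, j, j + 1}. if k \<in> {2..t} then e j k * d k else 0)"
      by (subst Int_commute) (simp add: sum.inter_restrict)
    also have "\<dots> = e_minus e j * d (j - 1) + d j + e_plus D e j * d (j + 1)"
    proof -
      have ejj: "e j j = 1" using e j t unfolding parameter_matrix_def by auto
      have "(if j - 1 \<in> {2..t} then e j (j - 1) * d (j - 1) else 0) = e_minus e j * d (j - 1)"
      proof (cases "j = 2")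
        case True then show ?thesis using d(1) by simp
      next
        case False then show ?thesis using j by (auto simp: e_minus_def)
      qed
      moreover have "(if j + 1 \<in> {2..t} then e j (j + 1) * d (j + 1) else 0) = e_plus D e j * d (j + 1)"
      proof (cases "j = t")
        case True then show ?thesis using d(2) t by (auto simp: e_plus_def)
      next
        case False then show ?thesis using j t by (auto simp: e_plus_def)
      qed
      moreover have "(if j \<in> {2..t} then e j j * d j else 0) = d j" using j ejj by simp
      moreover have "(\<Sum>k\<in>{j - 1, j, j + 1}. F k) = F (j - 1) + F j + F (j + 1)" for F :: "nat \<Rightarrow> complex"
      proof -
        have "j - 1 \<notin> {j, j + 1}" using j by auto
        then show ?thesis by (simp add: add.assoc)
      qed
      ultimately show ?thesis by (simp only:)
    qed
    also have "\<dots> = 0" by (rule eq[OF j])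
    finally show "Matrix.vec_index (?M *\<^sub>v u) r = Matrix.vec_index (0\<^sub>v ?n) r" using r by simp
  qed (use M in simp)
  then have "Determinant.det ?M = 0"
    using det_0_iff_vec_prod_zero_field[OF M] u by blast
  moreover have "Determinant.det ?M \<noteq> 0"
    using e t unfolding parameter_matrix_def by auto
  ultimately show False by contradiction
qed

end

context endpoint_one_module
begin

lemma lam_of_real: "lam (\<lambda>i. of_real (g i)) i = of_real (lamR g i)"
  by (simp add: lam_def lamR_def)

text \<open>On p i the three words in R and L are values of \<open>yy g\<close> times the common
  vector \<open>lamR g (i - 1)\<close> p (i - 1), which is cancelled. For i = D this factor lies
  outside the range of \<open>admissible\<close>, hence the extra hypothesis.\<close>

lemma uniform_module:
  assumes u: "uniform e f" and g: "admissible g" and g1: "- 1 - \<eta> = of_real (g 1)"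
    and i: "2 \<le> i" "i \<le> D" "i = D \<Longrightarrow> lamR g (D - 1) \<noteq> 0"
  shows "e_minus e i * of_real (yy g (i - 1)) + of_real (yy g i) + e_plus D e i * of_real (yy g (i + 1)) = f i"
proof -
  let ?g = "\<lambda>i. complex_of_real (g i)"
  let ?l = "\<lambda>i. complex_of_real (lamR g i)"
  have n1: "n 1 = ?g 1 *s p 1" using n_1 g1 by simp
  have rec: "lam ?g j \<noteq> 0 \<and> ?g (j + 1) * lam ?g j = of_real (bb (j + 1)) * ?g j"
    if "1 \<le> j" "j + 1 < D" for j
    using g that unfolding lam_of_real admissible_def by (metis of_real_eq_0_iff of_real_mult)
  have par: "p j \<noteq> 0" "P j (A (p (j + 1))) = ?l j *s p j" if "1 \<le> j" "j < D" for j
    using module_parameters[of ?g, OF n1 rec that] unfolding lam_of_real by blast+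
  have l: "lamR g (i - 1) \<noteq> 0"
  proof (cases "i = D")
    case False
    then show ?thesis using g i unfolding admissible_def by (auto dest: spec[of _ "i - 1"])
  qed (use i in auto)
  let ?L = "\<lambda>w. lowering G x *v w" and ?R = "\<lambda>w. raising G x *v w"
  have L: "?L (c *s p (j + 1)) = (c * ?l j) *s p j" if "1 \<le> j" "j < D" for j c
    using lowering_P[of "j + 1" "c *s p (j + 1)"] par(2)[OF that]
    by (simp add: P_scale A_scale vector_smult_assoc del: P_nth)
  have R: "?R (c *s p j) = (c * of_real (cc j)) *s p (j + 1)" if "1 \<le> j" for j c
    using raising_P[of j "c *s p j"] raise_p[OF that]
    by (simp add: P_scale A_scale vector_smult_assoc del: P_nth)
  obtain k where k: "i = k + 1" "1 \<le> k" "k < D" by (rule that[of "i - 1"]) (use i in auto)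
  have Lp: "?L (p i) = ?l k *s p k" using L[OF k(2,3), of 1] k(1) by simp
  have LRL: "?L (?R (?L (p i))) = (?l k * of_real (yy g i)) *s p k"
    unfolding Lp R[OF k(2)] L[OF k(2,3)] using k by (simp add: yy_def mult_ac)
  have RLL: "?R (?L (?L (p i))) = (?l k * of_real (yy g (i - 1))) *s p k"
  proof (cases "k = 1")
    case True
    have "?L (?l k *s v) = 0"
      using lowering_P[of 1 "?l k *s v"] P_1_v P_0_W[OF W_closed(4)[OF v_in]]
      by (simp add: P_scale A_scale)
    then show ?thesis unfolding Lp using True k by (simp add: yy_def)
  next
    case False
    obtain m where m: "k = m + 1" "1 \<le> m" "m < D" by (rule that[of "k - 1"]) (use k False in auto)
    have "?L (?L (p i)) = (?l k * ?l m) *s p m" unfolding Lp using L[OF m(2,3)] m(1) by simp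
    then show ?thesis using R[OF m(2)] m k by (simp add: yy_def mult_ac)
  qed
  have LLR: "e_plus D e i *s ?L (?L (?R (p i))) = (?l k * (e_plus D e i * of_real (yy g (i + 1)))) *s p k"
  proof (cases "i = D")
    case True
    then show ?thesis by (simp add: e_plus_def)
  next
    case False
    then have iD: "1 \<le> i" "i < D" using i by auto
    have "?L (?R (p i)) = (of_real (cc i) * ?l i) *s p i"
      using R[OF iD(1), of 1] L[OF iD] by simp
    then have "?L (?L (?R (p i))) = (of_real (cc i) * ?l i * ?l k) *s p k"
      using L[OF k(2,3)] k(1) by simp
    then show ?thesis using iD by (simp add: yy_def vector_smult_assoc mult_ac)
  qed
  have "(?l k * (e_minus e i * of_real (yy g (i - 1)) + of_real (yy g i) + e_plus D e i * of_real (yy g (i + 1)))) *s p k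
      = (?l k * f i) *s p k"
  proof -
    have "e_minus e i *s ?R (?L (?L (p i))) + ?L (?R (?L (p i))) + e_plus D e i *s ?L (?L (?R (p i)))
        = f i *s ?L (p i)"
      using u i unfolding uniform_def by auto
    then show ?thesis unfolding RLL LRL LLR unfolding Lp
      by (simp add: cvec_eq_iff algebra_simps)
  qed
  then have "?l k * (e_minus e i * of_real (yy g (i - 1)) + of_real (yy g i) + e_plus D e i * of_real (yy g (i + 1)))
      = ?l k * f i"
    using par(1)[OF k(2,3)] by (simp only: vec.scale_cancel_right) simp
  then show ?thesis using l k(1) by simp
qed

end

section \<open>The local graph is strongly regular\<close>

context rooted_classical_graph
begin

text \<open>The vectors \<open>S f e0\<close> are the functions of the distance to x; they form the
  primary module.\<close>

definition e0 :: "complex^'v" where "e0 = axis x 1"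

lemma S_e0_nth: "S f e0 $ y = of_real (f (gdist G x y))"
  by (simp add: S_def sph_def e0_def axis_def if_distrib[of "\<lambda>c. _ * c"] gdist_commute[of y]
      scaleR_conv_of_real cong: if_cong)

lemma P_S_e0: "P i (S f e0) = S (\<lambda>j. f j * dl i j) e0"
  by (simp add: cvec_eq_iff S_e0_nth dl_def)

text \<open>\<open>\<Lambda> - r\<close>, where \<open>\<Lambda>\<close> is the adjacency matrix of the local graph.\<close>

definition Lm :: "real \<Rightarrow> complex^'v \<Rightarrow> complex^'v" where
  "Lm r u = P 1 (A (P 1 u)) - of_real r *s P 1 u"

lemma cip_Lm: "cip (Lm r u) w = cip u (Lm r w)"
proof -
  have diff: "cip (a - b) w = cip a w - cip b w" "cip u (a - b) = cip u a - cip u b" for a b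
    by (simp_all add: cip_def algebra_simps sum_subtractf)
  show ?thesis unfolding Lm_def diff
    by (simp only: cip_P cip_A cip_scale_left cip_scale_right complex_cnj_complex_of_real)
qed

lemma Lm_S_e0: "Lm r (S f e0) = S (\<lambda>i. (Bop (\<lambda>i. f i * dl 1 i) i - r * f i) * dl 1 i) e0"
proof -
  have "Lm r (S f e0) = S (\<lambda>i. Bop (\<lambda>i. f i * dl 1 i) i * dl 1 i) e0 - of_real r *s S (\<lambda>i. f i * dl 1 i) e0"
    unfolding Lm_def P_S_e0 A_S ..
  then show ?thesis by (simp add: cvec_eq_iff S_e0_nth algebra_simps)
qed

lemma cip_S_e0_local:
  assumes "P 1 u = u" "(\<Sum>y\<in>UNIV. u $ y) = 0"
  shows "cip u (S (\<lambda>i. h i * dl 1 i) e0) = 0"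
proof -
  have eq: "u $ y * cnj (S (\<lambda>i. h i * dl 1 i) e0 $ y) = u $ y * of_real (h 1)" for y
  proof (cases "gdist G x y = 1")
    case False
    then have "u $ y = 0" using arg_cong[OF assms(1), of "\<lambda>u. u $ y"] by simp
    then show ?thesis by simp
  qed (simp only: S_e0_nth dl_def, simp)
  have "cip u (S (\<lambda>i. h i * dl 1 i) e0) = (\<Sum>y\<in>UNIV. u $ y) * of_real (h 1)"
    unfolding cip_def sum_distrib_right eq ..
  then show ?thesis using assms by simp
qed

text \<open>A submodule W of least dimension with nonzero component 1 is irreducible. A submodule W'
  of W either has a nonzero component 1 itself, so W' = W by minimality, or its complement in W
  contains P 1 w. Then the complement is all of W and W' is orthogonal to itself.\<close>

lemma ex_irreducible_endpoint_1:
  assumes M: "T_module G x M" and m: "m \<in> M" "P 1 m \<noteq> 0"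
  obtains W w where "irreducible_T_module G x W" "W \<subseteq> M" "w \<in> W" "P 1 w \<noteq> 0"
proof -
  let ?Q = "\<lambda>W. T_module G x W \<and> W \<subseteq> M \<and> (\<exists>w\<in>W. P 1 w \<noteq> 0)"
  have "?Q M" using assms by blast
  then obtain W where W: "?Q W" and min: "\<And>W'. ?Q W' \<Longrightarrow> vec.dim W \<le> vec.dim W'"
    using ex_has_least_nat[of ?Q M vec.dim] by blast
  then obtain w where w: "w \<in> W" "P 1 w \<noteq> 0" by blast
  note cl = T_module_subspace T_module_A T_module_P
  have "irreducible_T_module G x W"
    unfolding irreducible_T_module_def
  proof (intro conjI allI impI)
    show "T_module G x W" using W by blast
    show "W \<noteq> {0}" using w by auto
    fix W' assume W': "T_module G x W' \<and> W' \<subseteq> W"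
    show "W' = {0} \<or> W' = W"
    proof (cases "\<exists>w'\<in>W'. P 1 w' \<noteq> 0")
      case True
      then have "vec.dim W \<le> vec.dim W'" using min W' W by blast
      then have "W' = W"
        using W W' by (intro vec.subspace_dim_equal) (auto intro: cl)
      then show ?thesis ..
    next
      case False
      define C where "C = {c \<in> W. \<forall>w'\<in>W'. cip c w' = 0}"
      have "T_module G x C"
      proof (rule T_moduleI)
        show "vec.subspace C"
          using T_module_subspace[of W] W unfolding C_def vec.subspace_def
          by (auto simp: cip_add_left cip_scale_left)
      next
        fix c assume "c \<in> C" then show "A c \<in> C"
          using W W' unfolding C_def by (auto simp: cip_A intro: cl)
      next
        fix i c assume "c \<in> C" then show "P i c \<in> C"
          using W W' unfolding C_def by (auto simp: cip_P intro: cl)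
      qed
      moreover have "P 1 w \<in> C"
        using w W False unfolding C_def by (auto simp: cip_P intro: cl)
      moreover have "P 1 (P 1 w) \<noteq> 0" using w by simp
      ultimately have "vec.dim W \<le> vec.dim C" using W by (intro min) (auto simp: C_def)
      then have "C = W"
        using W \<open>T_module G x C\<close> by (intro vec.subspace_dim_equal) (auto intro: cl simp: C_def)
      then have "w' = 0" if "w' \<in> W'" for w'
        using W' that cip_self[of w'] unfolding C_def by blast
      moreover have "0 \<in> W'" using W' by (intro vec.subspace_0 cl) simp
      ultimately show ?thesis by blast
    qed
  qed
  with W w show thesis by (intro that) auto
qed

text \<open>Orthogonal complements avoid a decomposition of the standard module into irreducible ones: a vector
  orthogonal to the primary module and to all irreducible modules of endpoint \<open>1\<close> has no component in
  the first subconstituent.\<close>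

lemma T_module_orthogonal:
  "T_module G x {m. (\<forall>f. cip m (S f e0) = 0) \<and> (\<forall>W. T_module G x W \<and> Q W \<longrightarrow> (\<forall>w\<in>W. cip m w = 0))}"
proof (rule T_moduleI)
  show "vec.subspace {m. (\<forall>f. cip m (S f e0) = 0) \<and> (\<forall>W. T_module G x W \<and> Q W \<longrightarrow> (\<forall>w\<in>W. cip m w = 0))}"
    unfolding vec.subspace_def by (auto simp: cip_add_left cip_scale_left)
qed (auto simp: cip_A cip_P A_S P_S_e0 intro: T_module_A T_module_P)

end

locale thin_classical_graph = rooted_classical_graph G D q \<alpha> \<beta> x
  for G :: "'v::finite graph" and D q \<alpha> \<beta> x +
  assumes thin: "\<And>W. irreducible_T_module G x W \<Longrightarrow> endpoint G x W = 1 \<Longrightarrow> thin G x W"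
begin

lemma irreducible_endpoint_one_module:
  assumes W: "irreducible_T_module G x W" and P0: "\<And>w. w \<in> W \<Longrightarrow> P 0 w = 0"
    and w: "w \<in> W" "P 1 w \<noteq> 0"
  obtains \<eta> where "endpoint_one_module G D q \<alpha> \<beta> x W (P 1 w) \<eta>"
proof -
  have T: "T_module G x W" using W by (simp add: irreducible_T_module_def)
  have "component G x 0 W = {0}"
    using P0 w(1) unfolding component_def by auto
  moreover have "component G x 1 W \<noteq> {0}" using w unfolding component_def by auto
  ultimately have "endpoint G x W = 1"
    unfolding endpoint_def by (intro Least_equality) (auto simp: Suc_le_eq intro!: Nat.gr0I)
  then have th: "thin G x W" by (rule thin[OF W])
  have thW: "\<exists>t. P i w = t *s P i u" if "u \<in> W" "w \<in> W" "P i u \<noteq> 0" for i u w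
  proof (rule collinear_of_dim_le_1)
    have "i \<le> D" using that P_gt[of i u] by (auto simp: not_le[symmetric])
    then show "vec.dim (component G x i W) \<le> 1" using th by (simp add: thin_def gdiam_eq)
  qed (use that in \<open>auto simp: component_def\<close>)
  have "P 1 w \<in> W" using T_module_P[OF T w(1)] .
  then have "A (P 1 w) \<in> W" by (rule T_module_A[OF T])
  from thW[OF w(1) this w(2)] obtain \<eta> where "P 1 (A (P 1 w)) = \<eta> *s P 1 w" by blast
  then have "endpoint_one_module G D q \<alpha> \<beta> x W (P 1 w) \<eta>"
    using T P0 thW w \<open>P 1 w \<in> W\<close> by unfold_locales auto
  then show thesis by (rule that)
qed

text \<open>Moved to the other side of the inner product, the two factors annihilate component 1 of
  every module in question and keep radial vectors radial, to which u is orthogonal. So the image of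
  u lies in a complement without component 1, although it is supported on the neighbours of
  x.\<close>

lemma local_annihilator:
  assumes r: "\<And>W v \<eta>. endpoint_one_module G D q \<alpha> \<beta> x W v \<eta> \<Longrightarrow> \<eta> = of_real r1 \<or> \<eta> = of_real r2"
    and u: "P 1 u = u" "(\<Sum>y\<in>UNIV. u $ y) = 0"
  shows "Lm r1 (Lm r2 u) = 0"
proof -
  let ?Q = "\<lambda>W. irreducible_T_module G x W \<and> (\<forall>w\<in>W. P 0 w = 0) \<and> (\<exists>w\<in>W. P 1 w \<noteq> 0)"
  define M where
    "M = {m. (\<forall>f. cip m (S f e0) = 0) \<and> (\<forall>W. T_module G x W \<and> ?Q W \<longrightarrow> (\<forall>w\<in>W. cip m w = 0))}"
  have M: "T_module G x M" unfolding M_def by (rule T_module_orthogonal)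
  have P0: "P 0 m = 0" if "m \<in> M" for m
  proof -
    have "cip m (S (dl 0) e0) = (\<Sum>y\<in>UNIV. if y = x then m $ x else 0)"
      unfolding cip_def by (rule sum.cong) (auto simp: S_e0_nth dl_def simp del: S_dl_0)
    moreover have "cip m (S (dl 0) e0) = 0" using that unfolding M_def by blast
    ultimately have "m $ x = 0" by (simp del: S_dl_0)
    then show ?thesis by (simp add: cvec_eq_iff)
  qed
  have P1: "P 1 m = 0" if m: "m \<in> M" for m
  proof (rule ccontr)
    assume "P 1 m \<noteq> 0"
    then obtain W w where W: "irreducible_T_module G x W" "W \<subseteq> M" "w \<in> W" "P 1 w \<noteq> 0"
      using ex_irreducible_endpoint_1[OF M m] by metis
    then have "T_module G x W \<and> ?Q W"
      using P0 by (auto simp: irreducible_T_module_def)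
    then have "cip w w = 0" using W unfolding M_def by blast
    then show False using cip_self[of w] W(4) by simp
  qed
  let ?u = "Lm r1 (Lm r2 u)"
  have "?u \<in> M"
    unfolding M_def mem_Collect_eq
  proof (intro conjI allI impI ballI)
    fix f
    show "cip ?u (S f e0) = 0"
      unfolding cip_Lm Lm_S_e0 by (rule cip_S_e0_local[OF u])
  next
    fix W w assume W: "T_module G x W \<and> ?Q W" and w: "w \<in> W"
    obtain w' where w': "w' \<in> W" "P 1 w' \<noteq> 0" using W by blast
    obtain \<eta> where \<eta>: "endpoint_one_module G D q \<alpha> \<beta> x W (P 1 w') \<eta>"
      using irreducible_endpoint_one_module[OF _ _ w'] W by blast
    obtain t where t: "P 1 w = t *s P 1 w'"
      using endpoint_one_module.thin_W[OF \<eta> w'(1) w w'(2)] by blast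
    have step: "Lm r (c *s P 1 w') = (c * (\<eta> - of_real r)) *s P 1 w'" for r c
      using endpoint_one_module.local_eigen[OF \<eta>] endpoint_one_module.P_1_v[OF \<eta>]
      unfolding Lm_def P_scale A_scale
      by (simp add: cvec_eq_iff algebra_simps del: P_nth)
    have "Lm r1 w = Lm r1 (t *s P 1 w')" unfolding t[symmetric] Lm_def by simp
    also note step
    finally have "Lm r2 (Lm r1 w) = (t * (\<eta> - of_real r1) * (\<eta> - of_real r2)) *s P 1 w'"
      by (simp only: step)
    also have "\<dots> = 0" using r[OF \<eta>] by auto
    finally show "cip ?u w = 0" unfolding cip_Lm by simp
  qed
  then have "P 1 ?u = 0" by (rule P1)
  moreover have "P 1 ?u = ?u" unfolding Lm_def[of r1] P_diff P_scale by simp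
  ultimately show ?thesis by simp
qed

text \<open>The matrix E of (\<Lambda> - r1)(\<Lambda> - r2) kills differences of unit vectors, so
  its rows are constant. By symmetry all its entries equal one number \<mu>.\<close>

lemma local_strongly_regular:
  assumes r: "\<And>W v \<eta>. endpoint_one_module G D q \<alpha> \<beta> x W v \<eta> \<Longrightarrow> \<eta> = of_real r1 \<or> \<eta> = of_real r2"
  obtains \<mu> where
    "\<And>y z. G x y \<Longrightarrow> G x z \<Longrightarrow> real (card {t. G x t \<and> G y t \<and> G z t})
        = (if G y z then r1 + r2 else 0) - (if y = z then r1 * r2 else 0) + \<mu>"
    "aa 1 = \<mu> - r1 * r2" "(aa 1 - r1) * (aa 1 - r2) = bb 0 * \<mu>"
proof -
  define N where "N y z = real (card {t. G x t \<and> G y t \<and> G z t})" for y z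
  define E where "E y z = N y z - (if G y z then r1 + r2 else 0) + (if y = z then r1 * r2 else 0)" for y z
  have Lm_axis: "Lm r1 (Lm r2 (axis z 1)) $ y = of_real (E y z)" if "G x y" "G x z" for y z
  proof -
    have Ps: "P 1 (axis z 1) = axis z 1" using that by (auto simp: cvec_eq_iff axis_def)
    have L2: "Lm r2 (axis z 1) $ t = (if G x t then (if G t z then 1 else 0) - (if t = z then of_real r2 else 0) else 0)"
      for t
      unfolding Lm_def Ps by (auto simp: A_nth Ad_def axis_def that)
    have "Lm r1 (Lm r2 (axis z 1)) $ y
        = (\<Sum>t | G y t. Lm r2 (axis z 1) $ t) - of_real r1 * Lm r2 (axis z 1) $ y"
    proof -
      have "P 1 (Lm r2 (axis z 1)) = Lm r2 (axis z 1)" by (auto simp: cvec_eq_iff L2)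
      then show ?thesis using that unfolding Lm_def[of r1] by (simp add: A_nth Ad_def)
    qed
    also have "(\<Sum>t | G y t. Lm r2 (axis z 1) $ t)
        = (\<Sum>t | G y t. if G x t \<and> G t z then 1 else 0) - (\<Sum>t | G y t. if t = z then of_real r2 else 0)"
      unfolding sum_subtractf[symmetric] by (rule sum.cong) (auto simp: L2 that)
    also have "(\<Sum>t | G y t. if G x t \<and> G t z then 1 else 0) = of_real (N y z)"
      by (simp add: sum.If_cases N_def) (rule arg_cong[of _ _ card], auto simp: adj_sym)
    also have "(\<Sum>t | G y t. if t = z then of_real r2 else 0) = (if G y z then of_real r2 else 0)"
      by (simp add: sum.delta)
    finally show ?thesis
      by (cases "G y z"; cases "y = z"; simp add: L2 that E_def algebra_simps)
  qed
  have const: "E y z = E y z'" if "G x y" "G x z" "G x z'" for y z z'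
  proof -
    let ?u = "axis z 1 - axis z' 1 :: complex^'v"
    have "P 1 ?u = ?u" using that by (auto simp: cvec_eq_iff axis_def)
    moreover have "(\<Sum>y\<in>UNIV. ?u $ y) = 0" by (simp add: axis_def sum_subtractf)
    ultimately have "Lm r1 (Lm r2 ?u) = 0" by (rule local_annihilator[rotated]) (rule r)
    moreover have "Lm r (a - b) = Lm r a - Lm r b" for r a b
      unfolding Lm_def P_diff A_diff by (simp add: vector_ssub_ldistrib)
    ultimately have "Lm r1 (Lm r2 (axis z 1)) $ y = Lm r1 (Lm r2 (axis z' 1)) $ y" by simp
    then show ?thesis unfolding Lm_axis[OF that(1,2)] Lm_axis[OF that(1,3)] by simp
  qed
  have sym: "E y z = E z y" for y z
    unfolding E_def N_def using adj_sym[of y z] by (auto intro!: arg_cong[of _ _ card])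
  have "card {z. G x z} > 0" using card_neighbours[of x] bb_pos[of 0] D_ge by linarith
  then obtain y0 where y0: "G x y0" by (auto simp: card_gt_0_iff)
  define \<mu> where "\<mu> = E y0 y0"
  have E: "E y z = \<mu>" if "G x y" "G x z" for y z
    unfolding \<mu>_def using const[of y z y0] const[of y0 y y0] sym[of y y0] that y0 by metis
  have 1: "N y z = (if G y z then r1 + r2 else 0) - (if y = z then r1 * r2 else 0) + \<mu>"
    if "G x y" "G x z" for y z
    using E[OF that] unfolding E_def by (simp split: if_splits)
  have deg: "real (card {t. G x t \<and> G y t}) = aa 1" if "G x y" for y
  proof -
    have "(\<Sum>t | G y t. dl 1 (gdist G t x)) = Bop (dl 1) (gdist G y x)" by (rule sum_neighbours)
    moreover have "gdist G y x = Suc 0" using that by (simp add: adj_sym)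
    ultimately have "(\<Sum>t | G y t. dl 1 (gdist G t x)) = aa 1"
      by (simp add: Bop_dl dl_def)
    moreover have "(\<Sum>t | G y t. dl 1 (gdist G t x)) = (\<Sum>t | G y t. if G x t then 1 else 0)"
      by (rule sum.cong) (auto simp: dl_def adj_sym)
    ultimately show ?thesis by (simp add: sum.If_cases Collect_conj_eq Int_commute)
  qed
  have N0: "N y0 y0 = aa 1" using deg[OF y0] by (simp add: N_def)
  have "aa 1 = \<mu> - r1 * r2" using 1[OF y0 y0] N0 by simp
  \<comment> \<open>A row sum of E: paths of length 2 starting at y0 inside the local graph, which
    is regular of valency \<open>aa 1\<close>, are counted in two ways.\<close>
  moreover have "(aa 1 - r1) * (aa 1 - r2) = bb 0 * \<mu>"
  proof -
    have "(\<Sum>z | G x z. N y0 z) = (\<Sum>z | G x z. \<Sum>t\<in>{t \<in> {t. G x t \<and> G y0 t}. G z t}. 1)"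
      by (simp add: N_def Collect_conj_eq Int_ac)
    also have "\<dots> = (\<Sum>t | G x t \<and> G y0 t. \<Sum>z\<in>{z \<in> {z. G x z}. G z t}. 1)"
      by (rule sum.swap_restrict) auto
    also have "\<dots> = (\<Sum>t | G x t \<and> G y0 t. aa 1)"
    proof (rule sum.cong[OF refl])
      fix t assume "t \<in> {t. G x t \<and> G y0 t}"
      then have "real (card {z. G x z \<and> G t z}) = aa 1" using deg by blast
      then show "(\<Sum>z\<in>{z \<in> {z. G x z}. G z t}. 1) = aa 1" by (simp add: adj_sym)
    qed
    also have "\<dots> = aa 1 * aa 1" using deg[OF y0] by simp
    finally have "aa 1 * aa 1 = (\<Sum>z | G x z. N y0 z)" ..
    also have "\<dots> = (\<Sum>z | G x z. (if G y0 z then r1 + r2 else 0) - (if y0 = z then r1 * r2 else 0) + \<mu>)"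
      using 1[OF y0] by (intro sum.cong) auto
    also have "\<dots> = (r1 + r2) * aa 1 - r1 * r2 + bb 0 * \<mu>"
      using y0 deg[OF y0]
      by (simp add: sum.distrib sum_subtractf sum.If_cases card_neighbours sum.delta Collect_conj_eq Int_ac mult.commute)
    finally show ?thesis by (simp add: algebra_simps)
  qed
  ultimately show thesis using 1 that unfolding N_def by blast
qed

end

section \<open>Exclusion of pairs of local eigenvalues\<close>

locale uniform_thin_graph = thin_classical_graph G D q \<alpha> \<beta> x
  for G :: "'v::finite graph" and D q \<alpha> \<beta> x +
  assumes uniform_structure: "supports_uniform_structure G x"
    and alpha_nz: "\<alpha> \<noteq> 0"
begin

definition occurs :: "real \<Rightarrow> bool" where
  "occurs r \<longleftrightarrow> (\<exists>W v. endpoint_one_module G D q \<alpha> \<beta> x W v (of_real r))"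

text \<open>t is the last distance met by both modules. The sequences \<open>yy g\<close> and
  \<open>yy g'\<close> satisfy the same equations in rows 2 to t, and their difference vanishes at 1
  and, if t < D, at t + 1.\<close>

lemma not_occurs_both:
  assumes g: "admissible g" "admissible g'" and "occurs (- 1 - g 1)" "occurs (- 1 - g' 1)"
    and t: "t = D \<and> lamR g (D - 1) \<noteq> 0 \<and> lamR g' (D - 1) \<noteq> 0 \<or> t + 1 = D \<and> lamR g t = 0 \<and> lamR g' t = 0"
    and i: "1 \<le> i" "i < t"
  shows "lamR g i = lamR g' i"
proof -
  obtain e f where ef: "uniform e f" using supports_uniform[OF uniform_structure] .
  obtain W v where 1: "endpoint_one_module G D q \<alpha> \<beta> x W v (of_real (- 1 - g 1))"
    using assms(3) unfolding occurs_def by blast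
  obtain W' v' where 2: "endpoint_one_module G D q \<alpha> \<beta> x W' v' (of_real (- 1 - g' 1))"
    using assms(4) unfolding occurs_def by blast
  have D: "t \<le> D" "2 \<le> t" using t D_ge by auto
  define d where "d j = complex_of_real (yy g j) - of_real (yy g' j)" for j
  have "d (i + 1) = 0"
  proof (rule tridiagonal_unique)
    show "parameter_matrix D e" using ef by (simp add: uniform_def)
    show "2 \<le> t" "t \<le> D" using D by auto
    show "d 1 = 0" by (simp add: d_def yy_def)
    show "d (t + 1) = 0" if "t < D" using that t by (auto simp: d_def yy_def)
    show "2 \<le> i + 1" "i + 1 \<le> t" using i by auto
    show "e_minus e j * d (j - 1) + d j + e_plus D e j * d (j + 1) = 0" if j: "2 \<le> j" "j \<le> t" for j
    proof -
      have a: "- 1 - complex_of_real (- 1 - g 1) = of_real (g 1)"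
        "- 1 - complex_of_real (- 1 - g' 1) = of_real (g' 1)" by simp_all
      have b: "j \<le> D" "j = D \<Longrightarrow> lamR g (D - 1) \<noteq> 0" "j = D \<Longrightarrow> lamR g' (D - 1) \<noteq> 0"
        using j t by auto
      show ?thesis
        using endpoint_one_module.uniform_module[OF 1 ef g(1) a(1) j(1) b(1,2)]
          endpoint_one_module.uniform_module[OF 2 ef g(2) a(2) j(1) b(1,3)]
        unfolding d_def by (simp add: algebra_simps)
    qed
  qed
  then have "cc i * lamR g i = cc i * lamR g' i" using i by (simp add: d_def yy_def del: of_real_mult)
  then show ?thesis using cc_pos[of i] i D by simp
qed

text \<open>Equality at i = 1 already gives \<alpha>(\<beta> - \<alpha> + q) = 0, although \<beta> -
  \<alpha> is positive.\<close>

lemma not_occurs_tau_sigma: "\<not> (occurs (- q - 1) \<and> occurs (\<beta> - \<alpha> - 1))"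
proof
  assume o: "occurs (- q - 1) \<and> occurs (\<beta> - \<alpha> - 1)"
  have "lamR (\<lambda>_. q) 1 = lamR gB 1"
  proof (rule not_occurs_both[OF admissible_q admissible_gB])
    have "- 1 - q = - q - 1" by simp
    then show "occurs (- 1 - q)" using o by (simp only:)
    show "occurs (- 1 - gB 1)" using o by (simp add: gB_def algebra_simps)
    have "lamR (\<lambda>_. q) (D - 1) = 0" "lamR gB (D - 1) = 0"
      using lamR_q[of "D - 1"] lamR_gB[of "D - 1"] D_ge by auto
    then show "D - 1 = D \<and> lamR (\<lambda>_. q) (D - 1) \<noteq> 0 \<and> lamR gB (D - 1) \<noteq> 0
      \<or> D - 1 + 1 = D \<and> lamR (\<lambda>_. q) (D - 1) = 0 \<and> lamR gB (D - 1) = 0"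
      using D_ge by auto
  qed (use D_ge in auto)
  moreover have "lamR (\<lambda>_. q) 1 = q\<^sup>2 * br (D - 2) * (\<beta> - \<alpha> * (1 + q))"
    using lamR_q[of 1] D_ge bb_alt[of 2] by (simp add: numeral_2_eq_2 qbracket_Suc)
  moreover have "lamR gB 1 = q\<^sup>2 * br (D - 2) * ((\<beta> - \<alpha>) * (1 + \<alpha>))"
    using lamR_gB[of 1] D_ge by (simp add: numeral_2_eq_2 mult_ac)
  ultimately have "(q\<^sup>2 * br (D - 2)) * (\<beta> - \<alpha> * (1 + q)) = (q\<^sup>2 * br (D - 2)) * ((\<beta> - \<alpha>) * (1 + \<alpha>))"
    by simp
  moreover have nz: "q\<^sup>2 * br (D - 2) \<noteq> 0" using q_ge D_ge qbracket_pos[of q "D - 2"] by simp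
  ultimately have "\<beta> - \<alpha> * (1 + q) = (\<beta> - \<alpha>) * (1 + \<alpha>)" by (simp only: mult_left_cancel[OF nz])
  then have "\<alpha> * (\<beta> - \<alpha> + q) = 0" by (simp add: algebra_simps)
  moreover have "\<beta> - \<alpha> > 0" using beta_alpha_pos[of 1] D_ge by simp
  ultimately show False using alpha_nz q_ge by simp
qed

text \<open>The hypothesis on \<beta> makes both modules reach distance D. Equality at i = 1 only
  determines \<beta> = \<alpha>(1 + q) + q; equality at i = 2 then contradicts \<alpha> being
  nonzero.\<close>

lemma not_occurs_minus_one_rho:
  assumes "\<beta> \<noteq> \<alpha> * br D"
  shows "\<not> (occurs (- 1) \<and> occurs (\<alpha> * q * br (D - 1) - 1))"
proof
  assume o: "occurs (- 1) \<and> occurs (\<alpha> * q * br (D - 1) - 1)"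
  have eq: "lamR (\<lambda>_. 0) i = lamR gA i" if "1 \<le> i" "i < D" for i
  proof (rule not_occurs_both[OF admissible_0 admissible_gA _ _ _ that])
    show "occurs (- 1 - 0)" using o by simp
    show "occurs (- 1 - gA 1)" using o by (simp add: gA_def algebra_simps)
    have "1 + \<alpha> * br (D - 1) > 0" "1 + \<alpha> * br (D - 2) > 0" using alpha_br_pos D_ge by auto
    then have "lamR gA (D - 1) \<noteq> 0" "lamR (\<lambda>_. 0) (D - 1) \<noteq> 0"
      using lamR_gA[of "D - 1"] bb_pos[of "D - 1"] D_ge q_ge assms
      by (auto simp: lamR_0 numeral_2_eq_2)
    then show "D = D \<and> lamR (\<lambda>_. 0) (D - 1) \<noteq> 0 \<and> lamR gA (D - 1) \<noteq> 0
      \<or> D + 1 = D \<and> lamR (\<lambda>_. 0) D = 0 \<and> lamR gA D = 0"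
      by auto
  qed
  have key: "(\<beta> - \<alpha> * br i) * (1 + \<alpha> * br (i - 1)) = (\<beta> - \<alpha> * br (i + 1)) * (1 + \<alpha> * br i)"
    if i: "1 \<le> i" "i < D" for i
  proof -
    have E: "q ^ i * br (D - i) \<noteq> 0" using qbracket_pos[of q "D - i"] q_ge i by simp
    have "i - 1 < D" using i by simp
    from alpha_br_pos[OF this] have "1 + \<alpha> * br (i - 1) \<noteq> 0" by simp
    then have "(q ^ i * br (D - i)) * ((\<beta> - \<alpha> * br i) * (1 + \<alpha> * br (i - 1)))
        = (q ^ i * br (D - i)) * ((\<beta> - \<alpha> * br (i + 1)) * (1 + \<alpha> * br i))"
      using eq[OF i] unfolding lamR_gA[OF i] lamR_0 bb_alt[OF less_imp_le[OF i(2)]]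
      by (simp only: eq_divide_eq if_False mult_ac) simp
    then show ?thesis using E by (simp only: mult_cancel_left) simp
  qed
  have b: "br 2 = 1 + q" "br 3 = 1 + q + q\<^sup>2"
    by (simp_all add: numeral_2_eq_2 numeral_3_eq_3 qbracket_Suc algebra_simps)
  have "\<alpha> * (\<beta> - \<alpha> * (1 + q) - q) = 0"
    using key[of 1] D_ge b by (simp add: numeral_2_eq_2[symmetric] algebra_simps)
  then have \<beta>: "\<beta> = \<alpha> * (1 + q) + q" using alpha_nz by simp
  have "(\<beta> - \<alpha> * (1 + q)) * (1 + \<alpha>) = (\<beta> - \<alpha> * (1 + q + q\<^sup>2)) * (1 + \<alpha> * (1 + q))"
    using key[of 2] D_ge b by (simp add: numeral_3_eq_3[symmetric])
  then have "\<alpha> * \<alpha> * (q * q * (1 + q)) = 0"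
    unfolding \<beta> by (simp add: algebra_simps power2_eq_square)
  then show False using alpha_nz q_ge by simp
qed

lemma module_occurs:
  assumes "endpoint_one_module G D q \<alpha> \<beta> x W v \<eta>"
  obtains r where "\<eta> = of_real r" "occurs r" "r \<in> {- 1, \<alpha> * q * br (D - 1) - 1, \<beta> - \<alpha> - 1, - q - 1}"
proof -
  have "\<exists>r\<in>{- 1, \<alpha> * q * br (D - 1) - 1, \<beta> - \<alpha> - 1, - q - 1}. \<eta> = of_real r"
  proof -
    have *: "\<eta> = of_real (- 1 - s)" if "- 1 - \<eta> = of_real s" for s
      using that by (simp add: algebra_simps)
    have "\<exists>s\<in>{0, - \<alpha> * q * br (D - 1), \<alpha> - \<beta>, q}. - 1 - \<eta> = of_real s"
      using endpoint_one_module.local_eigenvalue[OF assms] by (metis insertCI of_real_0)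
    then obtain s where s: "s \<in> {0, - \<alpha> * q * br (D - 1), \<alpha> - \<beta>, q}" "\<eta> = of_real (- 1 - s)"
      using * by blast
    from s(1) have "- 1 - s \<in> {- 1, \<alpha> * q * br (D - 1) - 1, \<beta> - \<alpha> - 1, - q - 1}" by auto
    with s(2) show ?thesis by blast
  qed
  then show thesis using assms that unfolding occurs_def by blast
qed

lemma occurring_pair:
  obtains r1 r2 where "r1 \<in> {- 1, \<alpha> * q * br (D - 1) - 1}" "r2 \<in> {\<beta> - \<alpha> - 1, - q - 1}"
    "\<And>W v \<eta>. endpoint_one_module G D q \<alpha> \<beta> x W v \<eta> \<Longrightarrow> \<eta> = of_real r1 \<or> \<eta> = of_real r2"
proof -
  \<comment> \<open>Where no value of a pair occurs the choice is arbitrary. If \<beta> =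
    \<alpha>[D], r2 takes care of the coinciding value and r1 is free to be -1.\<close>
  define r1 where "r1 = (if occurs (- 1) \<or> \<beta> = \<alpha> * br D then - 1 else \<alpha> * q * br (D - 1) - 1)"
  define r2 where "r2 = (if occurs (\<beta> - \<alpha> - 1) then \<beta> - \<alpha> - 1 else - q - 1)"
  have eq: "\<alpha> * q * br (D - 1) - 1 = \<beta> - \<alpha> - 1" if "\<beta> = \<alpha> * br D"
    unfolding that br_D_1 by (simp add: algebra_simps)
  show thesis
  proof (rule that[of r1 r2])
    fix W v \<eta> assume "endpoint_one_module G D q \<alpha> \<beta> x W v \<eta>"
    then obtain r where r: "\<eta> = of_real r" "occurs r"
      "r \<in> {- 1, \<alpha> * q * br (D - 1) - 1, \<beta> - \<alpha> - 1, - q - 1}"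
      by (rule module_occurs)
    have "r = r1 \<or> r = r2"
      using r(2,3) not_occurs_tau_sigma not_occurs_minus_one_rho eq
      unfolding r1_def r2_def by (cases "\<beta> = \<alpha> * br D") (auto split: if_splits)
    then show "\<eta> = of_real r1 \<or> \<eta> = of_real r2" using r(1) by blast
  qed (auto simp: r1_def r2_def)
qed

lemma aa_1: "aa 1 = \<beta> - 1 + \<alpha> * q * br (D - 1)"
proof -
  have "aa 1 = bb 0 - bb 1 - 1" by (simp add: aa_def)
  also have "\<dots> = \<beta> - 1 + \<alpha> * q * br (D - 1)"
    unfolding bb_def br_D_1 by (simp add: algebra_simps)
  finally show ?thesis .
qed

lemma local_graph:
  "\<beta> = \<alpha> * br (D + 1) - q \<and> (\<forall>y z. G x y \<longrightarrow> G x z \<longrightarrow> real (card {t. G x t \<and> G y t \<and> G z t})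
        = (if y = z then aa 1 else if G y z then \<alpha> * (1 + q) + \<alpha> * q * br (D - 1) - q - 2 else \<alpha> * (1 + q)))"
proof -
  obtain r1 r2 where r: "r1 \<in> {- 1, \<alpha> * q * br (D - 1) - 1}" "r2 \<in> {\<beta> - \<alpha> - 1, - q - 1}"
    "\<And>W v \<eta>. endpoint_one_module G D q \<alpha> \<beta> x W v \<eta> \<Longrightarrow> \<eta> = of_real r1 \<or> \<eta> = of_real r2"
    by (rule occurring_pair) blast
  obtain \<mu> where \<mu>: "\<And>y z. G x y \<Longrightarrow> G x z \<Longrightarrow> real (card {t. G x t \<and> G y t \<and> G z t})
        = (if G y z then r1 + r2 else 0) - (if y = z then r1 * r2 else 0) + \<mu>"
    "aa 1 = \<mu> - r1 * r2" "(aa 1 - r1) * (aa 1 - r2) = bb 0 * \<mu>"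
    apply (rule local_strongly_regular[of r1 r2])
     apply (erule r(3))
    apply (rule that)
      apply blast+
    done
  define h where "h = br (D - 1)"
  have h: "h > 0" unfolding h_def using D_ge q_ge by (intro qbracket_pos) auto
  have bD: "br D = 1 + q * h" unfolding h_def by (rule br_D_1)
  have b0: "bb 0 = (1 + q * h) * \<beta>" by (simp add: bb_def bD)
  have pos: "\<beta> > 0" "\<beta> - \<alpha> > 0" "1 + q * h > 0"
    using beta_alpha_pos[of 0] beta_alpha_pos[of 1] D_ge h q_ge by (auto simp: add_pos_pos)
  have a1: "aa 1 = \<beta> - 1 + \<alpha> * q * h" unfolding h_def by (rule aa_1)
  have b1: "bb 0 - 1 - aa 1 > 0" using bb_pos[of 1] D_ge by (simp add: aa_def)
  have "card {z. G x z} > 0" using card_neighbours[of x] bb_pos[of 0] D_ge by linarith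
  then obtain y0 where y0: "G x y0" by (auto simp: card_gt_0_iff)
  have "real (card {t. G x t \<and> G y0 t \<and> G y0 t}) = aa 1"
    using \<mu>(1)[OF y0 y0] \<mu>(2) by simp
  then have a1_nonneg: "aa 1 \<ge> 0" by linarith
  \<comment> \<open>With r1 = -1 the two relations for \<mu> force \<open>aa 1\<close> =
    \<open>bb 0\<close> - 1: the local graph would be complete, contrary to \<open>bb 1\<close> >
    0.\<close>
  have "r1 \<noteq> - 1"
  proof
    assume r1: "r1 = - 1"
    have "\<mu> = aa 1 - r2" using \<mu>(2) r1 by simp
    moreover have "aa 1 - r2 \<noteq> 0"
    proof (cases "r2 = - q - 1")
      case True
      then show ?thesis using a1_nonneg q_ge by simp
    next
      case False
      then have "aa 1 - r2 = \<alpha> * (1 + q * h)" using r(2) unfolding a1 by (simp add: algebra_simps)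
      then show ?thesis using alpha_nz pos by simp
    qed
    ultimately have "aa 1 + 1 = bb 0" using \<mu>(3) r1 by simp
    then show False using b1 by simp
  qed
  then have r1: "r1 = \<alpha> * q * h - 1" using r(1) by (simp add: h_def)
  \<comment> \<open>For this pair the row sum relation gives \<mu> = \<alpha>, and the diagonal
    relation then makes a product of nonzero factors vanish.\<close>
  have "r2 \<noteq> \<beta> - \<alpha> - 1"
  proof
    assume r2: "r2 = \<beta> - \<alpha> - 1"
    have "\<beta> * (\<alpha> * (1 + q * h)) = \<beta> * (1 + q * h) * \<mu>"
      using \<mu>(3) unfolding a1 r1 r2 b0 by (simp add: algebra_simps)
    then have "\<mu> = \<alpha>" using pos by simp
    then have "\<alpha> * q * h * (\<beta> - \<alpha>) = 0"
      using \<mu>(2) unfolding a1 r1 r2 by (simp add: algebra_simps)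
    then show False using alpha_nz pos h q_ge by simp
  qed
  then have r2: "r2 = - q - 1" using r(2) by simp
  \<comment> \<open>For the pair that remains, the two relations determine both \<mu> and
    \<beta>.\<close>
  have \<mu>_eq: "\<mu> = \<beta> - 1 + \<alpha> * q * h + (\<alpha> * q * h - 1) * (- q - 1)" using \<mu>(2) unfolding a1 r1 r2 by simp
  have "\<beta> * (\<beta> + q + \<alpha> * q * h) = \<beta> * ((1 + q * h) * \<mu>)"
    using \<mu>(3) unfolding a1 r1 r2 b0 by (simp add: algebra_simps)
  then have "\<beta> + q + \<alpha> * q * h = (1 + q * h) * \<mu>" using pos by simp
  then have "q * h * (\<beta> + q - \<alpha> * (1 + q * (1 + q * h))) = 0"
    unfolding \<mu>_eq by (simp add: algebra_simps)
  then have \<beta>: "\<beta> = \<alpha> * (1 + q * (1 + q * h)) - q" using h q_ge by simp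
  have "br (D + 1) = 1 + q * (1 + q * h)" by (simp add: qbracket_Suc bD)
  with \<beta> have \<beta>': "\<beta> = \<alpha> * br (D + 1) - q" by simp
  have m: "\<mu> = \<alpha> * (1 + q)" unfolding \<mu>_eq \<beta> by (simp add: algebra_simps)
  show ?thesis
  proof (intro conjI allI impI \<beta>')
    fix y z assume yz: "G x y" "G x z"
    show "real (card {t. G x t \<and> G y t \<and> G z t})
        = (if y = z then aa 1 else if G y z then \<alpha> * (1 + q) + \<alpha> * q * br (D - 1) - q - 2 else \<alpha> * (1 + q))"
      unfolding \<mu>(1)[OF yz] \<mu>(2) h_def[symmetric] m by (simp add: r1 r2)
  qed
qed

end

section \<open>Pseudo-geometric strongly regular graphs\<close>

text \<open>Integrality of the rank without spectral theory. Subtracting from Q the rank-one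
  projection onto one of its nonzero columns leaves a symmetric idempotent whose trace is smaller by
  1. Traces are nonnegative, so the process ends at 0.\<close>

lemma trace_idempotent_nat:
  fixes Q :: "'a \<Rightarrow> 'a \<Rightarrow> real"
  assumes "finite A" "\<And>y z. y \<in> A \<Longrightarrow> z \<in> A \<Longrightarrow> Q y z = Q z y"
    "\<And>y z. y \<in> A \<Longrightarrow> z \<in> A \<Longrightarrow> (\<Sum>t\<in>A. Q y t * Q t z) = Q y z"
  shows "(\<Sum>y\<in>A. Q y y) \<in> \<nat>"
proof -
  obtain n :: nat where "(\<Sum>y\<in>A. Q y y) < n" using reals_Archimedean2 by blast
  then show ?thesis using assms(2,3)
  proof (induction n arbitrary: Q)
    case (0 Q)
    have "Q y y \<ge> 0" if "y \<in> A" for y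
      using 0(3)[OF that that] sum_nonneg[of A "\<lambda>t. Q y t * Q t y"] 0(2)[OF that] by fastforce
    then show ?case using 0(1) sum_nonneg[of A "\<lambda>y. Q y y"] by fastforce
  next
    case (Suc n Q)
    note sym = Suc.prems(2) and idem = Suc.prems(3)
    show ?case
    proof (cases "\<forall>y\<in>A. Q y y = 0")
      case True
      then show ?thesis by simp
    next
      case False
      then obtain w where w: "w \<in> A" "Q w w \<noteq> 0" by blast
      define R where "R y z = Q y z - Q y w * Q w z / Q w w" for y z
      have tr: "(\<Sum>y\<in>A. R y y) = (\<Sum>y\<in>A. Q y y) - 1"
      proof -
        have "(\<Sum>y\<in>A. Q y w * Q w y) = (\<Sum>y\<in>A. Q w y * Q y w)" by (simp add: mult.commute)
        then have "(\<Sum>y\<in>A. Q y w * Q w y) = Q w w" using idem[OF w(1) w(1)] by simp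
        then show ?thesis using w(2) by (simp add: R_def sum_subtractf flip: sum_divide_distrib)
      qed
      have "(\<Sum>y\<in>A. R y y) \<in> \<nat>"
      proof (rule Suc.IH[of R])
        show "(\<Sum>y\<in>A. R y y) < real n" using tr Suc.prems(1) by simp
        show "R y z = R z y" if "y \<in> A" "z \<in> A" for y z
          unfolding R_def by (simp only: sym[OF that] sym[OF that(1) w(1)] sym[OF w(1) that(2)] mult.commute)
        show "(\<Sum>t\<in>A. R y t * R t z) = R y z" if "y \<in> A" "z \<in> A" for y z
        proof -
          have "R y t * R t z = Q y t * Q t z - (Q y t * Q t w) * (Q w z / Q w w)
              - (Q w t * Q t z) * (Q y w / Q w w) + (Q w t * Q t w) * (Q y w * Q w z / (Q w w * Q w w))" for t
            using w(2) by (simp add: R_def field_simps)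
          then have "(\<Sum>t\<in>A. R y t * R t z) = (\<Sum>t\<in>A. Q y t * Q t z)
              - (\<Sum>t\<in>A. Q y t * Q t w) * (Q w z / Q w w)
              - (\<Sum>t\<in>A. Q w t * Q t z) * (Q y w / Q w w)
              + (\<Sum>t\<in>A. Q w t * Q t w) * (Q y w * Q w z / (Q w w * Q w w))"
            by (simp only: sum.distrib sum_subtractf sum_distrib_right)
          also have "\<dots> = R y z"
            unfolding idem[OF that] idem[OF that(1) w(1)] idem[OF w(1) that(2)] idem[OF w(1) w(1)]
            using w(2) by (simp add: R_def field_simps)
          finally show ?thesis .
        qed
      qed
      then have "(\<Sum>y\<in>A. R y y) + 1 \<in> \<nat>" by (intro Nats_add Nats_1)
      then show ?thesis using tr by simp
    qed
  qed
qed

lemma sum_card_swap: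
  assumes "finite A" "finite B"
  shows "(\<Sum>a\<in>A. real (card {b \<in> B. R a b})) = (\<Sum>b\<in>B. real (card {a \<in> A. R a b}))"
  using sum.swap_restrict[OF assms, of "\<lambda>_ _. 1 :: real" R] by simp

lemma sum_indicator_card: "finite A \<Longrightarrow> (\<Sum>t\<in>A. if R t then c else 0) = real (card {t \<in> A. R t}) * c"
  by (simp add: sum.If_cases Int_def)

text \<open>The parameters are those of the point graph of a partial geometry with lines of size \<open>\<alpha>[D]\<close>, with
  \<open>q + 1\<close> lines through each point, and with \<open>\<alpha>\<close> lines joining a point to a line not through it.\<close>

locale pseudo_geometric =
  fixes P :: "'a set" and E :: "'a \<Rightarrow> 'a \<Rightarrow> bool" and q D :: nat and \<alpha> :: real
  assumes finite_P: "finite P"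
    and E_sym: "E y z \<longleftrightarrow> E z y" and E_irrefl [simp]: "\<not> E y y"
    and q_ge: "q \<ge> 2" and D_ge: "D \<ge> 4" and alpha_pos: "\<alpha> > 0"
    and card_P: "real (card P) = qbracket q D * (\<alpha> * qbracket q (D + 1) - q)"
    and card_common: "y \<in> P \<Longrightarrow> z \<in> P \<Longrightarrow> real (card {t \<in> P. E y t \<and> E z t}) =
      (if y = z then (real q + 1) * (\<alpha> * qbracket q D - 1)
       else if E y z then \<alpha> * qbracket q D - 2 + q * (\<alpha> - 1) else \<alpha> * (real q + 1))"
    and ex_nonadjacent: "\<exists>y\<in>P. \<exists>z\<in>P. y \<noteq> z \<and> \<not> E y z"
begin

section \<open>Parameters of the partial geometry and inequalities between them\<close>

definition B :: real where "B = qbracket q D"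
text \<open>Lines are to have s + 1 points. K, lm and mu are then the valency and the two
  intersection parameters of the point graph.\<close>

definition s :: real where "s = \<alpha> * B - 1"
definition K :: real where "K = (q + 1) * s"
definition lm :: real where "lm = s - 1 + q * (\<alpha> - 1)"
definition mu :: real where "mu = \<alpha> * (q + 1)"
text \<open>The solution of \<open>K - q * (lm + 1) = gr - 1\<close>; it falls short of the expected
  line size s + 1 by q^2 (\<alpha> - 1).\<close>

definition gr :: real where "gr = s + 1 - (real q)\<^sup>2 * (\<alpha> - 1)"
definition nb :: "'a \<Rightarrow> 'a set" where "nb y = {t \<in> P. E y t}"

lemma finite_nb [simp]: "finite (nb y)" using finite_P by (simp add: nb_def)

lemma card_nb: "y \<in> P \<Longrightarrow> real (card (nb y)) = K"
  using card_common[of y y] by (simp add: nb_def K_def s_def B_def)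

lemma card_nb_adj: "y \<in> P \<Longrightarrow> z \<in> P \<Longrightarrow> E y z \<Longrightarrow> real (card (nb y \<inter> nb z)) = lm"
  using card_common[of y z] by (auto simp: nb_def lm_def s_def B_def Int_def conj_ac algebra_simps cong: conj_cong)

lemma card_nb_nonadj: "y \<in> P \<Longrightarrow> z \<in> P \<Longrightarrow> y \<noteq> z \<Longrightarrow> \<not> E y z \<Longrightarrow> real (card (nb y \<inter> nb z)) = mu"
  using card_common[of y z] by (auto simp: nb_def mu_def Int_def conj_ac cong: conj_cong)

text \<open>A positive count is at least 1. This bounds \<alpha> below by 1/(q + 1) before \<alpha>
  is known to be an integer.\<close>

lemma mu_ge_1: "mu \<ge> 1"
proof -
  obtain y z where "y \<in> P" "z \<in> P" "y \<noteq> z" "\<not> E y z" using ex_nonadjacent by blast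
  then have "mu = real (card (nb y \<inter> nb z))" using card_nb_nonadj by simp
  moreover have "mu > 0" using alpha_pos by (simp add: mu_def)
  ultimately show ?thesis by simp
qed

lemma B_ge: "B \<ge> 1 + q + (real q)\<^sup>2 + real q ^ 3" "D \<ge> 5 \<Longrightarrow> B \<ge> 1 + q + (real q)\<^sup>2 + real q ^ 3 + real q ^ 4"
proof -
  have "qbracket q 4 = 1 + q + (real q)\<^sup>2 + real q ^ 3" "qbracket q 5 = 1 + q + (real q)\<^sup>2 + real q ^ 3 + real q ^ 4"
    by (simp_all add: qbracket_def eval_nat_numeral)
  then show "B \<ge> 1 + q + (real q)\<^sup>2 + real q ^ 3" "D \<ge> 5 \<Longrightarrow> B \<ge> 1 + q + (real q)\<^sup>2 + real q ^ 3 + real q ^ 4"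
    using qbracket_mono[of q 4 D] qbracket_mono[of q 5 D] D_ge unfolding B_def by simp_all
qed

lemma q_powers: "real q \<ge> 2" "(real q)\<^sup>2 \<ge> 2 * q" "real q ^ 3 \<ge> 2 * (real q)\<^sup>2" "real q ^ 4 \<ge> 2 * real q ^ 3"
proof -
  show 1: "real q \<ge> 2" using q_ge by simp
  show "(real q)\<^sup>2 \<ge> 2 * q" "real q ^ 3 \<ge> 2 * (real q)\<^sup>2" "real q ^ 4 \<ge> 2 * real q ^ 3"
    using mult_right_mono[OF 1, of "real q"] mult_right_mono[OF 1, of "(real q)\<^sup>2"] mult_right_mono[OF 1, of "real q ^ 3"]
    by (simp_all add: power2_eq_square eval_nat_numeral)
qed

lemma alpha_q_ge: "\<alpha> * (q + 1) \<ge> 1" using mu_ge_1 by (simp add: mu_def)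

lemma alpha_B_ge: "\<alpha> * B \<ge> 1 + (real q)\<^sup>2"
proof -
  have "B \<ge> (1 + q) * (1 + (real q)\<^sup>2)" using B_ge(1) by (simp add: algebra_simps power2_eq_square power3_eq_cube)
  then have "\<alpha> * B \<ge> \<alpha> * ((1 + q) * (1 + (real q)\<^sup>2))" using alpha_pos by (intro mult_left_mono) auto
  also have "\<alpha> * ((1 + q) * (1 + (real q)\<^sup>2)) = (\<alpha> * (q + 1)) * (1 + (real q)\<^sup>2)" by (simp add: mult_ac add.commute)
  finally show ?thesis using mult_right_mono[OF alpha_q_ge, of "1 + (real q)\<^sup>2"] by simp
qed

lemma s_pos: "s > 0" using alpha_B_ge q_powers by (simp add: s_def)
lemma K_pos: "K > 0" using s_pos by (simp add: K_def)

lemma ex_adjacent: obtains y z where "y \<in> P" "z \<in> P" "E y z"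
proof -
  obtain y where "y \<in> P" using ex_nonadjacent by blast
  then have "card (nb y) > 0" using card_nb[of y] K_pos by linarith
  then show thesis using \<open>y \<in> P\<close> that by (auto simp: card_gt_0_iff nb_def)
qed

lemma lm_nat: "lm \<in> \<nat>" and mu_nat: "mu \<in> \<nat>"
proof -
  show "lm \<in> \<nat>" by (rule ex_adjacent) (metis card_nb_adj of_nat_in_Nats)
  show "mu \<in> \<nat>" using ex_nonadjacent by (metis card_nb_nonadj of_nat_in_Nats)
qed

text \<open>Here [4] = (1 + q)(1 + q^2), so \<alpha>[4] is a multiple of the integer mu. This makes
  \<alpha> an integral combination of mu, lm and q.\<close>

lemma alpha_ge_1: "D = 4 \<Longrightarrow> \<alpha> \<ge> 1"
proof -
  assume "D = 4"
  then have "B = (1 + q) * (1 + (real q)\<^sup>2)"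
    unfolding B_def unfolding \<open>D = 4\<close> by (simp add: qbracket_def eval_nat_numeral algebra_simps)
  then have "\<alpha> = mu * (1 + (1 + (real q)\<^sup>2)) - lm - 2 - q"
    by (simp add: lm_def s_def mu_def algebra_simps)
  also have "\<dots> \<in> \<int>" using lm_nat mu_nat by (auto elim!: Nats_cases)
  finally show ?thesis using alpha_pos by (auto elim!: Ints_cases)
qed

text \<open>The bound that a claw of size q + 2 would violate. For D \<ge> 5 the extra term q^4 in B
  makes up for having only \<alpha> \<ge> 1/(q + 1); for D = 4 the sharper \<alpha> \<ge> 1 is
  used.\<close>

lemma claw_inequality: "2 * ((q + 2) * (lm + 1) - K) > (q + 2) * (q + 1) * (mu - 1)"
proof -
  have "\<alpha> * (2 * B - real q ^ 3 - 2 * (real q)\<^sup>2 - q - 2) > (real q)\<^sup>2 + q"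
  proof (cases "D = 4")
    case True
    have "real q ^ 3 + q > (real q)\<^sup>2 + q" using q_powers by simp
    also have "real q ^ 3 + q \<le> 2 * B - real q ^ 3 - 2 * (real q)\<^sup>2 - q - 2" using B_ge(1) by simp
    also have "\<dots> \<le> \<alpha> * (2 * B - real q ^ 3 - 2 * (real q)\<^sup>2 - q - 2)"
      using alpha_ge_1[OF True] B_ge(1) q_powers by (intro mult_le_cancel_right1[THEN iffD2]) auto
    finally show ?thesis .
  next
    case False
    then have "2 * B - real q ^ 3 - 2 * (real q)\<^sup>2 - q - 2 \<ge> 2 * real q ^ 4"
      using B_ge(2) D_ge q_powers by linarith
    moreover have "2 * real q ^ 4 > ((real q)\<^sup>2 + q) * (q + 1)"
    proof -
      have "((real q)\<^sup>2 + q) * (q + 1) = real q ^ 3 + 2 * (real q)\<^sup>2 + q"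
        by (simp add: algebra_simps power2_eq_square power3_eq_cube)
      then show ?thesis using q_powers by linarith
    qed
    ultimately have "\<alpha> * (((real q)\<^sup>2 + q) * (q + 1)) < \<alpha> * (2 * B - real q ^ 3 - 2 * (real q)\<^sup>2 - q - 2)"
      using alpha_pos by (intro mult_strict_left_mono) linarith+
    moreover have "((real q)\<^sup>2 + q) * 1 \<le> ((real q)\<^sup>2 + q) * (\<alpha> * (q + 1))"
      using alpha_q_ge by (intro mult_left_mono) auto
    ultimately show ?thesis by (simp add: mult_ac)
  qed
  then show ?thesis
    by (simp add: lm_def K_def s_def mu_def field_simps power2_eq_square power3_eq_cube)
qed

lemma extension_inequality: "K - q * (lm + 1) = gr - 1" "gr > 1" "lm + 1 > 0"
proof -
  show "K - q * (lm + 1) = gr - 1"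
    by (simp add: K_def lm_def gr_def algebra_simps power2_eq_square)
  have "\<alpha> * B \<ge> \<alpha> * (real q)\<^sup>2"
    using B_ge(1) q_powers alpha_pos by (intro mult_left_mono) auto
  then show "gr > 1" using q_powers by (simp add: gr_def s_def algebra_simps)
  show "lm + 1 > 0" using lm_nat by (auto elim!: Nats_cases)
qed

text \<open>Two inequalities rest on this bound: one rules out lines with two common points, the
  other rules out q + 2 lines on a point.\<close>

lemma alpha_excess: "\<alpha> * B > \<alpha> * (2 * (real q)\<^sup>2 + 2 * q + 1)"
  using B_ge(1) q_powers alpha_pos by (intro mult_strict_left_mono) linarith+

lemma meet_inequality: "2 * gr - mu - 2 > lm"
proof -
  have "2 * gr - mu - 2 - lm = \<alpha> * B - \<alpha> * (2 * (real q)\<^sup>2 + 2 * q + 1) + (2 * (real q)\<^sup>2 + q)"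
    by (simp add: gr_def mu_def lm_def s_def algebra_simps)
  then show ?thesis using alpha_excess q_powers by linarith
qed

lemma transversal_inequality: "gr - 1 > (q + 1) * (mu - 1)"
proof -
  have "gr - 1 - (q + 1) * (mu - 1) = \<alpha> * B - \<alpha> * (2 * (real q)\<^sup>2 + 2 * q + 1) + ((real q)\<^sup>2 + q)"
    by (simp add: gr_def mu_def s_def algebra_simps power2_eq_square)
  then show ?thesis using alpha_excess q_powers by linarith
qed

section \<open>Claws\<close>

definition claw :: "'a \<Rightarrow> 'a set \<Rightarrow> bool" where
  "claw p S \<longleftrightarrow> p \<in> P \<and> S \<subseteq> nb p \<and> (\<forall>y\<in>S. \<forall>z\<in>S. \<not> E y z)"

lemma claw_finite: "claw p S \<Longrightarrow> finite S"
  unfolding claw_def using finite_nb finite_subset by blast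

lemma claw_degree_sum:
  assumes c: "claw p S"
  shows "(\<Sum>t\<in>nb p - S. real (card {y \<in> S. E t y})) = card S * lm"
proof -
  have S: "S \<subseteq> nb p" "S \<subseteq> P" "finite S" "p \<in> P"
    using c claw_finite[OF c] by (auto simp: claw_def nb_def)
  have "(\<Sum>t\<in>nb p - S. real (card {y \<in> S. E t y})) = (\<Sum>t\<in>nb p. real (card {y \<in> S. E t y}))"
    using c by (intro sum.mono_neutral_left) (auto simp: claw_def intro!: card_eq_0_iff[THEN iffD2])
  also have "\<dots> = (\<Sum>y\<in>S. real (card {t \<in> nb p. E t y}))"
    by (rule sum_card_swap) (use S in auto)
  also have "\<dots> = (\<Sum>y\<in>S. lm)"
  proof (rule sum.cong[OF refl])
    fix y assume y: "y \<in> S"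
    have "{t \<in> nb p. E t y} = nb p \<inter> nb y" by (auto simp: nb_def E_sym)
    then show "real (card {t \<in> nb p. E t y}) = lm"
      using card_nb_adj[of p y] y S by (auto simp: nb_def)
  qed
  finally show ?thesis by simp
qed

text \<open>Let f t be the number of claw members adjacent to t. Pairs of members have at most mu -
  1 common neighbours other than p, which bounds the sum of f (f - 1) above. Since f is an integer,
  f (f - 1) \<ge> 2 (f - 1), and the known sum of f bounds it below by more.\<close>

lemma no_large_claw: "claw p S \<Longrightarrow> card S \<noteq> q + 2"
proof
  assume c: "claw p S" and j: "card S = q + 2"
  have S: "S \<subseteq> nb p" "S \<subseteq> P" "finite S" "p \<in> P"
    using c claw_finite[OF c] by (auto simp: claw_def nb_def)
  define f where "f t = real (card {y \<in> S. E t y})" for t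
  have sq: "f t * f t - f t = (\<Sum>y\<in>S. \<Sum>z\<in>S - {y}. if E t y \<and> E t z then 1 else 0)" for t
  proof -
    have fs: "f t = (\<Sum>y\<in>S. if E t y then 1 else 0)" using S by (simp add: f_def sum_indicator_card)
    have "f t * f t = (\<Sum>y\<in>S. \<Sum>z\<in>S. if E t y \<and> E t z then 1 else 0)"
      unfolding fs sum_product by (intro sum.cong) auto
    also have "\<dots> = (\<Sum>y\<in>S. (if E t y then 1 else 0) + (\<Sum>z\<in>S - {y}. if E t y \<and> E t z then 1 else 0))"
      using S by (intro sum.cong refl) (simp add: sum.remove)
    finally show ?thesis unfolding sum.distrib fs[symmetric] by simp
  qed
  have "(\<Sum>t\<in>nb p. f t * f t - f t)
      = (\<Sum>y\<in>S. \<Sum>z\<in>S - {y}. \<Sum>t\<in>nb p. if E t y \<and> E t z then 1 else 0)"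
    unfolding sq by (subst sum.swap, rule sum.cong[OF refl], subst sum.swap, rule refl)
  also have "\<dots> \<le> (\<Sum>y\<in>S. \<Sum>z\<in>S - {y}. mu - 1)"
  proof (intro sum_mono)
    fix y z assume yz: "y \<in> S" "z \<in> S - {y}"
    have "insert p {t \<in> nb p. E t y \<and> E t z} \<subseteq> nb y \<inter> nb z"
      using yz S by (auto simp: nb_def E_sym)
    then have "card (insert p {t \<in> nb p. E t y \<and> E t z}) \<le> card (nb y \<inter> nb z)"
      by (intro card_mono) auto
    moreover have "p \<notin> {t \<in> nb p. E t y \<and> E t z}" by (simp add: nb_def)
    ultimately have "real (card {t \<in> nb p. E t y \<and> E t z}) + 1 \<le> real (card (nb y \<inter> nb z))"
      by simp
    also have "real (card (nb y \<inter> nb z)) = mu"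
      using yz S c by (intro card_nb_nonadj) (auto simp: claw_def)
    finally show "(\<Sum>t\<in>nb p. if E t y \<and> E t z then 1 else 0) \<le> mu - 1"
      by (simp add: sum_indicator_card)
  qed
  also have "\<dots> = (\<Sum>y\<in>S. (q + 1) * (mu - 1))"
    using S j by (intro sum.cong) (auto simp: card_Diff_singleton)
  also have "\<dots> = (q + 2) * (q + 1) * (mu - 1)" using j by (simp add: algebra_simps)
  finally have up: "(\<Sum>t\<in>nb p. f t * f t - f t) \<le> (q + 2) * (q + 1) * (mu - 1)" .
  have nn: "2 * (f t - 1) \<le> f t * f t - f t" "0 \<le> f t * f t - f t" for t
  proof -
    obtain k :: nat where k: "f t = k" by (simp add: f_def)
    consider "k = 0" | "k = 1" | "k \<ge> 2" by linarith
    then have "2 * (f t - 1) \<le> f t * f t - f t \<and> 0 \<le> f t * f t - f t"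
    proof cases
      case 3
      then have "0 \<le> (real k - 1) * (real k - 2)" "0 \<le> real k * (real k - 1)" by simp_all
      then show ?thesis unfolding k by (simp add: algebra_simps)
    qed (simp_all add: k)
    then show "2 * (f t - 1) \<le> f t * f t - f t" "0 \<le> f t * f t - f t" by auto
  qed
  have "2 * ((\<Sum>t\<in>nb p - S. f t) - card (nb p - S)) = (\<Sum>t\<in>nb p - S. 2 * (f t - 1))"
    by (simp add: sum_subtractf sum_distrib_left[symmetric])
  also have "\<dots> \<le> (\<Sum>t\<in>nb p - S. f t * f t - f t)" by (intro sum_mono nn)
  also have "\<dots> \<le> (\<Sum>t\<in>nb p. f t * f t - f t)" using nn(2) by (intro sum_mono2) auto
  also note up
  finally have "2 * ((q + 2) * lm - card (nb p - S)) \<le> (q + 2) * (q + 1) * (mu - 1)"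
    unfolding f_def claw_degree_sum[OF c] j by simp
  moreover have "real (card (nb p - S)) = K - (q + 2)"
  proof -
    have "card S \<le> card (nb p)" using S by (intro card_mono) auto
    then show ?thesis using S card_nb[of p] j by (simp add: card_Diff_subset of_nat_diff)
  qed
  ultimately show False using claw_inequality by (simp add: algebra_simps)
qed

definition free :: "'a \<Rightarrow> 'a set \<Rightarrow> 'a set" where
  "free p S = {t \<in> nb p - S. \<forall>y\<in>S. \<not> E t y}"

text \<open>Each member of the claw takes at most itself and its lm common neighbours with p out of
  the K neighbours of p.\<close>

lemma card_free:
  assumes c: "claw p S" and j: "card S \<le> q"
  shows "real (card (free p S)) \<ge> gr - 1"
proof -
  have S: "S \<subseteq> nb p" "finite S" "p \<in> P" using c claw_finite[OF c] by (auto simp: claw_def)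
  have sub: "free p S \<subseteq> nb p - S" "finite (nb p - S)" by (auto simp: free_def)
  have "card (nb p - S - free p S) = card (nb p - S) - card (free p S)"
    using sub by (intro card_Diff_subset finite_subset[OF sub])
  moreover have "card (free p S) \<le> card (nb p - S)" by (rule card_mono[OF sub(2,1)])
  ultimately have "real (card (nb p - S)) - real (card (free p S)) = real (card (nb p - S - free p S))"
    by linarith
  also have "\<dots> = (\<Sum>t\<in>nb p - S - free p S. 1)" by simp
  also have "\<dots> \<le> (\<Sum>t\<in>nb p - S - free p S. real (card {y \<in> S. E t y}))"
  proof (rule sum_mono)
    fix t assume "t \<in> nb p - S - free p S"
    then have "{y \<in> S. E t y} \<noteq> {}" by (auto simp: free_def)
    then have "card {y \<in> S. E t y} > 0" using S by (simp add: card_gt_0_iff)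
    then show "1 \<le> real (card {y \<in> S. E t y})" by linarith
  qed
  also have "\<dots> \<le> (\<Sum>t\<in>nb p - S. real (card {y \<in> S. E t y}))" by (rule sum_mono2) auto
  also have "\<dots> = card S * lm" by (rule claw_degree_sum[OF c])
  finally have "real (card (free p S)) \<ge> real (card (nb p - S)) - card S * lm" by simp
  moreover have "card S \<le> card (nb p)" using S by (intro card_mono) auto
  then have "real (card (nb p - S)) = K - card S"
    using S card_nb[of p] by (simp add: card_Diff_subset of_nat_diff)
  moreover have "card S * (lm + 1) \<le> q * (lm + 1)"
    using j extension_inequality(3) by (intro mult_right_mono) auto
  ultimately show ?thesis using extension_inequality(1) by (simp add: algebra_simps)
qed

lemma claw_insert: "claw p S \<Longrightarrow> t \<in> free p S \<Longrightarrow> claw p (insert t S)"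
  by (auto simp: claw_def free_def E_sym)

lemma ex_claw:
  assumes "p \<in> P" "y \<in> nb p" "1 \<le> j" "j \<le> q + 1"
  shows "\<exists>S. claw p S \<and> y \<in> S \<and> card S = j"
  using assms(3,4)
proof (induction j rule: dec_induct)
  case base
  show ?case by (rule exI[of _ "{y}"]) (use assms in \<open>auto simp: claw_def\<close>)
next
  case (step j)
  then obtain S where S: "claw p S" "y \<in> S" "card S = j" by auto
  then have "card (free p S) > 0" using card_free[of p S] step extension_inequality(2) by simp
  then obtain t where t: "t \<in> free p S" by (auto simp: card_gt_0_iff)
  then have "t \<notin> S" by (auto simp: free_def)
  then have "card (insert t S) = Suc j" using claw_finite[OF S(1)] S(3) by simp
  then show ?case using claw_insert[OF S(1) t] S(2) by blast
qed

section \<open>Large maximal cliques as lines\<close>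

definition clique :: "'a set \<Rightarrow> bool" where
  "clique C \<longleftrightarrow> C \<subseteq> P \<and> (\<forall>y\<in>C. \<forall>z\<in>C. y \<noteq> z \<longrightarrow> E y z)"

text \<open>\<open>gr - 1\<close> is a lower bound for the number of neighbours of \<open>p\<close> that extend a claw of size \<open>q\<close> at \<open>p\<close>.\<close>

definition line :: "'a set \<Rightarrow> bool" where
  "line C \<longleftrightarrow> clique C \<and> gr \<le> card C \<and> (\<forall>C'. clique C' \<longrightarrow> C \<subseteq> C' \<longrightarrow> C' = C)"

lemma clique_finite: "clique C \<Longrightarrow> finite C"
  unfolding clique_def using finite_P finite_subset by blast

text \<open>Two nonadjacent free vertices would extend a claw of size q to one of size q +
  2.\<close>

lemma free_clique:
  assumes c: "claw p S" and j: "card S = q"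
  shows "clique (insert p (free p S))"
proof -
  have "E t t'" if t: "t \<in> free p S" "t' \<in> free p S" "t \<noteq> t'" for t t'
  proof (rule ccontr)
    assume "\<not> E t t'"
    then have "t' \<in> free p (insert t S)" using t by (auto simp: free_def E_sym)
    then have "claw p (insert t' (insert t S))" by (intro claw_insert c t)
    moreover have "t \<notin> S" "t' \<notin> S" using t by (auto simp: free_def)
    then have "card (insert t' (insert t S)) = q + 2" using t j claw_finite[OF c] by simp
    ultimately show False using no_large_claw by blast
  qed
  moreover have "E p t" "E t p" "t \<in> P" if "t \<in> free p S" for t
    using that E_sym[of p t] by (auto simp: free_def nb_def)
  moreover have "p \<in> P" using c by (simp add: claw_def)
  ultimately show ?thesis unfolding clique_def by blast
qed

text \<open>A claw of size q + 1 through y, with y removed, is a claw of size q to which y is free.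
  Its free vertices and p form a large clique containing y; a maximal clique above it is a
  line.\<close>

lemma ex_line:
  assumes "p \<in> P" "y \<in> P" "E p y"
  shows "\<exists>C. line C \<and> p \<in> C \<and> y \<in> C"
proof -
  have y: "y \<in> nb p" using assms by (simp add: nb_def)
  then obtain T where T: "claw p T" "y \<in> T" "card T = q + 1"
    using ex_claw[OF assms(1), of y "q + 1"] by auto
  define S where "S = T - {y}"
  have S: "claw p S" "card S = q" using T claw_finite[OF T(1)] by (auto simp: S_def claw_def)
  have yf: "y \<in> free p S" using T y by (auto simp: free_def S_def claw_def)
  let ?C = "insert p (free p S)"
  have cl: "clique ?C" by (rule free_clique[OF S])
  have "p \<notin> free p S" by (simp add: free_def nb_def)
  moreover have "finite (free p S)" by (simp add: free_def)
  ultimately have big: "gr \<le> card ?C" using card_free[OF S(1)] S(2) by simp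
  have "finite {C. clique C \<and> ?C \<subseteq> C}"
    by (rule finite_subset[of _ "Pow P"]) (auto simp: clique_def finite_P)
  moreover have "?C \<in> {C. clique C \<and> ?C \<subseteq> C}" using cl by blast
  ultimately obtain C where C: "C \<in> {C. clique C \<and> ?C \<subseteq> C}" "?C \<subseteq> C"
      "\<forall>C'\<in>{C. clique C \<and> ?C \<subseteq> C}. C \<subseteq> C' \<longrightarrow> C' = C"
    using finite_has_maximal2[of "{C. clique C \<and> ?C \<subseteq> C}" ?C] by metis
  have "card ?C \<le> card C" using C by (intro card_mono) (auto intro: clique_finite)
  then have "line C" unfolding line_def using C big by auto
  then show ?thesis using C yf by blast
qed

lemma line_nonadjacent:
  assumes C: "line C" and z: "z \<in> P" "z \<notin> C"
  obtains c where "c \<in> C" "c \<noteq> z" "\<not> E z c"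
proof -
  have "\<not> (\<forall>c\<in>C. E z c)"
  proof
    assume "\<forall>c\<in>C. E z c"
    then have "clique (insert z C)" using C z by (auto simp: line_def clique_def E_sym)
    then have "insert z C = C" using C by (auto simp: line_def)
    then show False using z by auto
  qed
  then show thesis using z that by blast
qed

text \<open>If y and z are distinct common points, all other points of both lines are common
  neighbours of y and z, at most lm in number. The common points are also common neighbours of a
  nonadjacent pair c, c', hence at most mu. As lines have at least gr points,
  \<open>meet_inequality\<close> fails.\<close>

lemma line_meet:
  assumes C: "line C" "line C'" "C \<noteq> C'" and y: "y \<in> C \<inter> C'" and z: "z \<in> C \<inter> C'"
  shows "y = z"
proof (rule ccontr)
  assume "y \<noteq> z"
  have cl: "clique C" "clique C'" using C by (auto simp: line_def)
  have fin: "finite C" "finite C'" using cl clique_finite by auto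
  have "\<not> C' \<subseteq> C" using C cl by (auto simp: line_def)
  then obtain c' where c': "c' \<in> C'" "c' \<notin> C" by blast
  have "c' \<in> P" using c' cl by (auto simp: clique_def)
  obtain c where c: "c \<in> C" "c \<noteq> c'" "\<not> E c' c" by (rule line_nonadjacent[OF C(1) \<open>c' \<in> P\<close> c'(2)])
  have cP: "c \<in> P" using c cl by (auto simp: clique_def)
  have "c \<notin> C'" using c c' cl(2) by (auto simp: clique_def)
  then have "C \<inter> C' \<subseteq> nb c' \<inter> nb c"
    using cl c c' by (auto simp: clique_def nb_def)
  then have "card (C \<inter> C') \<le> card (nb c' \<inter> nb c)" by (intro card_mono) auto
  then have 1: "real (card (C \<inter> C')) \<le> mu"
    using card_nb_nonadj[of c' c] c \<open>c' \<in> P\<close> cP by auto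
  have "C \<union> C' - {y, z} \<subseteq> nb y \<inter> nb z"
    using cl y z by (auto simp: clique_def nb_def)
  then have "card (C \<union> C' - {y, z}) \<le> card (nb y \<inter> nb z)" by (intro card_mono) auto
  moreover have "y \<in> P" "z \<in> P" "E y z" using cl y z \<open>y \<noteq> z\<close> by (auto simp: clique_def)
  ultimately have "real (card (C \<union> C' - {y, z})) \<le> lm" using card_nb_adj[of y z] by simp
  moreover have "card (C \<union> C' - {y, z}) = card (C \<union> C') - 2"
  proof -
    have "card (C \<union> C' - {y, z}) = card (C \<union> C') - card {y, z}"
      using y z by (intro card_Diff_subset) auto
    then show ?thesis using \<open>y \<noteq> z\<close> by simp
  qed
  moreover have "card (C \<union> C') \<ge> card {y, z}" using y z fin by (intro card_mono) auto
  then have "card (C \<union> C') \<ge> 2" using \<open>y \<noteq> z\<close> by simp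
  ultimately have "real (card (C \<union> C')) - 2 \<le> lm" by (simp add: of_nat_diff)
  moreover have "real (card (C \<union> C')) + real (card (C \<inter> C')) = card C + card C'"
    using card_Un_Int[OF fin] by linarith
  moreover have "gr \<le> card C" "gr \<le> card C'" using C by (auto simp: line_def)
  ultimately show False using 1 meet_inequality by linarith
qed

end

text \<open>The arithmetic for D = 4: the divisibility by u expresses integrality of a multiplicity,
  and the integer w = q (q + 1) / a expresses integrality of the number of lines.\<close>

lemma no_small_line_parameter:
  fixes q a w u :: int
  assumes a: "1 \<le> a" "a < q" and w: "a * w = q * (q + 1)" and u: "u = a * (1 + q + q\<^sup>2) + 1"
    and dvd: "u dvd (q + 1) * ((q - a) * (q + 1 - a))"
  shows False
proof -
  define m where "m = w - 2 * q - 1 + a"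
  have am: "(q - a) * (q + 1 - a) = a * m"
    using w by (simp add: m_def algebra_simps)
  have "coprime u a"
  proof (rule coprimeI)
    fix c assume "c dvd u" "c dvd a"
    then have "c dvd u - a * (1 + q + q\<^sup>2)" by (intro dvd_diff dvd_mult2)
    then show "is_unit c" by (simp add: u)
  qed
  moreover have "u dvd ((q + 1) * m) * a" using dvd unfolding am by (simp add: mult_ac)
  ultimately have "u dvd (q + 1) * m" by (simp add: coprime_dvd_mult_left_iff)
  then obtain j where j: "(q + 1) * m = u * j" by (elim dvdE)
  have "a * m > 0" unfolding am[symmetric] using a by (intro mult_pos_pos) auto
  then have "m > 0" using a by (simp add: zero_less_mult_iff)
  have "u > 0" unfolding u using a by (intro add_pos_nonneg add_nonneg_pos mult_nonneg_nonneg) auto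
  have "(q + 1) * m > 0" using \<open>m > 0\<close> a by simp
  then have j1: "j \<ge> 1" using j \<open>u > 0\<close> by (simp add: zero_less_mult_iff)
  have u': "u = a * a * w + a + 1"
  proof -
    have "a * a * w = a * (q * (q + 1))" using w by (simp add: mult.assoc)
    then show ?thesis unfolding u by (simp add: algebra_simps power2_eq_square)
  qed
  \<comment> \<open>Substituting u = a a w + a + 1 in (q + 1) m = u j and collecting the multiples
    of w leaves w with this cofactor, so d is positive.\<close>
  define d where "d = q + 1 - j * a * a"
  have wd: "w * d = j * (a + 1) + (q + 1) * (2 * q + 1 - a)"
    using j unfolding u' m_def d_def by (simp add: algebra_simps)
  have "a * w > 0" unfolding w using a by simp
  then have "w > 0" using a by (simp add: zero_less_mult_iff)
  moreover have "j * (a + 1) + (q + 1) * (2 * q + 1 - a) > 0"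
    using a j1 by (intro add_pos_pos mult_pos_pos) auto
  ultimately have d1: "d \<ge> 1" using wd by (metis int_one_le_iff_zero_less zero_less_mult_pos)
  have qd: "q * (q + 1) * d = a * j * (a + 1) + a * (q + 1) * (2 * q + 1 - a)"
  proof -
    have "q * (q + 1) * d = a * (w * d)" using w by (simp add: mult.assoc)
    then show ?thesis unfolding wd by (simp add: algebra_simps)
  qed
  have "j * a * 1 \<le> j * a * a" using a j1 by (intro mult_left_mono) auto
  then have ja: "j * a \<le> j * a * a" by simp
  have "j * a * a \<le> q" using d1 by (simp add: d_def)
  have "1 \<le> j * a" using a j1 by (metis int_one_le_iff_zero_less zero_less_mult_iff less_le_trans zero_less_one)
  \<comment> \<open>Reduction modulo q + 1 shows that q + 1 divides j a - d. Both j a and d lie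
    between 1 and q, so they are equal, and little freedom remains.\<close>
  have "(q + 1) dvd a * j * (a + 1)"
  proof -
    have "a * j * (a + 1) = (q + 1) * (q * d - a * (2 * q + 1 - a))"
      using qd by (simp add: algebra_simps)
    then show ?thesis by simp
  qed
  moreover have "a * j * (a + 1) = (q + 1) + (j * a - d)" by (simp add: d_def algebra_simps)
  ultimately have dv: "(q + 1) dvd (j * a - d)" by (metis dvd_add_right_iff dvd_refl)
  have "\<bar>j * a - d\<bar> < q + 1"
    using ja \<open>j * a * a \<le> q\<close> \<open>1 \<le> j * a\<close> d1 by (auto simp: d_def)
  have eq: "d = j * a"
  proof (rule ccontr)
    assume "d \<noteq> j * a"
    then have "\<bar>q + 1\<bar> \<le> \<bar>j * a - d\<bar>" using dv by (intro dvd_imp_le_int) auto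
    then show False using \<open>\<bar>j * a - d\<bar> < q + 1\<close> a by linarith
  qed
  then have q1: "q + 1 = j * a * (a + 1)" by (simp add: d_def algebra_simps)
  have "(q + 1) * (q * (j * a)) = q * (q + 1) * d" by (simp add: eq)
  also have "\<dots> = j * a * (a + 1) + a * (q + 1) * (2 * q + 1 - a)" unfolding qd by (simp add: mult_ac)
  also have "\<dots> = (q + 1) * (1 + a * (2 * q + 1 - a))" unfolding q1[symmetric] by (simp add: algebra_simps)
  finally have "(q + 1) * (q * (j * a)) = (q + 1) * (1 + a * (2 * q + 1 - a))" .
  then have qj: "q * (j * a) = 1 + a * (2 * q + 1 - a)" using a by simp
  then have "a * (q * j - (2 * q + 1 - a)) = 1" by (simp add: algebra_simps)
  then have a1: "a = 1" using a by (auto simp: zmult_eq_1_iff)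
  then have "q * (j - 2) = 1" using qj by (simp add: algebra_simps)
  then have "q = 1 \<or> q = - 1" using zmult_eq_1_iff by blast
  then show False using a by auto
qed

section \<open>The lines through a point\<close>

context pseudo_geometric
begin

definition lines :: "'a \<Rightarrow> 'a set set" where "lines p = {C. line C \<and> p \<in> C}"

lemma finite_lines: "finite {C. line C}" "finite (lines p)"
proof -
  show 1: "finite {C. line C}"
    by (rule finite_subset[of _ "Pow P"]) (auto simp: line_def clique_def finite_P)
  show "finite (lines p)" by (rule finite_subset[OF _ 1]) (auto simp: lines_def)
qed

lemma line_adj: "line C \<Longrightarrow> y \<in> C \<Longrightarrow> z \<in> C \<Longrightarrow> y \<noteq> z \<Longrightarrow> E y z"
  and line_subset: "line C \<Longrightarrow> C \<subseteq> P"
  by (auto simp: line_def clique_def)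

text \<open>The members of a claw of size q + 1 at p are pairwise nonadjacent, so the lines joining
  them to p are distinct.\<close>

lemma card_lines_ge:
  assumes "p \<in> P"
  shows "card (lines p) \<ge> q + 1"
proof -
  have "card (nb p) > 0" using card_nb[OF assms] K_pos by linarith
  then obtain y where "y \<in> nb p" by (auto simp: card_gt_0_iff)
  then obtain T where T: "claw p T" "card T = q + 1" using ex_claw[OF assms, of y "q + 1"] by auto
  have "\<exists>C. line C \<and> p \<in> C \<and> t \<in> C" if "t \<in> T" for t
    using T(1) that by (intro ex_line) (auto simp: claw_def nb_def)
  then obtain l where l: "\<And>t. t \<in> T \<Longrightarrow> line (l t) \<and> p \<in> l t \<and> t \<in> l t" by metis
  have "inj_on l T"
  proof (rule inj_onI, rule ccontr)
    fix t t' assume t: "t \<in> T" "t' \<in> T" "l t = l t'" "t \<noteq> t'"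
    then have "E t t'" using l[OF t(1)] l[OF t(2)] line_adj by metis
    then show False using T(1) t by (auto simp: claw_def)
  qed
  moreover have "l ` T \<subseteq> lines p" using l by (auto simp: lines_def)
  ultimately show ?thesis using card_inj_on_le[of l T "lines p"] finite_lines T(2) by simp
qed

text \<open>One point is picked on each line in turn. A point already chosen is adjacent to at most
  mu - 1 points of the new line other than p, so by \<open>transversal_inequality\<close> some point
  of the new line is adjacent to none of them.\<close>

lemma ex_transversal_claw:
  assumes p: "p \<in> P" and F: "finite F" "F \<subseteq> lines p" "card F \<le> q + 2"
  shows "\<exists>S. claw p S \<and> card S = card F \<and> S \<subseteq> \<Union>F"
  using F
proof (induction F rule: finite_induct)
  case empty
  show ?case by (rule exI[of _ "{}"]) (use p in \<open>auto simp: claw_def\<close>)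
next
  case (insert C F)
  then obtain S where S: "claw p S" "card S = card F" "S \<subseteq> \<Union>F" by auto
  have C: "line C" "p \<in> C" using insert.prems by (auto simp: lines_def)
  have finS: "finite S" by (rule claw_finite[OF S(1)])
  have pS: "t \<in> P" "E p t" "t \<noteq> p" if "t \<in> S" for t
    using that S(1) by (auto simp: claw_def nb_def)
  have SC: "t \<notin> C" if t: "t \<in> S" for t
  proof
    assume "t \<in> C"
    obtain C' where C': "C' \<in> F" "t \<in> C'" using S(3) t by blast
    then have "line C'" "p \<in> C'" "C \<noteq> C'" using insert by (auto simp: lines_def)
    then have "p = t" using line_meet[of C C' p t] C C' \<open>t \<in> C\<close> by blast
    then show False using pS(3)[OF t] by simp
  qed
  have finC: "finite C" using C(1) clique_finite by (auto simp: line_def)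
  let ?bad = "\<Union>t\<in>S. nb t \<inter> C - {p}"
  have bad: "real (card (nb t \<inter> C - {p})) \<le> mu - 1" if t: "t \<in> S" for t
  proof -
    obtain c where c: "c \<in> C" "c \<noteq> t" "\<not> E t c"
      using line_nonadjacent[OF C(1) pS(1)[OF t] SC[OF t]] by blast
    have cP: "c \<in> P" using c line_subset[OF C(1)] by blast
    have "nb t \<inter> C \<subseteq> nb t \<inter> nb c"
      using c line_adj[OF C(1)] line_subset[OF C(1)] by (auto simp: nb_def)
    then have "card (nb t \<inter> C) \<le> card (nb t \<inter> nb c)" by (intro card_mono) auto
    then have "real (card (nb t \<inter> C)) \<le> mu"
      using card_nb_nonadj[OF pS(1)[OF t] cP] c by simp
    moreover have "p \<in> nb t \<inter> C" using pS[OF t] C(2) p E_sym[of p t] by (auto simp: nb_def)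
    then have "card (nb t \<inter> C - {p}) + 1 = card (nb t \<inter> C)" using finC by (subst card_Suc_Diff1[symmetric]) auto
    ultimately show ?thesis by linarith
  qed
  have "card ?bad \<le> (\<Sum>t\<in>S. card (nb t \<inter> C - {p}))" by (rule card_UN_le[OF finS])
  then have "real (card ?bad) \<le> (\<Sum>t\<in>S. real (card (nb t \<inter> C - {p})))"
    by (metis of_nat_le_iff of_nat_sum)
  also have "\<dots> \<le> (\<Sum>t\<in>S. mu - 1)" by (intro sum_mono bad)
  also have "\<dots> = card F * (mu - 1)" using S(2) by simp
  also have "\<dots> \<le> (q + 1) * (mu - 1)"
    using insert mu_ge_1 by (intro mult_right_mono) auto
  also have "\<dots> < gr - 1" by (rule transversal_inequality)
  also have "gr - 1 \<le> card (C - {p})"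
    using C finC extension_inequality(2) by (auto simp: line_def card_Diff_singleton of_nat_diff)
  finally have "card ?bad < card (C - {p})" by simp
  then have "\<not> C - {p} \<subseteq> ?bad" using finC finS card_mono[of ?bad "C - {p}"] by fastforce
  then obtain t where t: "t \<in> C" "t \<noteq> p" "\<And>y. y \<in> S \<Longrightarrow> t \<notin> nb y" by blast
  have tP: "t \<in> P" using t line_subset[OF C(1)] by blast
  have "t \<notin> S" using SC t by blast
  moreover have "t \<in> nb p" using t C line_adj[of C p t] tP by (auto simp: nb_def)
  moreover have "\<not> E t y" if "y \<in> S" for y using t(3)[OF that] tP E_sym[of t y] by (auto simp: nb_def)
  ultimately have "t \<in> free p S" by (auto simp: free_def)
  then have "claw p (insert t S)" by (rule claw_insert[OF S(1)])
  moreover have "card (insert t S) = card (insert C F)" using \<open>t \<notin> S\<close> finS insert S(2) by simp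
  moreover have "insert t S \<subseteq> \<Union>(insert C F)" using S(3) t(1) by auto
  ultimately show ?case by blast
qed

lemma card_lines: "p \<in> P \<Longrightarrow> card (lines p) = q + 1"
proof (rule ccontr)
  assume p: "p \<in> P" "card (lines p) \<noteq> q + 1"
  then have "q + 2 \<le> card (lines p)" using card_lines_ge[OF p(1)] by simp
  then obtain F where F: "F \<subseteq> lines p" "card F = q + 2" "finite F"
    using obtain_subset_with_card_n by metis
  then obtain S where "claw p S" "card S = q + 2" using ex_transversal_claw[OF p(1) F(3,1)] by auto
  then show False using no_large_claw by blast
qed

lemma sum_card_lines:
  assumes p: "p \<in> P"
  shows "(\<Sum>C\<in>lines p. real (card C) - 1) = K"
proof -
  have "nb p = (\<Union>C\<in>lines p. C - {p})"
  proof
    show "nb p \<subseteq> (\<Union>C\<in>lines p. C - {p})"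
    proof
      fix y assume y: "y \<in> nb p"
      then obtain C where "line C" "p \<in> C" "y \<in> C" using ex_line[OF p] by (auto simp: nb_def)
      then show "y \<in> (\<Union>C\<in>lines p. C - {p})" using y by (auto simp: lines_def nb_def)
    qed
    show "(\<Union>C\<in>lines p. C - {p}) \<subseteq> nb p"
      using line_adj line_subset by (fastforce simp: lines_def nb_def)
  qed
  moreover have "card (\<Union>C\<in>lines p. C - {p}) = (\<Sum>C\<in>lines p. card (C - {p}))"
  proof (intro card_UN_disjoint ballI impI finite_lines)
    fix C assume "C \<in> lines p"
    then show "finite (C - {p})" by (simp add: lines_def line_def clique_finite)
    fix C' assume "C' \<in> lines p" "C \<noteq> C'"
    then show "(C - {p}) \<inter> (C' - {p}) = {}"
      using \<open>C \<in> lines p\<close> line_meet[of C C' p] by (auto simp: lines_def)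
  qed
  ultimately have "K = (\<Sum>C\<in>lines p. real (card (C - {p})))" using card_nb[OF p] by simp
  also have "\<dots> = (\<Sum>C\<in>lines p. real (card C) - 1)"
  proof (rule sum.cong[OF refl])
    fix C assume C: "C \<in> lines p"
    then have "finite C" by (auto simp: lines_def line_def clique_finite)
    then have "card C > 0" using C by (auto simp: card_gt_0_iff lines_def)
    then show "real (card (C - {p})) = real (card C) - 1"
      using C \<open>finite C\<close> by (simp add: lines_def card_Diff_singleton of_nat_diff)
  qed
  finally show ?thesis ..
qed

section \<open>Line size and nexus from the clique bound\<close>

definition \<beta> :: real where "\<beta> = q * s + \<alpha>"

text \<open>This \<beta> equals \<alpha>[D+1] - q, so it is the parameter \<beta> of the
  distance-regular graph when the points are the neighbours of x.\<close>

lemma card_P_beta: "real (card P) = B * \<beta>"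
  using card_P by (simp add: qbracket_Suc B_def \<beta>_def s_def algebra_simps)

lemma beta_pos: "\<beta> > 0" using s_pos alpha_pos by (simp add: \<beta>_def add_nonneg_pos)
lemma B_gt_1: "B > 1" using B_ge(1) q_powers by linarith

lemma eigen_pos: "s - \<alpha> + q + 1 > 0"
proof -
  have "\<alpha> * 1 \<le> \<alpha> * B" using alpha_pos B_gt_1 by (intro mult_left_mono) auto
  then show ?thesis using q_powers(1) by (simp add: s_def)
qed

text \<open>The variance argument behind Delsarte's clique bound: the left-hand side is a sum of squares.\<close>

lemma clique_variance:
  assumes C: "clique C"
  shows "(\<Sum>y\<in>P. (real (card {z \<in> C. E y z}) - (if y \<in> C then s - \<alpha> else 0) - card C / B)\<^sup>2)
    = (s - \<alpha> + q + 1) * card C * (1 - 1 / B) * (\<alpha> * B - card C)"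
proof -
  define c where "c = real (card C)"
  define n where "n y = real (card {z \<in> C. E y z})" for y
  have CP: "C \<subseteq> P" "finite C" using C clique_finite by (auto simp: clique_def)
  have nC: "n y = c - 1" if y: "y \<in> C" for y
  proof -
    have "{z \<in> C. E y z} = C - {y}" using C y by (auto simp: clique_def)
    moreover have "card C > 0" using y CP by (auto simp: card_gt_0_iff)
    ultimately show ?thesis using y CP by (simp add: n_def c_def of_nat_diff)
  qed
  have s1: "(\<Sum>y\<in>P. n y) = c * K"
  proof -
    have "(\<Sum>y\<in>P. n y) = (\<Sum>z\<in>C. real (card {y \<in> P. E y z}))"
      unfolding n_def by (rule sum_card_swap) (use CP finite_P in auto)
    also have "\<dots> = (\<Sum>z\<in>C. K)"
      using card_nb CP by (intro sum.cong) (auto simp: nb_def E_sym[of _ "_ :: 'a"])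
    finally show ?thesis by (simp add: c_def)
  qed
  have s2: "(\<Sum>y\<in>P. n y * n y) = c * K + c * (c - 1) * lm"
  proof -
    have "(\<Sum>y\<in>P. n y * n y) = (\<Sum>y\<in>P. \<Sum>z\<in>C. \<Sum>z'\<in>C. if E y z \<and> E y z' then 1 else 0)"
    proof (rule sum.cong[OF refl])
      fix y
      have "n y = (\<Sum>z\<in>C. if E y z then 1 else 0)" using CP by (simp add: n_def sum_indicator_card)
      then show "n y * n y = (\<Sum>z\<in>C. \<Sum>z'\<in>C. if E y z \<and> E y z' then 1 else 0)"
        by (simp only: sum_product) (intro sum.cong, auto)
    qed
    also have "\<dots> = (\<Sum>z\<in>C. \<Sum>z'\<in>C. \<Sum>y\<in>P. if E y z \<and> E y z' then 1 else 0)"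
      by (subst sum.swap, rule sum.cong[OF refl], subst sum.swap, rule refl)
    also have "\<dots> = (\<Sum>z\<in>C. \<Sum>z'\<in>C. if z = z' then K else lm)"
    proof (intro sum.cong refl)
      fix z z' assume z: "z \<in> C" "z' \<in> C"
      have "(\<Sum>y\<in>P. if E y z \<and> E y z' then 1 else 0) = real (card (nb z \<inter> nb z'))"
        using finite_P E_sym by (simp add: sum_indicator_card nb_def Int_def) (metis (no_types, lifting))
      also have "\<dots> = (if z = z' then K else lm)"
        using z CP C card_nb[of z] card_nb_adj[of z z'] by (auto simp: clique_def)
      finally show "(\<Sum>y\<in>P. if E y z \<and> E y z' then 1 else 0) = (if z = z' then K else lm)" .
    qed
    also have "\<dots> = (\<Sum>z\<in>C. K + (c - 1) * lm)"
    proof (rule sum.cong[OF refl])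
      fix z assume z: "z \<in> C"
      then have "card C > 0" using CP by (auto simp: card_gt_0_iff)
      then have "real (card (C - {z})) = c - 1"
        using z CP by (simp add: c_def of_nat_diff card_Diff_singleton)
      moreover have "(\<Sum>z'\<in>C - {z}. if z = z' then K else lm) = (\<Sum>z'\<in>C - {z}. lm)"
        by (rule sum.cong) auto
      ultimately have "(\<Sum>z'\<in>C - {z}. if z = z' then K else lm) = (c - 1) * lm" by simp
      then show "(\<Sum>z'\<in>C. if z = z' then K else lm) = K + (c - 1) * lm"
        using z CP by (subst sum.remove[of _ z]) auto
    qed
    finally show ?thesis by (simp add: c_def algebra_simps)
  qed
  define r where "r = s - \<alpha>"
  have sC: "(\<Sum>y\<in>P. if y \<in> C then g y else 0) = (\<Sum>y\<in>C. g y)" for g :: "'a \<Rightarrow> real"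
    using CP finite_P by (simp add: sum.If_cases Int_absorb1)
  have "(\<Sum>y\<in>P. (n y - (if y \<in> C then r else 0) - c / B)\<^sup>2)
      = (\<Sum>y\<in>P. n y * n y - 2 * (c / B) * n y + (c / B)\<^sup>2
          + (if y \<in> C then r * r - 2 * r * n y + 2 * (c / B) * r else 0))"
    by (rule sum.cong) (auto simp: power2_eq_square algebra_simps)
  also have "\<dots> = (c * K + c * (c - 1) * lm) - 2 * (c / B) * (c * K) + card P * (c / B)\<^sup>2
      + (\<Sum>y\<in>C. r * r - 2 * r * n y + 2 * (c / B) * r)"
    unfolding sum.distrib sum_subtractf sC sum_distrib_left[symmetric] s1 s2 by simp
  also have "(\<Sum>y\<in>C. r * r - 2 * r * n y + 2 * (c / B) * r) = c * (r * r - 2 * r * (c - 1) + 2 * (c / B) * r)"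
    using nC by (simp add: c_def)
  also have "(c * K + c * (c - 1) * lm) - 2 * (c / B) * (c * K) + card P * (c / B)\<^sup>2
      + c * (r * r - 2 * r * (c - 1) + 2 * (c / B) * r) = (r + q + 1) * c * (1 - 1 / B) * (\<alpha> * B - c)"
    unfolding card_P_beta r_def K_def lm_def \<beta>_def s_def using B_gt_1
    by (simp add: field_simps power2_eq_square)
  finally show ?thesis by (simp only: n_def c_def r_def)
qed

lemma clique_bound:
  assumes "clique C"
  shows "card C \<le> \<alpha> * B"
proof (cases "card C = 0")
  case False
  have "0 \<le> (s - \<alpha> + q + 1) * card C * (1 - 1 / B) * (\<alpha> * B - card C)"
    unfolding clique_variance[OF assms, symmetric] by (rule sum_nonneg) simp
  moreover have "(s - \<alpha> + q + 1) * card C * (1 - 1 / B) > 0"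
    using eigen_pos False B_gt_1 by (intro mult_pos_pos) auto
  ultimately show ?thesis by (simp add: zero_le_mult_iff)
qed (use alpha_pos B_gt_1 in simp)

text \<open>The q + 1 lines on p partition its (q + 1) s neighbours, and by the clique bound none
  contains more than s of them; so each contains exactly s.\<close>

lemma card_line:
  assumes C: "line C"
  shows "card C = \<alpha> * B"
proof (rule ccontr)
  assume neq: "card C \<noteq> \<alpha> * B"
  have "gr > 1" "gr \<le> card C" using extension_inequality(2) C by (auto simp: line_def)
  then have "C \<noteq> {}" by auto
  then obtain p where p: "p \<in> C" by blast
  then have pP: "p \<in> P" using line_subset[OF C] by blast
  have "(\<Sum>C\<in>lines p. real (card C) - 1) < (\<Sum>C\<in>lines p. s)"
  proof (rule sum_strict_mono_ex1[OF finite_lines(2)])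
    show "\<forall>C\<in>lines p. real (card C) - 1 \<le> s"
      using clique_bound by (auto simp: lines_def line_def s_def)
    show "\<exists>C\<in>lines p. real (card C) - 1 < s"
      using p C neq clique_bound[of C] by (intro bexI[of _ C]) (auto simp: lines_def line_def s_def)
  qed
  then show False unfolding sum_card_lines[OF pP] by (simp add: card_lines[OF pP] K_def)
qed

text \<open>A line attains the clique bound, so every square in \<open>clique_variance\<close> is
  zero.\<close>

lemma card_nb_line:
  assumes C: "line C" and y: "y \<in> P" "y \<notin> C"
  shows "card {z \<in> C. E y z} = \<alpha>"
proof -
  have cl: "clique C" using C by (simp add: line_def)
  have "(\<Sum>y\<in>P. (real (card {z \<in> C. E y z}) - (if y \<in> C then s - \<alpha> else 0) - card C / B)\<^sup>2) = 0"
    using clique_variance[OF cl] unfolding card_line[OF C] by simp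
  then have "(real (card {z \<in> C. E y z}) - (if y \<in> C then s - \<alpha> else 0) - card C / B)\<^sup>2 = 0"
    using y finite_P by (subst (asm) sum_nonneg_eq_0_iff) auto
  then show ?thesis using y card_line[OF C] B_gt_1 by simp
qed

text \<open>\<alpha> counts the neighbours of y on a line not through y. Lines meet in at most one
  point, so these neighbours lie on distinct lines through y, of which there are q + 1.\<close>

lemma alpha_nat:
  obtains a :: nat where "\<alpha> = a" "1 \<le> a" "a \<le> q + 1"
proof -
  obtain p where p: "p \<in> P" using ex_nonadjacent by blast
  have "card (lines p) > 0" using card_lines[OF p] by simp
  then obtain C where C: "line C" by (auto simp: card_gt_0_iff lines_def)
  obtain y where y: "y \<in> P" "y \<notin> C" using ex_nonadjacent line_adj[OF C] by metis
  let ?N = "{z \<in> C. E y z}"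
  have a: "\<alpha> = card ?N" using card_nb_line[OF C y] by simp
  have "\<exists>L. line L \<and> y \<in> L \<and> z \<in> L" if "z \<in> ?N" for z
    using that y line_subset[OF C] by (intro ex_line) auto
  then obtain l where l: "\<And>z. z \<in> ?N \<Longrightarrow> line (l z) \<and> y \<in> l z \<and> z \<in> l z" by metis
  have "inj_on l ?N"
  proof (rule inj_onI, rule ccontr)
    fix z z' assume z: "z \<in> ?N" "z' \<in> ?N" "l z = l z'" "z \<noteq> z'"
    have "l z \<noteq> C" using l[OF z(1)] y by blast
    then show False using line_meet[of "l z" C z z'] l[OF z(1)] l[OF z(2)] z C by auto
  qed
  moreover have "l ` ?N \<subseteq> lines y" using l by (auto simp: lines_def)
  ultimately have "card ?N \<le> q + 1"
    using card_inj_on_le[of l ?N "lines y"] finite_lines card_lines[OF y(1)] by simp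
  moreover have "1 \<le> card ?N" using a alpha_pos by (metis One_nat_def Suc_le_eq of_nat_0_less_iff)
  ultimately show thesis using that a by blast
qed

section \<open>Integrality conditions\<close>

lemma count_flags: "(q + 1) * \<beta> = card {C. line C} * \<alpha>"
proof -
  have "(\<Sum>p\<in>P. real (card {C \<in> {C. line C}. p \<in> C})) = (\<Sum>C\<in>{C. line C}. real (card {p \<in> P. p \<in> C}))"
    by (rule sum_card_swap) (use finite_P finite_lines in auto)
  moreover have "(\<Sum>p\<in>P. real (card {C \<in> {C. line C}. p \<in> C})) = (\<Sum>p\<in>P. q + 1)"
    using card_lines by (simp add: lines_def algebra_simps)
  moreover have "(\<Sum>C\<in>{C. line C}. real (card {p \<in> P. p \<in> C})) = (\<Sum>C\<in>{C. line C}. \<alpha> * B)"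
  proof (rule sum.cong[OF refl])
    fix C assume C: "C \<in> {C. line C}"
    then have "{p \<in> P. p \<in> C} = C" using line_subset by blast
    then show "real (card {p \<in> P. p \<in> C}) = \<alpha> * B" using card_line C by simp
  qed
  ultimately have "B * ((q + 1) * \<beta>) = B * (card {C. line C} * \<alpha>)"
    using card_P_beta by (simp add: algebra_simps)
  then show ?thesis using B_gt_1 by simp
qed

text \<open>The number is the multiplicity of the eigenvalue s - \<alpha>. Adding (q + 1) I to the
  adjacency matrix removes the eigenvalue -q - 1; after removal of the all-ones part and division by
  R, the projection onto the eigenspace of s - \<alpha> remains.\<close>

lemma multiplicity_nat: "B * (q + 1) * (q * s) / (s - \<alpha> + q + 1) \<in> \<nat>"
proof -
  define e :: "'a \<Rightarrow> 'a \<Rightarrow> real" where "e y z = (if E y z then 1 else 0) + (if y = z then real q + 1 else 0)" for y z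
  \<comment> \<open>The row sum (q + 1)(s + 1) of e divided by the number of points.\<close>
  define k where "k = (q + 1) * \<alpha> / \<beta>"
  define R where "R = s - \<alpha> + q + 1"
  have R: "R > 0" using eigen_pos by (simp add: R_def)
  have "(\<Sum>y\<in>P. (e y y - k) / R) \<in> \<nat>"
  proof (rule trace_idempotent_nat[OF finite_P, of "\<lambda>y z. (e y z - k) / R"])
    show "(e y z - k) / R = (e z y - k) / R" for y z using E_sym[of y z] by (simp add: e_def)
    fix y z assume yz: "y \<in> P" "z \<in> P"
    have row: "(\<Sum>t\<in>P. e w t) = (q + 1) * (s + 1)" if "w \<in> P" for w
      using that finite_P card_nb[OF that]
      by (simp add: e_def sum.distrib sum_indicator_card nb_def K_def algebra_simps sum.delta')
    have col: "(\<Sum>t\<in>P. e t w) = (q + 1) * (s + 1)" if "w \<in> P" for w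
      using row[OF that] E_sym by (simp add: e_def eq_commute[of w])
    have "(\<Sum>t\<in>P. e y t * e t z) = (\<Sum>t\<in>P. (if E y t \<and> E z t then 1 else 0 :: real)
       + (if t = z then (if E y z then real q + 1 else 0) else 0)
       + (if t = y then (if E y z then real q + 1 else 0) else 0)
       + (if t = y then (if y = z then (real q + 1) * (real q + 1) else 0) else 0))"
      using E_sym[of z] by (intro sum.cong) (auto simp: e_def)
    also have "\<dots> = card (nb y \<inter> nb z) + 2 * (if E y z then real q + 1 else 0) + (if y = z then (real q + 1) * (real q + 1) else 0)"
      using yz finite_P by (simp add: sum.distrib sum_indicator_card nb_def Int_def conj_ac cong: conj_cong)
    also have "\<dots> = R * e y z + mu"
      using card_nb[OF yz(1)] card_nb_adj[OF yz] card_nb_nonadj[OF yz]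
      by (auto simp: e_def R_def K_def lm_def mu_def algebra_simps)
    finally have ee: "(\<Sum>t\<in>P. e y t * e t z) = R * e y z + mu" .
    have kb: "k * \<beta> = (q + 1) * \<alpha>" using beta_pos by (simp add: k_def)
    have "(\<Sum>t\<in>P. (e y t - k) * (e t z - k))
        = (\<Sum>t\<in>P. e y t * e t z) - k * (\<Sum>t\<in>P. e y t) - k * (\<Sum>t\<in>P. e t z) + card P * (k * k)"
      by (simp add: algebra_simps sum.distrib sum_subtractf sum_distrib_left)
    also have "\<dots> = R * (e y z - k)"
    proof -
      have "real (card P) * (k * k) = k * (B * (k * \<beta>))" unfolding card_P_beta by (simp add: mult_ac)
      also have "\<dots> = k * ((q + 1) * (s + 1))" unfolding kb by (simp add: s_def mult_ac)
      finally have v: "real (card P) * (k * k) = k * ((q + 1) * (s + 1))" .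
      have "mu = k * \<beta>" unfolding kb by (simp add: mu_def)
      then show ?thesis unfolding ee row[OF yz(1)] col[OF yz(2)] v
        by (simp add: R_def \<beta>_def algebra_simps)
    qed
    finally have main: "(\<Sum>t\<in>P. (e y t - k) * (e t z - k)) = R * (e y z - k)" .
    have "(\<Sum>t\<in>P. (e y t - k) / R * ((e t z - k) / R)) = (\<Sum>t\<in>P. (e y t - k) * (e t z - k)) / (R * R)"
      by (simp add: sum_divide_distrib)
    then show "(\<Sum>t\<in>P. (e y t - k) / R * ((e t z - k) / R)) = (e y z - k) / R"
      unfolding main using R by simp
  qed
  moreover have "(\<Sum>y\<in>P. (e y y - k) / R) = B * (q + 1) * (q * s) / R"
  proof -
    have "(\<Sum>y\<in>P. (e y y - k) / R) = B * (\<beta> * (q + 1 - k)) / R"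
      using card_P_beta by (simp add: e_def)
    also have "\<beta> * (q + 1 - k) = (q + 1) * (q * s)"
      using beta_pos by (simp add: k_def right_diff_distrib) (simp add: \<beta>_def algebra_simps)
    finally show ?thesis by simp
  qed
  ultimately show ?thesis by (simp add: R_def)
qed

theorem alpha_cases: "\<alpha> = real q \<or> \<alpha> = real q + 1"
proof -
  obtain a :: nat where a: "\<alpha> = a" "1 \<le> a" "a \<le> q + 1" by (rule alpha_nat)
  show ?thesis
  proof (cases "a < q")
    case False
    then show ?thesis using a by auto
  next
    case True
    define b :: int where "b = (\<Sum>k<D - 1. int q ^ k)"
    have b: "qbracket q (D - 1) = of_int b" by (simp add: b_def qbracket_def)
    have "D = Suc (D - 1)" using D_ge by simp
    then have Bb: "B = 1 + real q * real_of_int b"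
      unfolding B_def using b qbracket_Suc[of "real q" "D - 1"] by metis
    define u where "u = int a * b + 1"
    have "b \<ge> 0" unfolding b_def by (intro sum_nonneg) simp
    then have u_pos: "u > 0" by (simp add: u_def add_nonneg_pos)
    obtain f :: nat where f: "B * (q + 1) * (q * s) / (s - \<alpha> + q + 1) = f"
      using multiplicity_nat by (auto elim!: Nats_cases)
    have "s - \<alpha> + q + 1 = real q * real_of_int u"
      unfolding s_def Bb by (simp add: a(1) u_def algebra_simps)
    then have "B * (q + 1) * (q * s) = real f * (real q * real_of_int u)"
      using f u_pos q_ge by (simp add: field_simps)
    then have "real q * (B * (q + 1) * s) = real q * (real f * real_of_int u)" by (simp add: mult_ac)
    then have "B * (q + 1) * s = real f * real_of_int u" using q_ge by simp
    then have "real_of_int ((1 + q * b) * (q + 1) * (a * (1 + q * b) - 1)) = real_of_int (f * u)"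
      unfolding Bb s_def by (simp add: a(1))
    then have fu: "(1 + q * b) * (q + 1) * (a * (1 + q * b) - 1) = f * u" by (simp only: of_int_eq_iff)
    \<comment> \<open>Modulo u the product a (1 + q b) is a - q, so a times the multiplicity
      equation leaves a product that involves only q and a.\<close>
    have dvd: "u dvd (int q + 1) * ((int q - a) * (int q + 1 - a))"
    proof -
      have ab: "int a * (1 + int q * b) = int a - int q + int q * u" by (simp add: u_def algebra_simps)
      have "int a * (int f * u) = (int q + 1) * ((int a - int q + int q * u) * (int a - int q + int q * u - 1))"
        unfolding fu[symmetric] ab[symmetric] by (simp add: algebra_simps)
      also have "\<dots> = (int q + 1) * ((int q - a) * (int q + 1 - a)) + u * ((int q + 1) * int q * (2 * int a - 2 * int q - 1 + int q * u))"
        by (simp add: algebra_simps)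
      finally have "(int q + 1) * ((int q - a) * (int q + 1 - a)) = u * (int a * int f - (int q + 1) * int q * (2 * int a - 2 * int q - 1 + int q * u))"
        by (simp add: algebra_simps)
      then show ?thesis by simp
    qed
    have pos: "(int q + 1) * ((int q - a) * (int q + 1 - a)) > 0" using True by simp
    show ?thesis
    \<comment> \<open>If D \<ge> 5 then b > q^3 and u exceeds the positive number it should divide.
      If D = 4, u can be smaller than that number, and the number of lines gives the second
      condition.\<close>
    proof (cases "D = 4")
      case D4: True
      have b4: "b = 1 + q + (int q)\<^sup>2" unfolding b_def D4 by (simp add: eval_nat_numeral)
      define N where "N = int (card {C. line C})"
      have "(q + 1) * (q * (a * B - 1) + a) = real_of_int N * a"
        using count_flags unfolding \<beta>_def s_def N_def by (simp add: a(1))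
      then have "real_of_int ((q + 1) * (q * (a * (1 + q * b) - 1) + a)) = real_of_int (N * a)"
        unfolding Bb by simp
      then have "(q + 1) * (q * (a * (1 + q * b) - 1) + a) = N * a" by (simp only: of_int_eq_iff)
      then have "int a * ((int q + 1) * (q * (1 + q * b) + 1) - N) = int q * (int q + 1)"
        by (simp add: algebra_simps)
      then have False
        by (rule no_small_line_parameter[rotated 2, where u = u])
          (use True a dvd in \<open>auto simp: u_def b4\<close>)
      then show ?thesis ..
    next
      case False
      have "(\<Sum>k<4. int q ^ k) \<le> b" unfolding b_def using False D_ge by (intro sum_mono2) auto
      then have b5: "1 + q + (int q)\<^sup>2 + int q ^ 3 \<le> b" by (simp add: eval_nat_numeral)
      have "(int q - a) * (int q + 1 - a) \<le> (int q - 1) * int q"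
        using a(2) True by (intro mult_mono) auto
      then have "(int q + 1) * ((int q - a) * (int q + 1 - a)) \<le> (int q + 1) * ((int q - 1) * int q)"
        by (intro mult_left_mono) auto
      also have "\<dots> \<le> int q ^ 3" by (simp add: algebra_simps power3_eq_cube)
      also have "\<dots> < b" using b5 zero_le_power2[of "int q"] by linarith
      also have "b \<le> int a * b" using a(2) \<open>b \<ge> 0\<close> by (simp add: mult_le_cancel_right1)
      also have "\<dots> < u" by (simp add: u_def)
      finally show ?thesis using zdvd_imp_le[OF dvd pos] by simp
    qed
  qed
qed

end

section \<open>The parameter \<open>\<alpha>\<close>\<close>

context uniform_thin_graph
begin

lemma ex_local_nonadjacent: obtains y z where "G x y" "G x z" "y \<noteq> z" "\<not> G y z"
proof -
  have "card {z. G x z} > 0" using card_neighbours[of x] bb_pos[of 0] D_ge by linarith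
  then obtain y where y: "G x y" by (auto simp: card_gt_0_iff)
  then have "real (card {z. G x z \<and> gdist G z y = 1 + 1}) = bb 1" by (intro card_farther) simp
  then have "card {z. G x z \<and> gdist G z y = 2} > 0" using bb_pos[of 1] D_ge by (simp add: numeral_2_eq_2)
  then obtain z where z: "G x z" "gdist G z y = 2" by (auto simp: card_gt_0_iff)
  then have "y \<noteq> z" by auto
  moreover have "\<not> G y z" using z(2) gdist_eq_1[of z y] adj_sym[of y z] by auto
  ultimately show thesis using that y z(1) by blast
qed

theorem alpha_q_cases: "\<alpha> \<in> {q, q + 1}"
proof -
  have
    \<beta>: "\<beta> = \<alpha> * br (D + 1) - q" and
    common: "\<And>y z. G x y \<Longrightarrow> G x z \<Longrightarrow> real (card {t. G x t \<and> G y t \<and> G z t})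
        = (if y = z then aa 1 else if G y z then \<alpha> * (1 + q) + \<alpha> * q * br (D - 1) - q - 2 else \<alpha> * (1 + q))"
    using local_graph by blast+
  obtain y z where yz: "G x y" "G x z" "y \<noteq> z" "\<not> G y z" by (rule ex_local_nonadjacent)
  define m where "m = card {t. G x t \<and> G y t \<and> G z t}"
  have m: "\<alpha> * (1 + q) = m" using common[OF yz(1,2)] yz(3,4) by (simp add: m_def)
  then have "0 \<le> \<alpha> * (1 + q)" by simp
  then have "\<alpha> \<ge> 0" using q_ge by (simp add: zero_le_mult_iff)
  then have alpha_pos: "\<alpha> > 0" using alpha_nz by simp
  \<comment> \<open>q is real so far. Subtracting m = \<alpha>(1 + q) and 1 from the count
    \<open>cc 2\<close> = (1 + q)(1 + \<alpha>) leaves q, which is therefore an integer.\<close>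
  obtain y2 t2 where y2: "gdist G y2 t2 = 2" using ex_gdist[of 2] gdiam_eq D_ge by auto
  define c where "c = card {z. G y2 z \<and> gdist G z t2 = 2 - 1}"
  have c: "cc 2 = real c" using card_closer[OF y2] by (simp add: c_def)
  have "q = real c - 1 - real m"
    using c m by (simp add: cc_def numeral_2_eq_2 qbracket_Suc algebra_simps)
  then have qc: "q = real_of_int (int c - 1 - int m)" by simp
  then have "int c - 1 - int m \<ge> 2" using q_ge by linarith
  then obtain k :: nat where k: "int c - 1 - int m = int k" "k \<ge> 2"
    by (intro that[of "nat (int c - 1 - int m)"]) auto
  then have qk: "q = real k" using qc by simp
  have brD: "\<alpha> * br D = \<alpha> + \<alpha> * q * br (D - 1)" unfolding br_D_1 by (simp add: algebra_simps)
  interpret pg: pseudo_geometric "{t. G x t}" G k D \<alpha>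
  proof
    show "real (card {t. G x t}) = qbracket (real k) D * (\<alpha> * qbracket (real k) (D + 1) - real k)"
      unfolding card_neighbours qk[symmetric] \<beta>[symmetric] by (simp add: bb_def)
    fix y z assume "y \<in> {t. G x t}" "z \<in> {t. G x t}"
    then have yz: "G x y" "G x z" by auto
    have "aa 1 = (real k + 1) * (\<alpha> * qbracket (real k) D - 1)"
      unfolding aa_1 unfolding \<beta> qk[symmetric] by (simp add: qbracket_Suc br_D_1 algebra_simps)
    then show "real (card {t \<in> {t. G x t}. G y t \<and> G z t}) =
      (if y = z then (real k + 1) * (\<alpha> * qbracket (real k) D - 1)
       else if G y z then \<alpha> * qbracket (real k) D - 2 + real k * (\<alpha> - 1) else \<alpha> * (real k + 1))"
      using common[OF yz] brD unfolding qk[symmetric] by (auto simp: algebra_simps)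
  next
    show "\<exists>y\<in>{t. G x t}. \<exists>z\<in>{t. G x t}. y \<noteq> z \<and> \<not> G y z" using yz by blast
  qed (use adj_sym k D_ge alpha_pos in auto)
  show ?thesis using pg.alpha_cases unfolding qk by simp
qed

end

theorem theorem7p4:
  fixes G :: "'v::finite graph" and x :: 'v
    and D :: nat and q \<alpha> \<beta> :: real
  assumes "connected_simple_graph G"
    and "distance_regular G"
    and "\<not> bipartite G"
    and "classical_parameters G D q \<alpha> \<beta>"
    and "D \<ge> 4" and "q \<ge> 2"
    and "\<And>W. irreducible_T_module G x W \<Longrightarrow> endpoint G x W = 1 \<Longrightarrow> thin G x W"
    and "supports_uniform_structure G x"
    and "\<alpha> \<noteq> 0"
  shows "\<alpha> \<in> {q, q + 1}"
proof -
  interpret uniform_thin_graph G D q \<alpha> \<beta> x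
    using assms by unfold_locales
  show ?thesis by (rule alpha_q_cases)
qed

end
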